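(* Let $\mathcal X: y^m=f(x)$ be a Kummer curve over $\mathbb F_q$ and let $Q_1,\dots,Q_n$ be pairwise distinct totally ramified places of $\mathbb F_q(\mathcal X)/\mathbb F_q(x)$ lying over $P_1,\dots,P_n$, all as described in the context. Assume $2\le n\le q$. Let $(\alpha_1',\dots,\alpha_n')\in\mathbb Z^n$ and $D=\sum_{k=1}^n\alpha_k'Q_k$. (i) $D$ is a non-special divisor of degree $g(\mathcal X)-1$ if and only if $$\sum_{k=1}^{n}\left\lfloor\frac{\alpha_k'}{m}\right\rfloor=-1\quad\text{and}\quad n+\sum_{k=1}^{n}\left\lfloor\frac{\alpha_k'-t_k(i)}{m}\right\rfloor=\beta(i)\ \text{ for every }1\le i\le m-1.$$ (ii) Write $\alpha_k'=mj_k+\alpha_k$ with $j_k\in\mathbb Z$ and $0\le\alpha_k\le m-1$ for $k=1,\dots,n$. Then $D$ is a non-special divisor of degree $g(\mathcal X)-1$ if and only if $$\sum_{k=1}^{n}j_k=-1\quad\text{and}\quad \beta(i)=n-1+\sum_{k=1}^{n}\left\lfloor\frac{\alpha_k-t_k(i)}{m}\right\rfloor\ \text{ for every }1\le i\le m-1.$$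
   Context: Let $\mathbb F_q$ be the finite field with $q$ elements, $m\ge 2$ an integer with $\operatorname{char}(\mathbb F_q)\nmid m$, and $f(x)\in\mathbb F_q[x]$ a polynomial with $\deg f\ge 2$, all of whose roots lie in $\mathbb F_q$, and which is not a $d$-th power of an element of $\mathbb F_q(x)$ for any divisor $d\ge 2$ of $m$. Let $\mathcal X$ be the curve $y^m=f(x)$, with function field $\mathbb F_q(\mathcal X)=\mathbb F_q(x,y)$, whose genus $g(\mathcal X)$ is assumed to be at least $1$. Let $P_1,\dots,P_r$ be all the places of $\mathbb F_q(x)$ that are zeros or the pole of $f(x)$, and let $\lambda_k=\nu_{P_k}(f)$ be the valuation of $f$ at $P_k$ (so $\lambda_k=-\deg f$ if $P_k$ is the pole). For some $n\le r$, the places $P_1,\dots,P_n$ (possibly including the pole of $f$) are assumed totally ramified in $\mathbb F_q(\mathcal X)/\mathbb F_q(x)$, and $Q_k$ is the unique place of $\mathbb F_q(\mathcal X)$ over $P_k$, $1\le k\le n$. For $1\le i\le m-1$ put $$t_k(i)=(i\lambda_k)\bmod m\ \ (1\le k\le n),\qquad \beta(i)=\sum_{k=1}^{r}\left\lceil\frac{i\lambda_k}{m}\right\rceil-1,$$ where $b\bmod m$ is the smallest non-negative integer congruent to $b$ modulo $m$. A divisor $G$ of a function field of genus $g$ is non-special if $\ell(G)=\deg(G)+1-g$, where $\ell(G)$ is the dimension of the Riemann-Roch space $\mathcal L(G)$. *)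

theory Defs
  imports
    "HOL-Computational_Algebra.Computational_Algebra"
    "HOL-Algebra.Algebraic_Closure_Type"
    "HOL-Library.Poly_Mapping"
begin

section \<open>Places, valuations and divisors of a function field\<close>

text \<open>
  A function field is a type \<open>'f\<close> of class \<^class>\<open>field\<close> together with the embedding
  \<open>\<iota> :: 'k \<Rightarrow> 'f\<close> of its constant field. A place is a maximal ideal of a valuation ring and is
  thus a set of field elements.
\<close>

definition field_hom :: "('a::field \<Rightarrow> 'b::field) \<Rightarrow> bool" where
  "field_hom h \<longleftrightarrow> h 1 = 1 \<and> (\<forall>a b. h (a + b) = h a + h b) \<and> (\<forall>a b. h (a * b) = h a * h b)"

definition is_subring :: "'f::field set \<Rightarrow> bool" where
  "is_subring R \<longleftrightarrow> 1 \<in> R \<and> (\<forall>a\<in>R. \<forall>b\<in>R. a - b \<in> R \<and> a * b \<in> R)"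

definition is_subfield :: "'f::field set \<Rightarrow> bool" where
  "is_subfield R \<longleftrightarrow> is_subring R \<and> (\<forall>a\<in>R. inverse a \<in> R)"

definition valuation_ring :: "('k::field \<Rightarrow> 'f::field) \<Rightarrow> 'f set \<Rightarrow> bool" where
  "valuation_ring \<iota> R \<longleftrightarrow>
     is_subring R \<and> range \<iota> \<subset> R \<and> R \<subset> UNIV \<and> (\<forall>z. z \<in> R \<or> inverse z \<in> R)"

definition is_ideal :: "'f::field set \<Rightarrow> 'f set \<Rightarrow> bool" where
  "is_ideal J R \<longleftrightarrow> J \<subseteq> R \<and> 0 \<in> J \<and> (\<forall>a\<in>J. \<forall>b\<in>J. a + b \<in> J) \<and> (\<forall>a\<in>J. \<forall>c\<in>R. c * a \<in> J)"

definition is_maximal_ideal :: "'f::field set \<Rightarrow> 'f set \<Rightarrow> bool" where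
  "is_maximal_ideal J R \<longleftrightarrow>
     is_ideal J R \<and> J \<noteq> R \<and> (\<forall>I. is_ideal I R \<and> J \<subseteq> I \<longrightarrow> I = J \<or> I = R)"

definition place :: "('k::field \<Rightarrow> 'f::field) \<Rightarrow> 'f set \<Rightarrow> bool" where
  "place \<iota> P \<longleftrightarrow> (\<exists>R. valuation_ring \<iota> R \<and> is_maximal_ideal P R)"

text \<open>
  The valuation ring is determined by its maximal ideal \<open>P\<close> as the set of \<open>z\<close> with
  \<open>z\<^sup>-\<^sup>1 \<notin> P\<close>; the element \<open>0\<close> has to be added by hand because \<open>inverse 0 = 0\<close>.
\<close>

definition place_ring :: "'f::field set \<Rightarrow> 'f set" where
  "place_ring P = {z. z = 0 \<or> inverse z \<notin> P}"

definition prime_element :: "'f::field set \<Rightarrow> 'f \<Rightarrow> bool" where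
  "prime_element P t \<longleftrightarrow> P = (\<lambda>a. t * a) ` place_ring P"

text \<open>Only meaningful for \<open>z \<noteq> 0\<close>; the value \<open>\<infinity>\<close> at \<open>0\<close> is not represented.\<close>

definition val :: "'f::field set \<Rightarrow> 'f \<Rightarrow> int" where
  "val P z = (THE n. \<exists>t u. prime_element P t \<and> u \<in> place_ring P - {0} \<and>
     inverse u \<in> place_ring P \<and> z = t powi n * u)"

text \<open>
  The dimension over the constant field of the residue field \<open>place_ring P / P\<close>: the number of
  elements \<open>z 0, \<dots>, z (n - 1)\<close> of the valuation ring whose residue classes form a basis.
\<close>

definition place_degree :: "('k::field \<Rightarrow> 'f::field) \<Rightarrow> 'f set \<Rightarrow> nat" where
  "place_degree \<iota> P = (THE n. \<exists>z :: nat \<Rightarrow> 'f. (\<forall>i<n. z i \<in> place_ring P) \<and>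
     (\<forall>w\<in>place_ring P. \<exists>!c :: nat \<Rightarrow> 'k.
        (\<forall>i\<ge>n. c i = 0) \<and> w - (\<Sum>i<n. \<iota> (c i) * z i) \<in> P))"

text \<open>Divisors are elements of the free abelian group on the places.\<close>

type_synonym 'f divisor = "'f set \<Rightarrow>\<^sub>0 int"

definition is_divisor :: "('k::field \<Rightarrow> 'f::field) \<Rightarrow> 'f divisor \<Rightarrow> bool" where
  "is_divisor \<iota> A \<longleftrightarrow> (\<forall>P\<in>Poly_Mapping.keys A. place \<iota> P)"

definition div_degree :: "('k::field \<Rightarrow> 'f::field) \<Rightarrow> 'f divisor \<Rightarrow> int" where
  "div_degree \<iota> A =
     (\<Sum>P\<in>Poly_Mapping.keys A. Poly_Mapping.lookup A P * int (place_degree \<iota> P))"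

definition riemann_roch_space :: "('k::field \<Rightarrow> 'f::field) \<Rightarrow> 'f divisor \<Rightarrow> 'f set" where
  "riemann_roch_space \<iota> A =
     {z. z = 0 \<or> (\<forall>P. place \<iota> P \<longrightarrow> val P z \<ge> - Poly_Mapping.lookup A P)}"

definition ell :: "('k::field \<Rightarrow> 'f::field) \<Rightarrow> 'f divisor \<Rightarrow> nat" where
  "ell \<iota> A = vector_space.dim (\<lambda>c z. \<iota> c * z) (riemann_roch_space \<iota> A)"

definition genus :: "('k::field \<Rightarrow> 'f::field) \<Rightarrow> int" where
  "genus \<iota> = (GREATEST g. \<exists>A. is_divisor \<iota> A \<and> g = div_degree \<iota> A - int (ell \<iota> A) + 1)"

definition non_special :: "('k::field \<Rightarrow> 'f::field) \<Rightarrow> 'f divisor \<Rightarrow> bool" where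
  "non_special \<iota> A \<longleftrightarrow> int (ell \<iota> A) = div_degree \<iota> A + 1 - genus \<iota>"

section \<open>Extensions of function fields\<close>

text \<open>
  Here \<open>\<phi> :: 'e \<Rightarrow> 'f\<close> is the embedding of the smaller function field, and \<open>\<iota>\<close> that of the
  constant field into \<open>'e\<close>; \<open>\<phi> \<circ> \<iota>\<close> embeds the constant field into \<open>'f\<close>.
\<close>

definition ext_degree :: "('e::field \<Rightarrow> 'f::field) \<Rightarrow> nat" where
  "ext_degree \<phi> = vector_space.dim (\<lambda>a z. \<phi> a * z) UNIV"

definition lies_over ::
    "('k::field \<Rightarrow> 'e::field) \<Rightarrow> ('e \<Rightarrow> 'f::field) \<Rightarrow> 'f set \<Rightarrow> 'e set \<Rightarrow> bool" where
  "lies_over \<iota> \<phi> Q P \<longleftrightarrow> place (\<phi> \<circ> \<iota>) Q \<and> place \<iota> P \<and> \<phi> ` P \<subseteq> Q"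

definition ramification_index :: "('e::field \<Rightarrow> 'f::field) \<Rightarrow> 'f set \<Rightarrow> 'e set \<Rightarrow> nat" where
  "ramification_index \<phi> Q P = (THE e. \<forall>z. z \<noteq> 0 \<longrightarrow> val Q (\<phi> z) = int e * val P z)"

definition totally_ramified ::
    "('k::field \<Rightarrow> 'e::field) \<Rightarrow> ('e \<Rightarrow> 'f::field) \<Rightarrow> 'e set \<Rightarrow> bool" where
  "totally_ramified \<iota> \<phi> P \<longleftrightarrow>
     (\<exists>Q. (\<forall>Q'. lies_over \<iota> \<phi> Q' P \<longleftrightarrow> Q' = Q) \<and> ramification_index \<phi> Q P = ext_degree \<phi>)"

section \<open>Kummer curves\<close>

text \<open>The rational function field over \<open>'a\<close> is the type \<open>'a poly fract\<close>.\<close>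

definition rat_const :: "'a::field \<Rightarrow> 'a poly fract" where
  "rat_const a = to_fract [:a:]"

text \<open>\<open>'f\<close> is the field generated by the rational function field and a root \<open>y\<close> of \<open>Y\<^sup>m = f\<close>.\<close>

definition kummer_function_field ::
    "nat \<Rightarrow> 'a::field poly \<Rightarrow> ('a poly fract \<Rightarrow> 'f::field) \<Rightarrow> 'f \<Rightarrow> bool" where
  "kummer_function_field m f \<phi> y \<longleftrightarrow>
     field_hom \<phi> \<and> y ^ m = \<phi> (to_fract f) \<and>
     (\<forall>S. is_subfield S \<and> range \<phi> \<subseteq> S \<and> y \<in> S \<longrightarrow> S = UNIV)"

definition zero_or_pole :: "'a::field poly \<Rightarrow> 'a poly fract set \<Rightarrow> bool" where
  "zero_or_pole f P \<longleftrightarrow> place rat_const P \<and> val P (to_fract f) \<noteq> 0"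

definition lam :: "'a::field poly \<Rightarrow> (nat \<Rightarrow> 'a poly fract set) \<Rightarrow> nat \<Rightarrow> int" where
  "lam f P k = val (P k) (to_fract f)"

definition tk :: "nat \<Rightarrow> (nat \<Rightarrow> int) \<Rightarrow> nat \<Rightarrow> nat \<Rightarrow> int" where
  "tk m l k i = (int i * l k) mod int m"

definition beta :: "nat \<Rightarrow> nat \<Rightarrow> (nat \<Rightarrow> int) \<Rightarrow> nat \<Rightarrow> int" where
  "beta m r l i = (\<Sum>k=1..r. \<lceil>real_of_int (int i * l k) / real m\<rceil>) - 1"

end

(*
The function field F = K(y) over K = F_q(x) is generated by Y = 1/y with Y^m = 1/f. At a totally
ramified place Q over P, the valuation of f at P is prime to m and [F : K] = m, so F has the K-basis
1, Y, ..., Y^(m-1). A function SUM c_i Y^i lies in L(D) iff each summand c_i Y^i does: at the Q_k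
because the valuations of the summands are distinct modulo m; at the other places because m c_i Y^i
is a combination of the conjugates of the function under Y -> zeta Y. Hence L(D) is a direct sum of
Riemann-Roch spaces of the rational function field with divisors of degrees N_0, ..., N_(m-1), and
l(D) = SUM max 0 (N_i + 1), while SUM (N_i + 1) = deg D + 1 - g. So D is non-special of degree g - 1
iff every N_i is -1, and N_i = -1 is the i-th numerical condition.

The genus is the maximum of deg A - l(A) + 1 over all divisors A; it is determined by comparing A
with x Q_k plus a multiple of the zeros of a rational function that has its only pole at Q_k. This
needs the inequality SUM e_i f_i <= [F : K], obtained from weak approximation, and the discreteness
of all places of F; as the constant field is finite, both follow from a counting argument.
*)

theory Submission
  imports Defs
begin

section \<open>Valuation rings and discrete valuations\<close>

text \<open>Using \<open>Y = 1/y\<close> instead of \<open>y\<close>, the coefficient of the i-th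
  power is governed by the floors of (\<alpha>'_k - i \<lambda>_k) / m, so the index i matches
  \<open>t k i\<close> and \<open>\<beta> i\<close> without the substitution i -> m - i. A place is
  given only as a maximal ideal of a valuation ring, while \<open>val\<close>,
  \<open>place_degree\<close> and \<open>genus\<close> are \<open>THE\<close> and
  \<open>GREATEST\<close> terms; discreteness, finite residue degrees and a bound for deg A - l(A)
  are what give them their meaning. That [F : K] equals m is not known at the start, only that it is
  at most m; equality comes out of one totally ramified place together with f not being a d-th
  power. The m-th roots of unity need not lie in F, so conjugates live in the algebraic closure, and
  places of F over P arise by pulling one valuation ring of the closure back along every conjugate
  embedding. The comparison of divisors takes place at a Q_k over a finite point x = a, which exists
  because n >= 2: there the functions U / (x - a)^d with deg U <= d have their only pole.\<close>

locale field_homo =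
  fixes h :: "'a::field \<Rightarrow> 'b::field"
  assumes hom: "field_hom h"
begin

lemma one [simp]: "h 1 = 1" and add [simp]: "h (a + b) = h a + h b"
  and mult [simp]: "h (a * b) = h a * h b"
  using hom by (auto simp: field_hom_def)

lemma zero [simp]: "h 0 = 0"
  using add[of 0 0] by (metis add_cancel_right_right add_0)

lemma uminus [simp]: "h (- a) = - h a"
  using add[of a "- a"] by (simp add: eq_neg_iff_add_eq_0 add.commute)

lemma diff [simp]: "h (a - b) = h a - h b"
  using add[of a "- b"] by simp

lemma eq_0_iff [simp]: "h a = 0 \<longleftrightarrow> a = 0"
proof
  assume "h a = 0"
  show "a = 0"
  proof (rule ccontr)
    assume "a \<noteq> 0"
    then have "h a * h (inverse a) = 1"
      by (simp flip: mult)
    then show False using \<open>h a = 0\<close> by simp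
  qed
qed simp

lemma eq_iff [simp]: "h a = h b \<longleftrightarrow> a = b"
  using eq_0_iff[of "a - b"] by simp

lemma inverse [simp]: "h (inverse a) = inverse (h a)"
proof (cases "a = 0")
  case False
  then have "h a * h (inverse a) = 1" by (simp flip: mult)
  then show ?thesis by (metis inverse_unique)
qed simp

lemma divide [simp]: "h (a / b) = h a / h b"
  by (simp add: divide_inverse)

lemma power [simp]: "h (a ^ n) = h a ^ n"
  by (induction n) auto

lemma sum [simp]: "h (sum f A) = (\<Sum>i\<in>A. h (f i))"
  by (induction A rule: infinite_finite_induct) auto

lemma of_nat [simp]: "h (of_nat n) = of_nat n"
  by (induction n) auto

end

lemma field_homo_comp:
  assumes "field_homo g" "field_homo h"
  shows "field_homo (g \<circ> h)"
  using assms by (simp add: field_homo_def field_hom_def)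

section \<open>Valuation rings and their maximal ideals\<close>

locale subring =
  fixes R :: "'f::field set"
  assumes subring: "is_subring R"
begin

lemma one: "1 \<in> R" and diff: "a \<in> R \<Longrightarrow> b \<in> R \<Longrightarrow> a - b \<in> R"
  and mult: "a \<in> R \<Longrightarrow> b \<in> R \<Longrightarrow> a * b \<in> R"
  using subring by (auto simp: is_subring_def)

lemma zero: "0 \<in> R" using diff[OF one one] by simp

lemma uminus: "a \<in> R \<Longrightarrow> - a \<in> R"
  using diff[OF zero] by fastforce

lemma add: "a \<in> R \<Longrightarrow> b \<in> R \<Longrightarrow> a + b \<in> R"
  using diff[OF _ uminus] by fastforce

lemma power: "a \<in> R \<Longrightarrow> a ^ n \<in> R"
  by (induction n) (auto intro: one mult)

lemma sum: "(\<And>i. i \<in> A \<Longrightarrow> g i \<in> R) \<Longrightarrow> sum g A \<in> R"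
  by (induction A rule: infinite_finite_induct) (auto intro: zero add)

lemma of_nat: "of_nat n \<in> R"
  by (induction n) (auto intro: zero one add)

lemmas closed = zero one uminus diff add mult power sum of_nat

end

text \<open>Leaves out the constant field, so that the same theory serves the base field, F and the
  algebraic closure of F.\<close>

definition val_ring :: "'f::field set \<Rightarrow> bool" where
  "val_ring R \<longleftrightarrow> is_subring R \<and> R \<noteq> UNIV \<and> (\<forall>z. z \<in> R \<or> inverse z \<in> R)"

definition nonunits :: "'f::field set \<Rightarrow> 'f set" where
  "nonunits R = {z \<in> R. z = 0 \<or> inverse z \<notin> R}"

locale valring =
  fixes R :: "'f::field set"
  assumes val_ring: "val_ring R"
begin

sublocale subring R using val_ring by unfold_locales (simp add: val_ring_def)

lemma total: "z \<notin> R \<Longrightarrow> inverse z \<in> R"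
  using val_ring by (auto simp: val_ring_def)

lemma nonunit_mult:
  assumes "a \<in> nonunits R" "c \<in> R" shows "c * a \<in> nonunits R"
proof (cases "c * a = 0")
  case False
  have "inverse (c * a) \<notin> R"
  proof
    assume "inverse (c * a) \<in> R"
    then have "c * inverse (c * a) \<in> R" using assms mult by auto
    then show False using False assms by (auto simp: nonunits_def field_simps)
  qed
  then show ?thesis using assms by (auto simp: nonunits_def mult)
qed (auto simp: nonunits_def zero)

lemma nonunit_add_aux:
  assumes "a \<in> nonunits R" "b \<in> nonunits R" "b \<noteq> 0" "a / b \<in> R" shows "a + b \<in> nonunits R"
proof -
  have "(a / b + 1) * b \<in> nonunits R" using assms by (intro nonunit_mult closed)
  then show ?thesis using assms by (simp add: distrib_right)
qed

text \<open>In a valuation ring one of a / b and b / a is integral, so the sum is a ring multiple of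
  one of the summands.\<close>

lemma nonunit_add:
  assumes "a \<in> nonunits R" "b \<in> nonunits R" shows "a + b \<in> nonunits R"
proof (cases "a = 0 \<or> b = 0")
  case False
  then show ?thesis
    using nonunit_add_aux[of a b] nonunit_add_aux[of b a] assms total[of "a / b"]
    by (auto simp: add.commute)
qed (use assms in auto)

lemma nonunits_ideal: "is_ideal (nonunits R) R"
  unfolding is_ideal_def using nonunit_add nonunit_mult
  by (auto simp: nonunits_def zero)

lemma one_not_nonunit: "1 \<notin> nonunits R"
  by (auto simp: nonunits_def one)

lemma ideal_proper:
  assumes "is_ideal I R" "I \<noteq> R" shows "I \<subseteq> nonunits R"
proof
  fix z assume z: "z \<in> I"
  then have zR: "z \<in> R" using assms by (auto simp: is_ideal_def)
  have "inverse z \<notin> R" if "z \<noteq> 0"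
  proof
    assume "inverse z \<in> R"
    then have "inverse z * z \<in> I" using assms z by (auto simp: is_ideal_def)
    then have "1 \<in> I" using that by simp
    then have "R \<subseteq> I" using assms by (force simp: is_ideal_def)
    then show False using assms by (auto simp: is_ideal_def)
  qed
  then show "z \<in> nonunits R" using zR by (auto simp: nonunits_def)
qed

text \<open>An ideal containing a unit is the whole ring, so every proper ideal sits inside
  \<open>nonunits R\<close>. This turns the definition of a place by maximality into an explicit
  set.\<close>

lemma maximal_ideal_iff: "is_maximal_ideal J R \<longleftrightarrow> J = nonunits R"
proof
  assume J: "is_maximal_ideal J R"
  then have "J \<subseteq> nonunits R" by (intro ideal_proper) (auto simp: is_maximal_ideal_def)
  then show "J = nonunits R"
    using J nonunits_ideal one one_not_nonunit unfolding is_maximal_ideal_def by blast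
next
  assume "J = nonunits R"
  then show "is_maximal_ideal J R"
    using nonunits_ideal one one_not_nonunit ideal_proper unfolding is_maximal_ideal_def by blast
qed

lemma place_ring_nonunits: "place_ring (nonunits R) = R"
  using total zero by (auto simp: place_ring_def nonunits_def)

end

lemma place_iff: "place \<iota> P \<longleftrightarrow> (\<exists>R. valuation_ring \<iota> R \<and> P = nonunits R)"
proof -
  have "valring R" if "valuation_ring \<iota> R" for R
    using that by unfold_locales (auto simp: valuation_ring_def val_ring_def)
  then show ?thesis unfolding place_def using valring.maximal_ideal_iff by blast
qed

lemma place_valring:
  assumes "place \<iota> P"
  shows "val_ring (place_ring P)" "P = nonunits (place_ring P)" "range \<iota> \<subseteq> place_ring P"
proof -
  obtain R where R: "valuation_ring \<iota> R" "P = nonunits R" using assms place_iff by blast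
  then interpret valring R
    by unfold_locales (auto simp: valuation_ring_def val_ring_def)
  have "place_ring P = R" using R place_ring_nonunits by simp
  then show "val_ring (place_ring P)" "P = nonunits (place_ring P)" "range \<iota> \<subseteq> place_ring P"
    using R val_ring by (auto simp: valuation_ring_def)
qed

section \<open>Arithmetic of a discrete valuation\<close>

definition discrete :: "'f::field set \<Rightarrow> bool" where
  "discrete P \<longleftrightarrow> val_ring (place_ring P) \<and> P = nonunits (place_ring P) \<and>
     (\<exists>u. u \<noteq> 0 \<and> u \<in> P \<and> (\<forall>z. z \<noteq> 0 \<longrightarrow>
        (\<exists>n v. v \<noteq> 0 \<and> v \<in> place_ring P \<and> inverse v \<in> place_ring P \<and> z = u powi n * v)))"

text \<open>The convention \<open>v\<^sub>P(0) = \<infinity>\<close>.\<close>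

definition vge :: "'f::field set \<Rightarrow> 'f \<Rightarrow> int \<Rightarrow> bool" where
  "vge P z n \<longleftrightarrow> z = 0 \<or> n \<le> val P z"

text \<open>Here \<open>val\<close> becomes a valuation. That every place of the function fields in
  question is \<open>discrete\<close> is the content of \<open>place_discrete\<close>.\<close>

locale dplace =
  fixes P :: "'f::field set"
  assumes disc: "discrete P"
begin

sublocale valring "place_ring P"
  using disc by unfold_locales (simp add: discrete_def)

abbreviation "R \<equiv> place_ring P"

lemma P_eq: "P = nonunits R"
  using disc by (simp add: discrete_def)

definition "unif = (SOME u. u \<noteq> 0 \<and> u \<in> P \<and> (\<forall>z. z \<noteq> 0 \<longrightarrow>
        (\<exists>n v. v \<noteq> 0 \<and> v \<in> R \<and> inverse v \<in> R \<and> z = u powi n * v)))"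

definition unit where "unit v \<longleftrightarrow> v \<noteq> 0 \<and> v \<in> R \<and> inverse v \<in> R"

lemma unif: "unif \<noteq> 0" "unif \<in> P"
  and decomp: "z \<noteq> 0 \<Longrightarrow> \<exists>n v. unit v \<and> z = unif powi n * v"
proof -
  have ex: "\<exists>u. u \<noteq> 0 \<and> u \<in> P \<and> (\<forall>z. z \<noteq> 0 \<longrightarrow>
        (\<exists>n v. v \<noteq> 0 \<and> v \<in> R \<and> inverse v \<in> R \<and> z = u powi n * v))"
    using disc unfolding discrete_def by blast
  from someI_ex[OF ex, folded unif_def]
  show "unif \<noteq> 0" "unif \<in> P"  "z \<noteq> 0 \<Longrightarrow> \<exists>n v. unit v \<and> z = unif powi n * v"
    unfolding unit_def by blast+
qed

lemma P_iff: "z \<in> P \<longleftrightarrow> z \<in> R \<and> \<not> unit z"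
  using P_eq by (auto simp: nonunits_def unit_def zero)

lemma P_ideal: "a \<in> P \<Longrightarrow> c \<in> R \<Longrightarrow> c * a \<in> P" "a \<in> P \<Longrightarrow> b \<in> P \<Longrightarrow> a + b \<in> P"
  using nonunit_mult nonunit_add P_eq by auto

lemma unit_mult: "unit a \<Longrightarrow> unit b \<Longrightarrow> unit (a * b)"
  and unit_inverse: "unit a \<Longrightarrow> unit (inverse a)"
  and unit_one: "unit 1"
  by (auto simp: unit_def closed)

lemma unit_powi: "unit a \<Longrightarrow> unit (a powi n)"
proof -
  assume a: "unit a"
  have "unit (a ^ k)" for k by (induction k) (auto simp: unit_one unit_mult a)
  then show ?thesis by (auto simp: power_int_def unit_inverse simp flip: power_inverse)
      (metis power_inverse unit_inverse)
qed

lemma unif_powi_R: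
  assumes "unit v" shows "unif powi n * v \<in> R \<longleftrightarrow> 0 \<le> n" "unif powi n * v \<in> P \<longleftrightarrow> 0 < n"
proof -
  have pos: "unif powi k * w \<in> P" if "0 < k" "unit w" for k w
  proof -
    have "unif powi k = unif * unif ^ nat (k - 1)"
      using that unif by (simp add: power_int_def flip: power_Suc)
        (metis Suc_nat_eq_nat_zadd1 add.commute diff_add_cancel zle_diff1_eq)
    then have "unif powi k * w = (unif ^ nat (k - 1) * w) * unif" by simp
    moreover have "unif \<in> R" using unif P_iff by simp
    ultimately show ?thesis using unif that P_ideal by (metis mult power unit_def)
  qed
  have neg: "unif powi k * w \<notin> R" if "k < 0" "unit w" for k w
  proof
    assume "unif powi k * w \<in> R"
    moreover have "unif powi (- k) * inverse w \<in> P" using pos that unit_inverse by simp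
    ultimately have "(unif powi k * w) * (unif powi (- k) * inverse w) \<in> P"
      using P_ideal by blast
    then have "1 \<in> P" using that unif by (simp add: unit_def power_int_minus field_simps)
    then show False using P_iff unit_one by simp
  qed
  have z: "unit (unif powi 0 * w)" if "unit w" for w using that by simp
  show "unif powi n * v \<in> R \<longleftrightarrow> 0 \<le> n" "unif powi n * v \<in> P \<longleftrightarrow> 0 < n"
    using pos[of n v] neg[of n v] z[of v] assms P_iff
    by (cases "n = 0"; cases "n > 0"; auto simp: unit_def)+
qed

lemma prime_unif: "prime_element P unif"
  unfolding prime_element_def
proof (intro equalityI subsetI)
  fix a assume a: "a \<in> P"
  show "a \<in> (\<lambda>a. unif * a) ` R"
  proof (cases "a = 0")
    case False
    then obtain n v where nv: "unit v" "a = unif powi n * v" using decomp by blast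
    then have n: "n > 0" using a unif_powi_R by simp
    have "a = unif * (unif powi (n - 1) * v)" using nv unif by (simp add: power_int_diff)
    moreover have "unif powi (n - 1) * v \<in> R" using unif_powi_R nv n by simp
    ultimately show ?thesis by blast
  next
    case True
    then show ?thesis using zero by (intro image_eqI[of _ _ 0]) auto
  qed
next
  fix a assume "a \<in> (\<lambda>a. unif * a) ` R"
  then show "a \<in> P" using P_ideal(1)[OF unif(2)] by (auto simp: mult.commute)
qed

lemma prime_element_unit:
  assumes "prime_element P t" shows "t \<noteq> 0" "unit (t / unif)"
proof -
  have "unif \<in> (\<lambda>a. t * a) ` R" using assms unif by (simp add: prime_element_def)
  then obtain s where s: "s \<in> R" "unif = t * s" by blast
  then show t0: "t \<noteq> 0" using unif by auto
  have "t \<in> P" using assms one unfolding prime_element_def by (metis image_eqI mult.right_neutral)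
  then have "t \<in> (\<lambda>a. unif * a) ` R" using prime_unif by (simp add: prime_element_def)
  then obtain r where r: "r \<in> R" "t = unif * r" by blast
  have "r = t / unif" using r unif by simp
  moreover have "s = inverse (t / unif)" using s t0 by (simp add: inverse_eq_divide)
  ultimately have "t / unif \<in> R" "inverse (t / unif) \<in> R" using r(1) s(1) by auto
  then show "unit (t / unif)" using t0 unif by (simp add: unit_def)
qed

text \<open>Justifies the \<open>THE\<close> in \<open>val\<close>: prime elements differ from
  \<open>unif\<close> by a unit, so two representations of \<open>z\<close> yield a power of
  \<open>unif\<close> that is a unit, and its exponent \<open>n - k\<close> must be 0.\<close>

lemma val_eqI:
  assumes "prime_element P t" "unit v" "z = t powi n * v" shows "val P z = n"
proof -
  have *: "n = k" if h: "prime_element P t'" "unit v'" "z = t' powi k * v'" for k t' v'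
  proof -
    have e: "s powi j * w = unif powi j * ((s / unif) powi j * w)"
      if "prime_element P s" for s w j
      using unif by (simp add: power_int_divide_distrib)
    have un: "unit ((s / unif) powi j * w)" if "prime_element P s" "unit w" for s w j
      using that unit_mult unit_powi prime_element_unit by blast
    let ?a = "(t / unif) powi n * v" and ?b = "(t' / unif) powi k * v'"
    have u: "unit ?a" "unit ?b" using un assms h by auto
    then have ab: "unit (?a * inverse ?b)" "?b \<noteq> 0"
      using unit_mult unit_inverse by (blast, simp add: unit_def)
    have "unif powi n * ?a = unif powi k * ?b" using assms h e by metis
    then have "unif powi n * (?a * inverse ?b) = unif powi k"
      using ab(2) by (metis divide_inverse mult.assoc nonzero_mult_div_cancel_right)
    then have "unif powi (n - k) * (?a * inverse ?b) = 1"
      using unif by (simp add: power_int_diff)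
    then have "0 \<le> n - k" "\<not> 0 < n - k" using unif_powi_R[OF ab(1), of "n - k"] one P_iff unit_one
      by simp_all
    then show ?thesis by simp
  qed
  show ?thesis unfolding val_def
  proof (rule the_equality)
    show "\<exists>t u. prime_element P t \<and> u \<in> R - {0} \<and> inverse u \<in> R \<and> z = t powi n * u"
      using assms unfolding unit_def by blast
  next
    fix k assume "\<exists>t u. prime_element P t \<and> u \<in> R - {0} \<and> inverse u \<in> R \<and> z = t powi k * u"
    then show "k = n" using * unfolding unit_def by blast
  qed
qed

lemma val_decomp: "z \<noteq> 0 \<Longrightarrow> \<exists>v. unit v \<and> z = unif powi val P z * v"
  using decomp val_eqI[OF prime_unif] by blast

lemma val_unit: "unit v \<Longrightarrow> val P v = 0"
  using val_eqI[OF prime_unif, of v v 0] by simp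

lemma val_one [simp]: "val P 1 = 0"
  using val_unit unit_one by simp

lemma val_prime: "prime_element P t \<Longrightarrow> val P t = 1"
  using val_eqI[of t 1 t 1] unit_one by simp

lemma val_unif [simp]: "val P unif = 1"
  using val_prime prime_unif by simp

lemma val_mult: "a \<noteq> 0 \<Longrightarrow> b \<noteq> 0 \<Longrightarrow> val P (a * b) = val P a + val P b"
proof -
  assume ab: "a \<noteq> 0" "b \<noteq> 0"
  obtain v w where v: "unit v" "a = unif powi val P a * v"
    and w: "unit w" "b = unif powi val P b * w"
    using ab val_decomp by meson
  have "a * b = (unif powi val P a * v) * (unif powi val P b * w)"
    unfolding v(2)[symmetric] w(2)[symmetric] ..
  then have "a * b = unif powi (val P a + val P b) * (v * w)"
    using unif by (simp add: power_int_add mult_ac)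
  moreover have "unit (v * w)" using v w unit_mult by simp
  ultimately show ?thesis using val_eqI[OF prime_unif] by blast
qed

lemma val_inverse: "a \<noteq> 0 \<Longrightarrow> val P (inverse a) = - val P a"
  using val_mult[of a "inverse a"] by simp

lemma val_divide: "a \<noteq> 0 \<Longrightarrow> b \<noteq> 0 \<Longrightarrow> val P (a / b) = val P a - val P b"
  using val_mult[of a "inverse b"] val_inverse by (simp add: divide_inverse)

lemma val_power: "a \<noteq> 0 \<Longrightarrow> val P (a ^ n) = int n * val P a"
  by (induction n) (auto simp: val_mult algebra_simps)

lemma val_powi: "a \<noteq> 0 \<Longrightarrow> val P (a powi n) = n * val P a"
  by (auto simp: power_int_def val_power power_inverse[symmetric] val_inverse)

lemma val_prod: "(\<And>i. i \<in> A \<Longrightarrow> g i \<noteq> 0) \<Longrightarrow> val P (prod g A) = (\<Sum>i\<in>A. val P (g i))"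
  by (induction A rule: infinite_finite_induct) (auto simp: val_mult)

lemma vge_0 [simp]: "vge P 0 n" by (simp add: vge_def)

lemma vge_iff: "vge P z n \<longleftrightarrow> unif powi (- n) * z \<in> R"
proof (cases "z = 0")
  case False
  obtain v where v: "unit v" "z = unif powi val P z * v" using False val_decomp by blast
  have "unif powi (- n) * z = unif powi (val P z - n) * v"
    using unif by (subst v(2)) (simp add: power_int_diff power_int_minus field_simps)
  then show ?thesis using unif_powi_R(1)[OF v(1), of "val P z - n"] False by (simp add: vge_def)
qed (simp add: zero)

lemma R_iff: "z \<in> R \<longleftrightarrow> vge P z 0"
  using vge_iff[of z 0] by simp

lemma P_vge: "z \<in> P \<longleftrightarrow> vge P z 1"
proof (cases "z = 0")
  case False
  obtain v where v: "unit v" "z = unif powi val P z * v" using False val_decomp by blast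
  show ?thesis using unif_powi_R(2)[OF v(1), of "val P z"] False
    unfolding v(2)[symmetric] by (auto simp: vge_def)
qed (auto simp: P_iff unit_def zero)

lemma vge_add: "vge P a n \<Longrightarrow> vge P b n \<Longrightarrow> vge P (a + b) n"
  and vge_diff: "vge P a n \<Longrightarrow> vge P b n \<Longrightarrow> vge P (a - b) n"
  and vge_uminus: "vge P a n \<Longrightarrow> vge P (- a) n"
  unfolding vge_iff using add diff uminus by (auto simp: algebra_simps)

lemma vge_sum: "(\<And>i. i \<in> A \<Longrightarrow> vge P (g i) n) \<Longrightarrow> vge P (sum g A) n"
  by (induction A rule: infinite_finite_induct) (auto intro: vge_add)

lemma vge_mult: "vge P a n \<Longrightarrow> vge P b k \<Longrightarrow> vge P (a * b) (n + k)"
  by (cases "a = 0"; cases "b = 0") (auto simp: vge_def val_mult)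

lemma vge_mono: "vge P a n \<Longrightarrow> k \<le> n \<Longrightarrow> vge P a k"
  by (auto simp: vge_def)

lemma vge_mult_iff: "a \<noteq> 0 \<Longrightarrow> vge P (a * b) n \<longleftrightarrow> vge P b (n - val P a)"
  by (cases "b = 0") (auto simp: vge_def val_mult)

lemma val_uminus: "val P (- a) = val P a"
proof (cases "a = 0")
  case False
  have "val P (- a) \<ge> val P a" using vge_uminus[of a "val P a"] False by (simp add: vge_def)
  moreover have "val P a \<ge> val P (- a)"
    using vge_uminus[of "- a" "val P (- a)"] False by (simp add: vge_def)
  ultimately show ?thesis by simp
qed simp

text \<open>Strict triangle inequality: if the sum had larger valuation than \<open>a\<close>,
  subtracting \<open>b\<close> would give \<open>a\<close> a larger valuation than it has.\<close>

lemma val_add_eq: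
  assumes "a \<noteq> 0" "vge P b (val P a + 1)" shows "a + b \<noteq> 0" "val P (a + b) = val P a"
proof -
  show ne: "a + b \<noteq> 0"
  proof
    assume "a + b = 0"
    then have "b = - a" by (simp add: eq_neg_iff_add_eq_0 add.commute)
    then show False using assms by (simp add: vge_def val_uminus)
  qed
  have "vge P (a + b) (val P a)"
    using assms by (intro vge_add) (auto simp: vge_def)
  moreover have "\<not> vge P (a + b) (val P a + 1)"
    using vge_diff[of "a + b" "val P a + 1" b] assms by (auto simp: vge_def)
  ultimately show "val P (a + b) = val P a" using ne by (simp add: vge_def)
qed

text \<open>The minimum is attained by a single term, which the others cannot cancel. At totally
  ramified places this rules out cancellation between the powers of \<open>Y\<close>.\<close>

lemma val_sum_distinct:
  assumes "finite I" "I \<noteq> {}" "\<And>i. i \<in> I \<Longrightarrow> a i \<noteq> 0" "inj_on (\<lambda>i. val P (a i)) I"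
  shows "sum a I \<noteq> 0 \<and> val P (sum a I) = Min ((\<lambda>i. val P (a i)) ` I)"
proof -
  let ?v = "\<lambda>i. val P (a i)"
  have "Min (?v ` I) \<in> ?v ` I" using assms by (intro Min_in) auto
  then obtain k where k: "k \<in> I" "?v k = Min (?v ` I)" by auto
  have "vge P (\<Sum>i\<in>I - {k}. a i) (?v k + 1)"
  proof (intro vge_sum)
    fix i assume i: "i \<in> I - {k}"
    then have "?v i \<ge> ?v k" using assms k by simp
    moreover have "?v i \<noteq> ?v k" using i k inj_onD[OF assms(4), of i k] by auto
    ultimately show "vge P (a i) (?v k + 1)" by (simp add: vge_def)
  qed
  from val_add_eq[OF assms(3)[OF k(1)] this] show ?thesis
    using k assms by (simp add: sum.remove)
qed

end

text \<open>A discrete valuation ring is maximal among proper subrings; this is the form used to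
  identify places. The larger ring has the smaller ideal, and an element of it with negative
  valuation at \<open>P\<close> would, through its powers, push a uniformizer of \<open>P'\<close>
  out of \<open>P\<close>.\<close>

lemma place_ring_mono_eq:
  assumes "discrete P" "discrete P'" "place_ring P \<subseteq> place_ring P'" shows "P = P'"
proof -
  interpret p: dplace P by unfold_locales fact
  interpret p': dplace P' by unfold_locales fact
  have sub: "P' \<subseteq> P"
  proof
    fix z assume z: "z \<in> P'"
    then have "z = 0 \<or> inverse z \<notin> place_ring P'" using p'.P_eq by (auto simp: nonunits_def)
    then have "z = 0 \<or> inverse z \<notin> place_ring P" using assms by auto
    then show "z \<in> P" using p.P_eq p.total[of "inverse z"] p.zero by (auto simp: nonunits_def)
  qed
  have "place_ring P' \<subseteq> place_ring P"
  proof (rule ccontr)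
    assume "\<not> place_ring P' \<subseteq> place_ring P"
    then obtain z where z: "z \<in> place_ring P'" "z \<notin> place_ring P" by auto
    then have z0: "z \<noteq> 0" "val P z < 0" using p.zero p.R_iff by (auto simp: vge_def)
    \<comment> \<open>Large enough for \<open>z ^ N\<close> to cancel the valuation of
      \<open>p'.unif\<close> at \<open>P\<close>, since \<open>val P z\<close> is at most
      -1.\<close>
    define N where "N = nat (val P p'.unif)"
    have "z ^ N * p'.unif \<in> P'" using z by (intro p'.P_ideal p'.unif p'.power)
    then have "vge P (z ^ N * p'.unif) 1" using sub p.P_vge by blast
    then have "0 < val P (z ^ N * p'.unif)" using z0 p'.unif by (simp add: vge_def)
    also have "\<dots> = int N * val P z + val P p'.unif" using z0 p'.unif by (simp add: p.val_mult p.val_power)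
    also have "\<dots> \<le> int N * (-1) + val P p'.unif" using z0 by (intro add_right_mono mult_left_mono) auto
    also have "\<dots> \<le> 0" by (simp add: N_def)
    finally show False by simp
  qed
  then have "place_ring P = place_ring P'" using assms by auto
  then show ?thesis using p.P_eq p'.P_eq by simp
qed

section \<open>Places of finite extensions of the rational function field\<close>

lemma card_polys_le:
  "finite {p :: 'a::{field,finite} poly. degree p \<le> N}"
  "card {p :: 'a poly. degree p \<le> N} \<le> card (UNIV :: 'a set) ^ (N + 1)"
proof -
  let ?r = "\<lambda>p :: 'a poly. restrict (coeff p) {..N}"
  have inj: "inj_on ?r {p. degree p \<le> N}"
  proof (rule inj_onI, rule poly_eqI)
    fix p q :: "'a poly" and n
    assume pq: "p \<in> {p. degree p \<le> N}" "q \<in> {p. degree p \<le> N}" "?r p = ?r q"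
    show "coeff p n = coeff q n"
    proof (cases "n \<le> N")
      case True
      then show ?thesis using fun_cong[OF pq(3), of n] by simp
    next
      case False
      then show ?thesis using pq by (simp add: coeff_eq_0)
    qed
  qed
  have sub: "?r ` {p. degree p \<le> N} \<subseteq> ({..N} \<rightarrow>\<^sub>E UNIV)" by (auto simp: PiE_def)
  have fin: "finite ({..N} \<rightarrow>\<^sub>E (UNIV :: 'a set))" by (intro finite_PiE) auto
  show "finite {p :: 'a poly. degree p \<le> N}"
    using inj_on_finite[OF inj sub fin] .
  have "card {p :: 'a poly. degree p \<le> N} \<le> card ({..N} \<rightarrow>\<^sub>E (UNIV :: 'a set))"
    using card_inj_on_le[OF inj sub fin] .
  then show "card {p :: 'a poly. degree p \<le> N} \<le> card (UNIV :: 'a set) ^ (N + 1)"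
    by (simp add: card_PiE)
qed

lemma rat_const_hom: "field_homo (rat_const :: 'a::field \<Rightarrow> _)"
  by unfold_locales (auto simp: field_hom_def rat_const_def simp flip: to_fract_add to_fract_mult,
      auto simp: one_pCons[symmetric])

lemma to_fract_surj: "\<exists>a b. b \<noteq> 0 \<and> z = to_fract a / to_fract b"
  by (metis Fract_conv_to_fract Fract_cases)

text \<open>The powers of \<open>Y\<close> are only required to span, so [F : K] may be smaller than
  \<open>m\<close>. Independence is added in \<open>kummer_ext\<close>, after total ramification has
  provided it.\<close>

locale ff =
  fixes \<phi> :: "'a::{field,finite} poly fract \<Rightarrow> 'f::field" and Y :: 'f and m :: nat
    and f0 :: "'a poly fract"
  assumes hom: "field_hom \<phi>" and m: "0 < m" and Ym: "Y ^ m = \<phi> f0" and f0: "f0 \<noteq> 0"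
    and gen: "\<exists>c. z = (\<Sum>i<m. \<phi> (c i) * Y ^ i)"
begin

sublocale phi: field_homo \<phi> by unfold_locales (rule hom)
sublocale rc: field_homo "rat_const :: 'a \<Rightarrow> _" by (rule rat_const_hom)

abbreviation \<iota> :: "'a \<Rightarrow> 'f" where "\<iota> \<equiv> \<phi> \<circ> rat_const"

sublocale iota: field_homo \<iota>
  by (intro field_homo_comp) unfold_locales

abbreviation pol :: "'a poly \<Rightarrow> 'f" where "pol p \<equiv> \<phi> (to_fract p)"

lemma pol_smult: "pol (smult c p) = \<phi> (rat_const c) * pol p"
  by (simp add: rat_const_def flip: phi.mult to_fract_mult)

lemma to_fract_power: "to_fract (p ^ n) = to_fract p ^ n" for p :: "'a poly"
  by (induction n) auto

lemma q_ge_2: "2 \<le> card (UNIV :: 'a set)"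
proof -
  have "card {0, 1 :: 'a} \<le> card (UNIV :: 'a set)" by (intro card_mono) auto
  then show ?thesis by simp
qed

lemma common_denominator:
  assumes "finite I"
  shows "\<exists>b g. b \<noteq> 0 \<and> (\<forall>i\<in>I. pol b * w i = (\<Sum>j<m. pol (g i j) * Y ^ j))"
proof -
  have "\<forall>i. \<exists>c. w i = (\<Sum>j<m. \<phi> (c j) * Y ^ j)" using gen by blast
  then obtain c where c: "\<And>i. w i = (\<Sum>j<m. \<phi> (c i j) * Y ^ j)" by metis
  have "\<exists>n e. e \<noteq> 0 \<and> c i j = to_fract n / to_fract e" for i j using to_fract_surj by blast
  then obtain n e where ne: "\<And>i j. e i j \<noteq> 0" "\<And>i j. c i j = to_fract (n i j) / to_fract (e i j)"
    by metis
  define b where "b = (\<Prod>(i, j)\<in>I \<times> {..<m}. e i j)"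
  define g where "g i j = n i j * (b div e i j)" for i j
  have "b \<noteq> 0" unfolding b_def using ne assms by auto
  moreover have "pol b * \<phi> (c i j) = pol (g i j)" if "i \<in> I" "j < m" for i j
  proof -
    have "e i j dvd b" unfolding b_def using dvd_prodI[of "I \<times> {..<m}" "(i, j)" "\<lambda>(i, j). e i j"]
      assms that by auto
    then have "b = e i j * (b div e i j)" by simp
    then have "to_fract b = to_fract (e i j) * to_fract (b div e i j)" by (metis to_fract_mult)
    then have "to_fract b * c i j = to_fract (g i j)" unfolding ne(2) g_def using ne(1) by simp
    then show ?thesis by (metis phi.mult)
  qed
  ultimately show ?thesis
    by (intro exI[of _ b] exI[of _ g]) (auto simp: c sum_distrib_left simp flip: mult.assoc)
qed

text \<open>This replaces the computation of \<open>[F : k(t)]\<close>: as \<open>k\<close> is finite, one counts the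
  elements of \<open>F\<close> with bounded degrees and a fixed denominator.\<close>

lemma card_le_if_indep_powers:
  fixes w :: "'i \<Rightarrow> 'f"
  assumes fin: "finite I" and uv: "degree u \<le> d" "degree v \<le> d" "v \<noteq> 0"
    and t: "t = pol u / pol v"
    and indep: "\<And>L c. (\<Sum>l<L. \<Sum>i\<in>I. \<iota> (c l i) * t ^ l * w i) = 0 \<Longrightarrow> \<forall>l<L. \<forall>i\<in>I. c l i = 0"
  shows "card I \<le> m * d"
proof -
  obtain b g where b: "b \<noteq> 0" and g: "\<And>i. i \<in> I \<Longrightarrow> pol b * w i = (\<Sum>j<m. pol (g i j) * Y ^ j)"
    using common_denominator[OF fin, of w] by blast
  define B where "B = Max (insert 0 ((\<lambda>(i, j). degree (g i j)) ` (I \<times> {..<m})))"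
  have B: "degree (g i j) \<le> B" if "i \<in> I" "j < m" for i j
    unfolding B_def using that fin by (intro Max_ge) auto
  \<comment> \<open>Pigeonhole: the q^(L * card I) coefficient families give distinct elements after
    denominators are cleared, and these lie in a set of at most q^(m * (B + d * L + 1))
    elements.\<close>
  have main: "L * card I \<le> m * (B + d * L + 1)" for L
  proof -
    let ?N = "B + d * L"
    let ?D = "({..<L} \<times> I) \<rightarrow>\<^sub>E (UNIV :: 'a set)"
    let ?C = "{..<m} \<rightarrow>\<^sub>E {p :: 'a poly. degree p \<le> ?N}"
    let ?S = "(\<lambda>G. \<Sum>j<m. pol (G j) * Y ^ j) ` ?C"
    \<comment> \<open>\<open>pol b\<close> clears the denominators of the \<open>w i\<close>, and
      \<open>pol v ^ L\<close> those of all \<open>t ^ l\<close> with l < L.\<close>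
    define \<Phi> where "\<Phi> c = pol b * pol v ^ L * (\<Sum>l<L. \<Sum>i\<in>I. \<iota> (c (l, i)) * t ^ l * w i)"
      for c :: "nat \<times> 'i \<Rightarrow> 'a"
    have "\<Phi> c \<in> ?S" for c
    proof -
      define G where "G j = (\<Sum>l<L. \<Sum>i\<in>I. smult (c (l, i)) (u ^ l * v ^ (L - l) * g i j))" for j
      have "degree (smult (c (l, i)) (u ^ l * v ^ (L - l) * g i j)) \<le> ?N"
        if "l < L" "i \<in> I" "j < m" for l i j
      proof -
        have "degree (u ^ l * v ^ (L - l) * g i j) \<le> degree (u ^ l) + degree (v ^ (L - l)) + degree (g i j)"
          by (meson add_right_mono degree_mult_le order_trans)
        also have "\<dots> \<le> d * l + d * (L - l) + B"
          using uv B[OF that(2,3)] degree_power_le[of u l] degree_power_le[of v "L - l"]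
          by (intro add_mono) (meson mult_le_mono1 order_trans)+
        also have "\<dots> = ?N" using that by (simp flip: distrib_left)
        finally show ?thesis using degree_smult_le order_trans by blast
      qed
      then have "degree (G j) \<le> ?N" if "j < m" for j
        unfolding G_def using that by (intro degree_sum_le) (auto simp: fin)
      then have "restrict G {..<m} \<in> ?C" by auto
      moreover have "\<Phi> c = (\<Sum>j<m. pol (restrict G {..<m} j) * Y ^ j)"
      proof -
        have pv: "pol v \<noteq> 0" using uv by simp
        have "\<Phi> c = (\<Sum>l<L. \<Sum>i\<in>I. \<iota> (c (l, i)) * (pol v ^ L * t ^ l) * (pol b * w i))"
          unfolding \<Phi>_def by (simp add: sum_distrib_left mult_ac)
        also have "\<dots> = (\<Sum>l<L. \<Sum>i\<in>I. \<iota> (c (l, i)) * pol (u ^ l * v ^ (L - l)) * (\<Sum>j<m. pol (g i j) * Y ^ j))"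
        proof (intro sum.cong refl)
          fix l i assume l: "l \<in> {..<L}" "i \<in> I"
          then have "pol v ^ L * t ^ l = pol (u ^ l * v ^ (L - l))"
            using pv by (simp add: t to_fract_power power_divide field_simps flip: power_add)
          then show "\<iota> (c (l, i)) * (pol v ^ L * t ^ l) * (pol b * w i) =
              \<iota> (c (l, i)) * pol (u ^ l * v ^ (L - l)) * (\<Sum>j<m. pol (g i j) * Y ^ j)"
            using g l by simp
        qed
        also have "\<dots> = (\<Sum>l<L. \<Sum>i\<in>I. \<Sum>j<m. pol (smult (c (l, i)) (u ^ l * v ^ (L - l) * g i j)) * Y ^ j)"
          by (simp add: sum_distrib_left mult_ac pol_smult del: to_fract_mult)
            (simp add: mult_ac)
        also have "\<dots> = (\<Sum>j<m. \<Sum>l<L. \<Sum>i\<in>I. pol (smult (c (l, i)) (u ^ l * v ^ (L - l) * g i j)) * Y ^ j)"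
          by (rule trans[OF sum.cong[OF refl sum.swap] sum.swap])
        also have "\<dots> = (\<Sum>j<m. pol (G j) * Y ^ j)"
          unfolding G_def to_fract_sum phi.sum sum_distrib_right ..
        finally show ?thesis by simp
      qed
      ultimately show ?thesis by blast
    qed
    then have sub: "\<Phi> ` ?D \<subseteq> ?S" by blast
    have fin': "finite ?S" using card_polys_le by (intro finite_imageI finite_PiE) auto
    have inj: "inj_on \<Phi> ?D"
    proof (rule inj_onI)
      fix c c' assume cc: "c \<in> ?D" "c' \<in> ?D" "\<Phi> c = \<Phi> c'"
      have "pol b * pol v ^ L \<noteq> 0" using b uv by simp
      then have "(\<Sum>l<L. \<Sum>i\<in>I. \<iota> (c (l, i)) * t ^ l * w i) - (\<Sum>l<L. \<Sum>i\<in>I. \<iota> (c' (l, i)) * t ^ l * w i) = 0"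
        using cc(3)[unfolded \<Phi>_def mult_cancel_left] unfolding right_minus_eq by blast
      then have "(\<Sum>l<L. \<Sum>i\<in>I. \<iota> (c (l, i) - c' (l, i)) * t ^ l * w i) = 0"
        by (simp only: iota.diff left_diff_distrib sum_subtractf)
      then have "\<forall>l<L. \<forall>i\<in>I. c (l, i) - c' (l, i) = 0" by (rule indep)
      then show "c = c'" using cc by (intro PiE_ext[OF cc(1,2)]) auto
    qed
    have "card (UNIV :: 'a set) ^ (L * card I) = card ?D" using fin by (simp add: card_PiE)
    also have "\<dots> \<le> card ?S" by (rule card_inj_on_le[OF inj sub fin'])
    also have "\<dots> \<le> card ?C" using card_polys_le by (intro card_image_le finite_PiE) auto
    also have "\<dots> = card {p :: 'a poly. degree p \<le> ?N} ^ m" by (simp add: card_PiE)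
    also have "\<dots> \<le> (card (UNIV :: 'a set) ^ (?N + 1)) ^ m" using card_polys_le by (intro power_mono) auto
    also have "\<dots> = card (UNIV :: 'a set) ^ (m * (?N + 1))" by (metis mult.commute power_mult)
    finally show ?thesis using q_ge_2 by (subst (asm) power_increasing_iff) auto
  qed
  show ?thesis
  proof (rule ccontr)
    assume "\<not> card I \<le> m * d"
    then have "m * d + 1 \<le> card I" by simp
    \<comment> \<open>The choice L = m * (B + 1) + 1 exceeds by one the part of the bound that does
      not grow with L.\<close>
    then have "(m * (B + 1) + 1) * (m * d + 1) \<le> (m * (B + 1) + 1) * card I" by (intro mult_le_mono2)
    also have "\<dots> \<le> m * (B + d * (m * (B + 1) + 1) + 1)" by (rule main)
    finally show False by (simp add: algebra_simps)
  qed
qed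

text \<open>Independence modulo \<open>t * M\<close> lifts to independence of all
  \<open>t ^ l * w i\<close>: in a relation the terms with l = 0 add up to \<open>t\<close> times an
  element of \<open>M\<close>, so their coefficients vanish, and \<open>t\<close> can be cancelled.
  \<open>M\<close> will be a valuation ring or an intersection of several.\<close>

lemma card_le_if_indep_mod:
  fixes w :: "'i \<Rightarrow> 'f"
  assumes fin: "finite I" and uv: "degree u \<le> d" "degree v \<le> d" "v \<noteq> 0"
    and t: "t = pol u / pol v" "t \<noteq> 0"
    and M: "0 \<in> M" "\<And>a b. a \<in> M \<Longrightarrow> b \<in> M \<Longrightarrow> a + b \<in> M" "\<And>c a. a \<in> M \<Longrightarrow> \<iota> c * a \<in> M"
      "\<And>a. a \<in> M \<Longrightarrow> t * a \<in> M"
    and w: "\<And>i. i \<in> I \<Longrightarrow> w i \<in> M"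
    and indep: "\<And>c s. s \<in> M \<Longrightarrow> (\<Sum>i\<in>I. \<iota> (c i) * w i) = t * s \<Longrightarrow> \<forall>i\<in>I. c i = 0"
  shows "card I \<le> m * d"
proof (rule card_le_if_indep_powers[OF fin uv t(1), of w])
  fix L c assume "(\<Sum>l<L. \<Sum>i\<in>I. \<iota> (c l i) * t ^ l * w i) = 0"
  then show "\<forall>l<L. \<forall>i\<in>I. c l i = 0"
  proof (induction L arbitrary: c)
    case (Suc L)
    let ?s = "\<Sum>l<L. \<Sum>i\<in>I. \<iota> (c (Suc l) i) * t ^ l * w i"
    have sumM: "sum g A \<in> M" if "\<And>i. i \<in> A \<Longrightarrow> g i \<in> M" for g and A :: "'b set"
      using that by (induction A rule: infinite_finite_induct) (auto intro: M)
    have pow: "t ^ l * a \<in> M" if "a \<in> M" for l a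
      using that by (induction l) (auto simp: mult.assoc intro: M)
    have s: "?s \<in> M"
      unfolding mult.assoc using w sumM by (intro sumM M(3) pow) auto
    have "(\<Sum>i\<in>I. \<iota> (c 0 i) * w i) + t * ?s = 0"
      using Suc.prems unfolding sum.lessThan_Suc_shift sum_distrib_left by (simp add: mult_ac)
    then have "(\<Sum>i\<in>I. \<iota> (c 0 i) * w i) = t * (- ?s)" by (simp add: eq_neg_iff_add_eq_0)
    moreover have "- ?s \<in> M" using M(3)[OF s, of "-1"] by (simp only: iota.uminus iota.one) simp
    ultimately have c0: "\<forall>i\<in>I. c 0 i = 0" using indep by blast
    then have "(\<Sum>i\<in>I. \<iota> (c 0 i) * w i) = 0" by (intro sum.neutral) auto
    then have "?s = 0" using \<open>_ + t * ?s = 0\<close> t by simp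
    then have "\<forall>l<L. \<forall>i\<in>I. c (Suc l) i = 0" by (rule Suc.IH)
    then show ?case using c0 by (metis less_Suc_eq_0_disj)
  qed simp
qed


lemma poly_in_subring:
  assumes "valring R" "range \<iota> \<subseteq> R" "\<phi> (to_fract [:0, 1:]) \<in> R"
  shows "pol p \<in> R"
proof -
  interpret valring R by fact
  show ?thesis
  proof (induction p)
    case (pCons a p)
    have "pCons a p = [:a:] + [:0, 1:] * p" by simp
    then have "pol (pCons a p) = \<iota> a + \<phi> (to_fract [:0, 1:]) * pol p"
      by (simp only: to_fract_add to_fract_mult phi.add phi.mult o_apply rat_const_def)
    then show ?case using pCons assms(2,3) by (auto intro!: closed)
  qed (simp add: closed)
qed

text \<open>\<open>Y\<close> is integral over the base field: if it were outside \<open>R\<close>,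
  then \<open>Y = Y ^ m * inverse Y ^ (m - 1)\<close> would be a product of elements of
  \<open>R\<close>. So \<open>R\<close> would be everything; consequently contractions to the base
  field are proper subrings.\<close>

lemma base_not_in_val_ring:
  assumes "val_ring R" "range \<phi> \<subseteq> R" shows False
proof -
  interpret valring R by unfold_locales fact
  have "Y \<in> R"
  proof (rule ccontr)
    assume Y: "Y \<notin> R"
    then have "Y \<noteq> 0" using zero by auto
    have "Y ^ m * inverse Y ^ (m - 1) \<in> R" using assms Y total by (auto intro!: closed simp: Ym)
    moreover have "Y ^ m * inverse Y ^ (m - 1) = Y"
      using \<open>Y \<noteq> 0\<close> m by (cases m) (simp_all add: power_inverse)
    ultimately show False using Y by simp
  qed
  have "z \<in> R" for z
  proof -
    obtain c where "z = (\<Sum>i<m. \<phi> (c i) * Y ^ i)" using gen by blast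
    then show ?thesis using assms \<open>Y \<in> R\<close> by (auto intro!: closed)
  qed
  then show False using assms by (auto simp: val_ring_def)
qed

text \<open>Supplies a rational function of positive value before any valuation is available; the
  degrees of its numerator and denominator bound all later counts. It is a polynomial, or 1 / x if
  \<open>x\<close> is not integral.\<close>

lemma exists_base_nonunit:
  assumes "val_ring R" "range \<iota> \<subseteq> R"
  shows "\<exists>u v. u \<noteq> 0 \<and> v \<noteq> 0 \<and> pol u / pol v \<in> nonunits R"
proof -
  interpret valring R by unfold_locales fact
  show ?thesis
  proof (cases "pol [:0, 1:] \<in> R")
    case True
    then have pR: "pol p \<in> R" for p using poly_in_subring assms valring_axioms by blast
    have "\<exists>p. p \<noteq> 0 \<and> inverse (pol p) \<notin> R"
    proof (rule ccontr)
      assume *: "\<not> ?thesis"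
      have "\<phi> z \<in> R" for z
      proof -
        obtain a b where ab: "b \<noteq> 0" "z = to_fract a / to_fract b" using to_fract_surj by blast
        then have "\<phi> z = pol a * inverse (pol b)" by (simp add: divide_inverse)
        then show ?thesis using * ab pR mult by auto
      qed
      then show False using base_not_in_val_ring assms by blast
    qed
    then obtain p where "p \<noteq> 0" "inverse (pol p) \<notin> R" by blast
    then have "p \<noteq> 0" "pol p / pol 1 \<in> nonunits R" using pR by (auto simp: nonunits_def)
    then show ?thesis by (metis one_neq_zero)
  next
    case False
    then have "inverse (pol [:0, 1:]) \<in> nonunits R" using total[OF False] by (simp add: nonunits_def)
    then have "pol 1 / pol [:0, 1:] \<in> nonunits R" by (simp add: inverse_eq_divide)
    then show ?thesis by (metis one_neq_zero pCons_eq_0_iff)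
  qed
qed

end

section \<open>Discreteness of the valuation rings containing the constants\<close>

locale ff_valring = ff \<phi> Y m f0 + valring R
  for \<phi> :: "'a::{field,finite} poly fract \<Rightarrow> 'f::field" and Y m f0 R +
  fixes u v :: "'a poly" and t and d
  assumes const: "range \<iota> \<subseteq> R"
    and uv: "u \<noteq> 0" "v \<noteq> 0" and t: "t = pol u / pol v" "t \<in> nonunits R"
    and d: "degree u \<le> d" "degree v \<le> d"
begin

abbreviation "Q \<equiv> nonunits R"

lemma Q_mult: "a \<in> Q \<Longrightarrow> c \<in> R \<Longrightarrow> c * a \<in> Q" "a \<in> Q \<Longrightarrow> c \<in> R \<Longrightarrow> a * c \<in> Q"
  using nonunit_mult by (auto simp: mult.commute)

lemma Q_0: "0 \<in> Q" by (simp add: nonunits_def zero)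

lemma Q_sum: "(\<And>i. i \<in> A \<Longrightarrow> g i \<in> Q) \<Longrightarrow> sum g A \<in> Q"
  by (induction A rule: infinite_finite_induct) (auto intro: nonunit_add simp: Q_0)

lemma Q_R: "a \<in> Q \<Longrightarrow> a \<in> R" by (simp add: nonunits_def)

lemma Q_uminus: "a \<in> Q \<Longrightarrow> - a \<in> Q"
  using Q_mult(1)[of a "- 1"] one uminus by auto

lemma Q_diff: "a \<in> Q \<Longrightarrow> b \<in> Q \<Longrightarrow> a - b \<in> Q"
  using nonunit_add[of a "- b"] Q_uminus by auto

lemma t0: "t \<noteq> 0" using uv t by simp

lemma iota_R: "\<iota> c \<in> R" using const by auto

lemma iota_Q: "\<iota> c \<in> Q \<Longrightarrow> c = 0"
  using iota_R[of "inverse c"] by (auto simp: nonunits_def simp del: o_apply)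

lemma not_in_ring: "b / a \<notin> R \<Longrightarrow> a / b \<in> Q"
  using total[of "b / a"] by (auto simp: nonunits_def zero)

lemmas card_le_mod = card_le_if_indep_mod[OF _ d uv(2) t(1) t0, where M = R]

text \<open>The \<open>w i\<close> are divisors of \<open>t\<close> whose value decreases strictly
  with the index. They are independent modulo \<open>t\<close>, since in a relation the term of
  least value cannot be cancelled, so the counting bound limits the length of the chain.\<close>

lemma chain_card_le:
  assumes "finite I"
    and w: "\<And>i. i \<in> I \<Longrightarrow> w i \<in> R" "\<And>i. i \<in> I \<Longrightarrow> w i \<noteq> 0" "\<And>i. i \<in> I \<Longrightarrow> t / w i \<in> Q"
      "\<And>i j. i \<in> I \<Longrightarrow> j \<in> I \<Longrightarrow> i < j \<Longrightarrow> w i / w j \<in> Q"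
  shows "card (I :: nat set) \<le> m * d"
proof (rule card_le_mod[OF assms(1)])
  fix c s assume s: "s \<in> R" "(\<Sum>i\<in>I. \<iota> (c i) * w i) = t * s"
  show "\<forall>i\<in>I. c i = 0"
  proof (rule ccontr)
    assume "\<not> ?thesis"
    then have ne: "{i \<in> I. c i \<noteq> 0} \<noteq> {}" by auto
    \<comment> \<open>The largest index belongs to the least value.\<close>
    define k where "k = Max {i \<in> I. c i \<noteq> 0}"
    have k: "k \<in> I" "c k \<noteq> 0" using Max_in[OF _ ne] assms(1) by (auto simp: k_def)
    have big: "c i = 0" if "i \<in> I" "k < i" for i
      using Max_ge[of "{i \<in> I. c i \<noteq> 0}" i] that assms(1) unfolding k_def[symmetric] by auto
    have "(\<Sum>i\<in>I - {k}. \<iota> (c i) * (w i / w k)) \<in> Q"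
    proof (intro Q_sum)
      fix i assume i: "i \<in> I - {k}"
      show "\<iota> (c i) * (w i / w k) \<in> Q"
      proof (cases "i < k")
        case True
        then show ?thesis using i k Q_mult(1)[OF w(4) iota_R] by blast
      next
        case False
        then show ?thesis using big[of i] i by (simp add: nonunits_def zero)
      qed
    qed
    moreover have "(t / w k) * s \<in> Q" by (rule Q_mult(2)[OF w(3)[OF k(1)] s(1)])
    moreover have "\<iota> (c k) = (t / w k) * s - (\<Sum>i\<in>I - {k}. \<iota> (c i) * (w i / w k))"
    proof -
      have "\<iota> (c k) * w k = t * s - (\<Sum>i\<in>I - {k}. \<iota> (c i) * w i)"
        using s(2) k assms(1) by (simp add: sum.remove[of I k] eq_diff_eq)
      then have "\<iota> (c k) * w k / w k = (t * s - (\<Sum>i\<in>I - {k}. \<iota> (c i) * w i)) / w k" by simp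
      then show ?thesis using w(2) k by (simp add: diff_divide_distrib sum_divide_distrib)
    qed
    ultimately have "\<iota> (c k) \<in> Q" using Q_diff by simp
    then show False using iota_Q k by blast
  qed
qed (use w Q_R t(2) iota_R in \<open>auto intro: closed simp del: o_apply\<close>)

text \<open>If no nonunit divided all the others, from each \<open>a\<close> in \<open>Q\<close> one
  could pass to some \<open>b\<close> in \<open>Q\<close> with \<open>a / b\<close> in
  \<open>Q\<close>; iterating from \<open>t\<close> gives a chain longer than
  \<open>chain_card_le\<close> permits.\<close>

lemma principal: "\<exists>p\<in>Q. p \<noteq> 0 \<and> (\<forall>b\<in>Q. b / p \<in> R)"
proof (rule ccontr)
  assume *: "\<not> ?thesis"
  have step: "\<exists>b. (b \<in> Q \<and> b \<noteq> 0) \<and> a / b \<in> Q" if a: "a \<in> Q \<and> a \<noteq> 0" for a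
  proof -
    obtain b where b: "b \<in> Q" "b / a \<notin> R" using * a by blast
    then have "b \<noteq> 0" using zero by auto
    then show ?thesis using b not_in_ring[OF b(2)] by blast
  qed
  define S where "S a = (SOME b. (b \<in> Q \<and> b \<noteq> 0) \<and> a / b \<in> Q)" for a
  have S: "(S a \<in> Q \<and> S a \<noteq> 0) \<and> a / S a \<in> Q" if "a \<in> Q \<and> a \<noteq> 0" for a
    unfolding S_def using step[OF that] by (rule someI_ex)
  define a where "a n = (S ^^ n) t" for n
  have a1: "a n \<in> Q \<and> a n \<noteq> 0" for n
    by (induction n) (use S t t0 in \<open>auto simp: a_def\<close>)
  have a2: "a n / a (Suc n) \<in> Q" for n
    using S[OF a1[of n]] by (simp add: a_def)
  have a3: "a 0 = t" by (simp add: a_def)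
  have lt: "a i / a (i + Suc j) \<in> Q" for i j
  proof (induction j)
    case (Suc j)
    have "(a i / a (i + Suc j)) * (a (i + Suc j) / a (Suc (i + Suc j))) \<in> Q"
      using Suc a2 Q_mult Q_R by blast
    then show ?case using a1 by simp
  qed (use a2 in simp)
  have "card {1..m * d + 1} \<le> m * d"
  proof (rule chain_card_le[of _ a])
    fix i assume "i \<in> {1..m * d + 1}"
    then show "t / a i \<in> Q" using lt[of 0 "i - 1"] a3 by simp
  next
    fix i j :: nat assume "i < j"
    then show "a i / a j \<in> Q" using lt[of i "j - i - 1"] by simp
  qed (use a1 Q_R in auto)
  then show False by simp
qed

text \<open>A generator \<open>p\<close> of \<open>Q\<close> does not yet make the ring discrete:
  nonzero elements divisible by every power of \<open>p\<close> have to be excluded. This is done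
  for \<open>t\<close>, and from there for arbitrary \<open>z\<close>, each time by
  counting.\<close>

lemma decomposition:
  shows "\<exists>p\<in>Q. p \<noteq> 0 \<and> (\<forall>z. z \<noteq> 0 \<longrightarrow> (\<exists>n w. w \<noteq> 0 \<and> w \<in> R \<and> inverse w \<in> R \<and> z = p powi n * w))"
proof -
  obtain p where p: "p \<in> Q" "p \<noteq> 0" "\<And>b. b \<in> Q \<Longrightarrow> b / p \<in> R" using principal by blast
  have p_pow: "p ^ n \<in> Q" if "0 < n" for n
    using that by (induction n) (use p Q_mult Q_R closed in auto)
  \<comment> \<open>If every power of \<open>p\<close> divided \<open>t\<close>, then 1, p, p^2, ...
    would be independent modulo \<open>t\<close>, because the lowest power in a relation
    dominates.\<close>
  have "\<exists>n. t / p ^ n \<notin> R"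
  proof (rule ccontr)
    assume *: "\<not> ?thesis"
    have "card {..<m * d + 1} \<le> m * d"
    proof (rule card_le_mod[of _ "\<lambda>i. p ^ i"])
      fix c s assume s: "s \<in> R" "(\<Sum>i<m * d + 1. \<iota> (c i) * p ^ i) = t * s"
      show "\<forall>i\<in>{..<m * d + 1}. c i = 0"
      proof (rule ccontr)
        assume "\<not> ?thesis"
        then have ne: "{i. i < m * d + 1 \<and> c i \<noteq> 0} \<noteq> {}" by auto
        define k where "k = Min {i. i < m * d + 1 \<and> c i \<noteq> 0}"
        have k: "k < m * d + 1" "c k \<noteq> 0" using Min_in[OF _ ne] by (auto simp: k_def)
        have small: "c i = 0" if "i < k" for i
          using Min_le[of "{i. i < m * d + 1 \<and> c i \<noteq> 0}" i] that k(1) unfolding k_def[symmetric] by force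
        have "(\<Sum>i\<in>{..<m * d + 1} - {k}. \<iota> (c i) * (p ^ i / p ^ k)) \<in> Q"
        proof (intro Q_sum)
          fix i assume i: "i \<in> {..<m * d + 1} - {k}"
          show "\<iota> (c i) * (p ^ i / p ^ k) \<in> Q"
          proof (cases "i < k")
            case False
            then have "p ^ i / p ^ k = p ^ (i - k)" using p(2) by (simp add: power_diff)
            then show ?thesis using p_pow[of "i - k"] i False Q_mult iota_R by simp
          qed (simp add: small nonunits_def zero)
        qed
        moreover have "p * (t / p ^ Suc k) * s \<in> Q" using * by (intro Q_mult(2) p(1) s(1)) blast
        then have "(t / p ^ k) * s \<in> Q" using p by simp
        moreover have "\<iota> (c k) = (t / p ^ k) * s - (\<Sum>i\<in>{..<m * d + 1} - {k}. \<iota> (c i) * (p ^ i / p ^ k))"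
        proof -
          have "\<iota> (c k) * p ^ k = t * s - (\<Sum>i\<in>{..<m * d + 1} - {k}. \<iota> (c i) * p ^ i)"
            using s(2) k by (subst (asm) sum.remove[of _ k]) (auto simp: eq_diff_eq)
          then have "\<iota> (c k) * p ^ k / p ^ k = (t * s - (\<Sum>i\<in>{..<m * d + 1} - {k}. \<iota> (c i) * p ^ i)) / p ^ k" by simp
          then show ?thesis using p(2) by (simp add: diff_divide_distrib sum_divide_distrib)
        qed
        ultimately have "\<iota> (c k) \<in> Q" using Q_diff by simp
        then show False using iota_Q k by blast
      qed
    qed (use p Q_R t(2) iota_R in \<open>auto intro: closed simp del: o_apply\<close>)
    then show False by simp
  qed
  then obtain e where e: "t / p ^ e \<notin> R" by blast
  then have pt: "p ^ e / t \<in> R" using not_in_ring Q_R by blast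
  \<comment> \<open>Since \<open>p ^ e\<close> is a multiple of \<open>t\<close>, a \<open>z\<close>
    divisible by all powers of \<open>p\<close> is divisible by all powers of \<open>t\<close>. Then
    the products \<open>t ^ l * inverse z ^ i\<close> have pairwise different values, ordered
    lexicographically with \<open>i\<close> leading, and form too large an independent
    family.\<close>
  have fin: "\<exists>n. z / p ^ n \<notin> R" if z: "z \<noteq> 0" for z
  proof (rule ccontr)
    assume *: "\<not> ?thesis"
    have zt: "z / t ^ l \<in> R" for l
    proof -
      have "(z / p ^ (e * l)) * (p ^ e / t) ^ l \<in> R" using * pt by (intro mult power) blast+
      then show ?thesis using p(2) by (simp add: power_divide flip: power_mult)
    qed
    then have ztQ: "z / t ^ l \<in> Q" for l
      using Q_mult(1)[OF t(2) zt[of "Suc l"]] t0 by simp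
    have "card {..<m * d + 1} \<le> m * d"
    proof (rule card_le_if_indep_powers[OF _ d uv(2) t(1), of _ "\<lambda>i. inverse z ^ i"])
      fix L c assume s: "(\<Sum>l<L. \<Sum>i<m * d + 1. \<iota> (c l i) * t ^ l * inverse z ^ i) = 0"
      show "\<forall>l<L. \<forall>i\<in>{..<m * d + 1}. c l i = 0"
      proof (rule ccontr)
        assume not0: "\<not> ?thesis"
        define A where "A = {i. i < m * d + 1 \<and> (\<exists>l<L. c l i \<noteq> 0)}"
        \<comment> \<open>The dominant term has the highest power of \<open>inverse z\<close>, and
          among those the lowest power of \<open>t\<close>.\<close>
        define k where "k = Max A"
        have "A \<noteq> {}" "finite A" using not0 by (auto simp: A_def)
        then have "k \<in> A" unfolding k_def by (rule Max_in[rotated])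
        then have k: "k < m * d + 1" "\<exists>l<L. c l k \<noteq> 0" by (auto simp: A_def)
        have big: "c l i = 0" if "k < i" "i < m * d + 1" "l < L" for l i
          using Max_ge[of A i] \<open>finite A\<close> that unfolding k_def[symmetric] by (force simp: A_def)
        define l0 where "l0 = (LEAST l. l < L \<and> c l k \<noteq> 0)"
        have l0: "l0 < L" "c l0 k \<noteq> 0" using LeastI_ex[of "\<lambda>l. l < L \<and> c l k \<noteq> 0"] k(2) by (auto simp: l0_def)
        have small: "c l k = 0" if "l < l0" for l
          using not_less_Least[of l "\<lambda>l. l < L \<and> c l k \<noteq> 0"] that l0 by (auto simp: l0_def)
        define g where "g l i = \<iota> (c l i) * t ^ l * inverse z ^ i" for l i
        define G where "G l i = \<iota> (c l i) * (t ^ l / t ^ l0) * (z ^ k / z ^ i)" for l i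
        have "g l i * (z ^ k / t ^ l0) = G l i" for l i
          using z t0 by (simp add: g_def G_def power_inverse divide_inverse mult_ac)
        then have "(\<Sum>l<L. \<Sum>i<m * d + 1. G l i) = (\<Sum>l<L. \<Sum>i<m * d + 1. g l i * (z ^ k / t ^ l0))" by simp
        also have "\<dots> = (\<Sum>l<L. \<Sum>i<m * d + 1. g l i) * (z ^ k / t ^ l0)"
          by (simp only: sum_distrib_right)
        also have "\<dots> = 0" using s unfolding g_def by simp
        finally have "(\<Sum>l<L. \<Sum>i<m * d + 1. G l i) = 0" .
        then have s0: "(\<Sum>(l, i)\<in>{..<L} \<times> {..<m * d + 1}. G l i) = 0"
          by (simp only: sum.cartesian_product)
        have GQ: "G l i \<in> Q" if li: "l < L" "i < m * d + 1" "(l, i) \<noteq> (l0, k)" for l i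
        proof -
          consider "k < i" | "i = k" "l < l0" | "i = k" "l0 < l" | "i < k" using li(3) by fastforce
          then show ?thesis
          proof cases
            case 1
            then show ?thesis using big li by (simp add: G_def nonunits_def zero)
          next
            case 2
            then show ?thesis using small by (simp add: G_def nonunits_def zero)
          next
            case 3
            then have "t ^ l / t ^ l0 = t ^ (l - l0 - 1) * t" using t0
              by (simp add: power_diff flip: power_Suc2)
            moreover have "t ^ (l - l0 - 1) * t \<in> Q" using t Q_mult Q_R closed by metis
            ultimately show ?thesis using 3 Q_mult(1)[OF _ iota_R[of "c l i"]] z by (simp add: G_def)
          next
            case 4
            then have "z ^ k / z ^ i = z ^ (k - i - 1) * z" using z
              by (simp add: power_diff flip: power_Suc2)
            then have "G l i = (\<iota> (c l i) * t ^ l * z ^ (k - i - 1)) * (z / t ^ l0)"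
              unfolding G_def by (simp only: mult_ac) (simp add: divide_inverse mult_ac)
            moreover have "\<iota> (c l i) * t ^ l * z ^ (k - i - 1) \<in> R"
              using zt[of 0] by (intro mult power iota_R Q_R[OF t(2)]) simp
            ultimately show ?thesis using Q_mult(1)[OF ztQ[of l0]] by metis
          qed
        qed
        have mem: "(l0, k) \<in> {..<L} \<times> {..<m * d + 1}" using l0 k by auto
        have "G l0 k = - (\<Sum>(l, i)\<in>{..<L} \<times> {..<m * d + 1} - {(l0, k)}. G l i)"
          using s0 sum.remove[OF _ mem, of "\<lambda>(l, i). G l i"]
          by (simp only: eq_neg_iff_add_eq_0 prod.case finite_cartesian_product finite_lessThan simp_thms)
        moreover have "(\<Sum>(l, i)\<in>{..<L} \<times> {..<m * d + 1} - {(l0, k)}. G l i) \<in> Q"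
          by (intro Q_sum) (use GQ in auto)
        ultimately have "G l0 k \<in> Q" using Q_uminus by simp
        then have "\<iota> (c l0 k) \<in> Q" using t0 z by (simp add: G_def)
        then show False using iota_Q l0 by blast
      qed
    qed simp
    then show False by simp
  qed
  have dec: "\<exists>n w. w \<noteq> 0 \<and> w \<in> R \<and> inverse w \<in> R \<and> z = p powi n * w" if z: "z \<noteq> 0" "z \<in> R" for z
  proof -
    \<comment> \<open>The least power of \<open>p\<close> that fails to divide \<open>z\<close>; the
      exponent sought is therefore \<open>n - 1\<close>.\<close>
    define n where "n = (LEAST n. z / p ^ n \<notin> R)"
    have n: "z / p ^ n \<notin> R" using LeastI_ex[OF fin[OF z(1)]] by (simp add: n_def)
    then have "n \<noteq> 0" using z by (intro notI) simp
    then have n1: "z / p ^ (n - 1) \<in> R" using not_less_Least[of "n - 1" "\<lambda>n. z / p ^ n \<notin> R"] by (auto simp: n_def)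
    define w where "w = z / p ^ (n - 1)"
    have "inverse w \<in> R"
    proof (rule ccontr)
      assume "inverse w \<notin> R"
      then have "w \<in> Q" using n1 by (simp add: w_def nonunits_def)
      then have "w / p \<in> R" by (rule p)
      then show False using n \<open>n \<noteq> 0\<close> by (cases n) (simp_all add: w_def mult.commute)
    qed
    moreover have "z = p powi int (n - 1) * w" using p(2) by (simp add: w_def)
    moreover have "w \<noteq> 0" "w \<in> R" using n1 z p(2) by (simp_all add: w_def)
    ultimately show ?thesis by blast
  qed
  have "\<exists>n w. w \<noteq> 0 \<and> w \<in> R \<and> inverse w \<in> R \<and> z = p powi n * w" if z: "z \<noteq> 0" for z
  proof (cases "z \<in> R")
    case False
    then have "inverse z \<noteq> 0" "inverse z \<in> R" using z total by auto
    then obtain n w where nw: "w \<noteq> 0" "w \<in> R" "inverse w \<in> R" "inverse z = p powi n * w" using dec by blast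
    have "z = inverse (p powi n * w)" using nw(4) by (metis inverse_inverse_eq)
    then have "z = p powi (- n) * inverse w" by (simp add: power_int_minus)
    then show ?thesis using nw by (intro exI[of _ "- n"] exI[of _ "inverse w"]) auto
  qed (use dec z in blast)
  then show ?thesis using p by blast
qed

lemma discrete: "discrete Q"
  unfolding discrete_def place_ring_nonunits using val_ring decomposition by blast

end


section \<open>Residue fields and degrees of places\<close>

definition residue_indep :: "('k::field \<Rightarrow> 'f::field) \<Rightarrow> 'f set \<Rightarrow> nat \<Rightarrow> (nat \<Rightarrow> 'f) \<Rightarrow> bool" where
  "residue_indep \<iota> Q n z \<longleftrightarrow> (\<forall>i<n. z i \<in> place_ring Q) \<and>
     (\<forall>c. (\<Sum>i<n. \<iota> (c i) * z i) \<in> Q \<longrightarrow> (\<forall>i<n. c i = 0))"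

lemma residue_indepD:
  "residue_indep \<iota> Q n z \<Longrightarrow> (\<Sum>i<n. \<iota> (c i) * z i) \<in> Q \<Longrightarrow> i < n \<Longrightarrow> c i = 0"
  unfolding residue_indep_def by blast

definition residue_spans :: "('k::field \<Rightarrow> 'f::field) \<Rightarrow> 'f set \<Rightarrow> nat \<Rightarrow> (nat \<Rightarrow> 'f) \<Rightarrow> bool" where
  "residue_spans \<iota> Q n z \<longleftrightarrow> (\<forall>w\<in>place_ring Q. \<exists>c. w - (\<Sum>i<n. \<iota> (c i) * z i) \<in> Q)"

context ff begin

lemma place_discrete:
  assumes "place \<iota> Q" shows "discrete Q"
proof -
  interpret valring "place_ring Q" using place_valring(1)[OF assms] by unfold_locales
  obtain u v where uv: "u \<noteq> 0" "v \<noteq> 0" "pol u / pol v \<in> nonunits (place_ring Q)"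
    using exists_base_nonunit place_valring[OF assms] by blast
  interpret ff_valring \<phi> Y m f0 "place_ring Q" u v "pol u / pol v" "max (degree u) (degree v)"
    using uv place_valring[OF assms] by unfold_locales auto
  show ?thesis using discrete place_valring(2)[OF assms] by simp
qed

text \<open>Multiples of the nonunit \<open>pol u / pol v\<close> lie in \<open>Q\<close>, so
  independence modulo \<open>Q\<close> implies independence modulo that element, and the counting
  bound makes the residue field finite over the constants.\<close>

lemma residue_indep_bound:
  assumes "place \<iota> Q"
  shows "\<exists>N. \<forall>n z. residue_indep \<iota> Q n z \<longrightarrow> n \<le> N"
proof -
  interpret valring "place_ring Q" using place_valring(1)[OF assms] by unfold_locales
  obtain u v where uv: "u \<noteq> 0" "v \<noteq> 0" "pol u / pol v \<in> nonunits (place_ring Q)"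
    using exists_base_nonunit place_valring[OF assms] by blast
  interpret v: ff_valring \<phi> Y m f0 "place_ring Q" u v "pol u / pol v" "max (degree u) (degree v)"
    using uv place_valring[OF assms] by unfold_locales auto
  have Q: "nonunits (place_ring Q) = Q" using place_valring(2)[OF assms] by simp
  have "n \<le> m * max (degree u) (degree v)" if "residue_indep \<iota> Q n z" for n z
  proof -
    have "card {..<n} \<le> m * max (degree u) (degree v)"
    proof (rule v.card_le_mod[of _ z])
      fix c s assume s: "s \<in> place_ring Q" "(\<Sum>i<n. \<iota> (c i) * z i) = pol u / pol v * s"
      have "pol u / pol v * s \<in> Q" using v.Q_mult(2)[OF uv(3) s(1)] Q by simp
      then have "\<forall>i<n. c i = 0" using that s(2) unfolding residue_indep_def by metis
      then show "\<forall>i\<in>{..<n}. c i = 0" by simp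
    qed (use that mult[OF v.Q_R[OF uv(3)]] v.iota_R in
        \<open>auto intro: closed simp: residue_indep_def simp del: o_apply times_divide_eq_left\<close>)
    then show ?thesis by simp
  qed
  then show ?thesis by blast
qed

definition residue_basis where
  "residue_basis Q n z \<longleftrightarrow> (\<forall>i<n. z i \<in> place_ring Q) \<and>
     (\<forall>w\<in>place_ring Q. \<exists>!c :: nat \<Rightarrow> 'a.
        (\<forall>i\<ge>n. c i = 0) \<and> w - (\<Sum>i<n. \<iota> (c i) * z i) \<in> Q)"

lemma residue_basisI:
  assumes Q: "place \<iota> Q" and z: "residue_indep \<iota> Q n z" "residue_spans \<iota> Q n z"
  shows "residue_basis Q n z"
  unfolding residue_basis_def
proof (intro conjI ballI)
  interpret dplace Q using place_discrete[OF Q] by unfold_locales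
  fix w assume w: "w \<in> place_ring Q"
  then obtain c where c: "w - (\<Sum>i<n. \<iota> (c i) * z i) \<in> Q"
    using z(2) by (auto simp: residue_spans_def simp del: o_apply)
  show "\<exists>!c. (\<forall>i\<ge>n. c i = 0) \<and> w - (\<Sum>i<n. \<iota> (c i) * z i) \<in> Q"
  proof (rule ex1I[of _ "\<lambda>i. if i < n then c i else 0"])
    have "(\<Sum>i<n. \<iota> (if i < n then c i else 0) * z i) = (\<Sum>i<n. \<iota> (c i) * z i)" by (intro sum.cong) auto
    then show "(\<forall>i\<ge>n. (if i < n then c i else 0) = 0) \<and>
        w - (\<Sum>i<n. \<iota> (if i < n then c i else 0) * z i) \<in> Q" using c by auto
  next
    fix c' :: "nat \<Rightarrow> 'a" assume c': "(\<forall>i\<ge>n. c' i = 0) \<and> w - (\<Sum>i<n. \<iota> (c' i) * z i) \<in> Q"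
    have "(w - (\<Sum>i<n. \<iota> (c' i) * z i)) - (w - (\<Sum>i<n. \<iota> (c i) * z i)) \<in> Q"
      using c' c P_vge vge_diff by blast
    then have "(\<Sum>i<n. \<iota> (c i - c' i) * z i) \<in> Q"
      by (simp only: iota.diff left_diff_distrib sum_subtractf) (simp add: algebra_simps)
    then have "\<forall>i<n. c i - c' i = 0"
      using residue_indepD[OF z(1), of "\<lambda>i. c i - c' i"] by blast
    then show "c' = (\<lambda>i. if i < n then c i else 0)" using c' by (auto simp: fun_eq_iff)
  qed
qed (use z(1) in \<open>auto simp: residue_indep_def\<close>)

text \<open>Invariance of the basis length by cardinality: over a finite constant field the
  coefficient vectors of length \<open>n\<close> inject into those of length \<open>n'\<close>, so
  q^n <= q^n'. This justifies the \<open>THE\<close> in \<open>place_degree\<close>.\<close>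

lemma residue_basis_card:
  assumes Q: "place \<iota> Q" and "residue_basis Q n z" "residue_basis Q n' z'" shows "n \<le> n'"
proof -
  interpret dplace Q using place_discrete[OF Q] by unfold_locales
  have iR: "\<iota> c \<in> place_ring Q" for c using place_valring(3)[OF Q] by auto
  have sR: "(\<Sum>i<n. \<iota> (c i) * z i) \<in> place_ring Q" for c
    using assms(2) iR unfolding residue_basis_def by (auto intro!: closed simp del: o_apply)
  have "\<forall>w\<in>place_ring Q. \<exists>c. w - (\<Sum>i<n'. \<iota> (c i) * z' i) \<in> Q"
    using assms(3) unfolding residue_basis_def by blast
  then obtain C where c: "\<And>w. w \<in> place_ring Q \<Longrightarrow> w - (\<Sum>i<n'. \<iota> (C w i) * z' i) \<in> Q" by metis
  define F where "F c = restrict (C (\<Sum>i<n. \<iota> (c i) * z i)) {..<n'}" for c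
  let ?D = "\<lambda>n. {..<n} \<rightarrow>\<^sub>E (UNIV :: 'a set)"
  have "inj_on F (?D n)"
  proof (rule inj_onI)
    fix c c' assume cc: "c \<in> ?D n" "c' \<in> ?D n" "F c = F c'"
    let ?w = "\<Sum>i<n. \<iota> (c i) * z i" and ?w' = "\<Sum>i<n. \<iota> (c' i) * z i"
    have eq: "C ?w i = C ?w' i" if "i < n'" for i
      using fun_cong[OF cc(3), of i] that by (simp add: F_def del: o_apply)
    have "(\<Sum>i<n'. \<iota> (C ?w i) * z' i) = (\<Sum>i<n'. \<iota> (C ?w' i) * z' i)"
      by (intro sum.cong refl) (simp only: eq lessThan_iff)
    then have "(?w - (\<Sum>i<n'. \<iota> (C ?w i) * z' i)) - (?w' - (\<Sum>i<n'. \<iota> (C ?w i) * z' i)) \<in> Q"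
      using c[OF sR[of c]] c[OF sR[of c']] vge_diff unfolding P_vge by presburger
    then have "?w - ?w' \<in> Q" by simp
    \<comment> \<open>Uniqueness in \<open>residue_basis\<close> concerns coefficient functions that
      are 0 from \<open>n\<close> on, whereas elements of the extensional function space are
      \<open>undefined\<close> there.\<close>
    let ?r = "\<lambda>c i. if i < n then c i else 0 :: 'a"
    have r: "(\<Sum>i<n. \<iota> (?r c i) * z i) = (\<Sum>i<n. \<iota> (c i) * z i)" for c by (intro sum.cong) auto
    have "?w - ?w \<in> Q" using P_vge by simp
    define A where "A c' \<longleftrightarrow> (\<forall>i\<ge>n. c' i = 0) \<and> ?w - (\<Sum>i<n. \<iota> (c' i) * z i) \<in> Q" for c'
    have ex1: "\<exists>!c. A c"
      using assms(2) sR[of c] unfolding residue_basis_def A_def by blast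
    have 1: "A (?r c)" unfolding A_def r using \<open>?w - ?w \<in> Q\<close> by simp
    have 2: "A (?r c')" unfolding A_def r using \<open>?w - ?w' \<in> Q\<close> by simp
    have "?r c = ?r c'" using ex1 1 2 by blast
    then show "c = c'" using cc by (intro PiE_ext[OF cc(1,2)]) (metis lessThan_iff)
  qed
  moreover have "F ` ?D n \<subseteq> ?D n'" unfolding F_def by (intro image_subsetI) (simp only: restrict_PiE_iff UNIV_I, blast)
  ultimately have "card (?D n) \<le> card (?D n')" by (rule card_inj_on_le) (intro finite_PiE; simp)
  then have "card (UNIV :: 'a set) ^ n \<le> card (UNIV :: 'a set) ^ n'" by (simp add: card_PiE)
  then show ?thesis using q_ge_2 by (subst (asm) power_increasing_iff) auto
qed

lemma place_degree_eqI:
  assumes Q: "place \<iota> Q" and z: "residue_indep \<iota> Q n z" "residue_spans \<iota> Q n z"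
  shows "place_degree \<iota> Q = n"
  unfolding place_degree_def residue_basis_def[symmetric]
proof (rule the_equality)
  show "\<exists>z. residue_basis Q n z" using residue_basisI[OF assms] by blast
next
  fix k assume "\<exists>z. residue_basis Q k z"
  then show "k = n" using residue_basis_card[OF Q] residue_basisI[OF assms] antisym by metis
qed

text \<open>A residue-independent family of maximal length exists by
  \<open>residue_indep_bound\<close>; an element outside its span would extend it.\<close>

lemma exists_residue_basis:
  assumes Q: "place \<iota> Q"
  shows "\<exists>z. residue_indep \<iota> Q (place_degree \<iota> Q) z \<and> residue_spans \<iota> Q (place_degree \<iota> Q) z"
proof -
  interpret dplace Q using place_discrete[OF Q] by unfold_locales
  have iR: "\<iota> c \<in> place_ring Q" for c using place_valring(3)[OF Q] by auto
  obtain N where N: "\<And>n z. residue_indep \<iota> Q n z \<Longrightarrow> n \<le> N" using residue_indep_bound[OF Q] by blast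
  define n where "n = (GREATEST n. \<exists>z. residue_indep \<iota> Q n z)"
  have "\<exists>z. residue_indep \<iota> Q 0 z" by (simp add: residue_indep_def)
  then have "\<exists>z. residue_indep \<iota> Q n z" unfolding n_def
    by (rule GreatestI_nat[where b = N]) (use N in blast)
  then obtain z where z: "residue_indep \<iota> Q n z" by blast
  have max: "k \<le> n" if "residue_indep \<iota> Q k y" for k y unfolding n_def
    by (rule Greatest_le_nat[where b = N]) (use N that in blast)+
  have "residue_spans \<iota> Q n z" unfolding residue_spans_def
  proof (rule ballI, rule ccontr)
    fix w assume w: "w \<in> place_ring Q" "\<nexists>c. w - (\<Sum>i<n. \<iota> (c i) * z i) \<in> Q"
    have "residue_indep \<iota> Q (Suc n) (z(n := w))"
      unfolding residue_indep_def
    proof (intro conjI allI impI)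
      fix i assume "i < Suc n" then show "(z(n := w)) i \<in> place_ring Q"
        using z w(1) by (auto simp: residue_indep_def less_Suc_eq)
    next
      fix c i assume c: "(\<Sum>i<Suc n. \<iota> (c i) * (z(n := w)) i) \<in> Q" and i: "i < Suc n"
      have e: "(\<Sum>i<Suc n. \<iota> (c i) * (z(n := w)) i) = (\<Sum>i<n. \<iota> (c i) * z i) + \<iota> (c n) * w"
        by simp
      have cn: "c n = 0"
      proof (rule ccontr)
        assume n0: "c n \<noteq> 0"
        have "\<iota> (inverse (c n)) * ((\<Sum>i<n. \<iota> (c i) * z i) + \<iota> (c n) * w) \<in> Q"
          using P_ideal(1)[OF c iR] unfolding e .
        moreover have "\<iota> (inverse (c n)) * ((\<Sum>i<n. \<iota> (c i) * z i) + \<iota> (c n) * w)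
            = w - (\<Sum>i<n. \<iota> (- (c i / c n)) * z i)"
          using n0 by (simp add: distrib_left sum_negf sum_distrib_left divide_inverse mult_ac)
        ultimately show False using w(2) by metis
      qed
      have "(\<Sum>i<n. \<iota> (c i) * z i) + 0 * w \<in> Q" using c unfolding e cn iota.zero .
      then have "(\<Sum>i<n. \<iota> (c i) * z i) \<in> Q" by simp
      then have "\<forall>i<n. c i = 0" using residue_indepD[OF z, of c] by blast
      then show "c i = 0" using cn i by (metis less_Suc_eq)
    qed
    then show False using max by fastforce
  qed
  then show ?thesis using place_degree_eqI[OF Q z] z by auto
qed

end

section \<open>Weak approximation and zeros of rational functions\<close>

context dplace begin

lemma val_add_distinct:
  assumes "a \<noteq> 0" "b \<noteq> 0" "val P a \<noteq> val P b"
  shows "a + b \<noteq> 0 \<and> val P (a + b) = min (val P a) (val P b)"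
proof (cases "val P a < val P b")
  case True
  then have "vge P b (val P a + 1)" by (simp add: vge_def)
  from val_add_eq[OF assms(1) this] show ?thesis using True by simp
next
  case False
  then have "vge P a (val P b + 1)" using assms by (simp add: vge_def)
  from val_add_eq[OF assms(2) this] show ?thesis using False by (simp add: add.commute)
qed

end

text \<open>Neither valuation ring contains the other, and the quotient of two witnesses separates
  the places.\<close>

lemma separate_two_places:
  assumes "discrete P" "discrete P'" "P \<noteq> P'"
  shows "\<exists>v. v \<noteq> 0 \<and> 0 < val P v \<and> val P' v < 0"
proof -
  interpret p: dplace P by unfold_locales fact
  interpret p': dplace P' by unfold_locales fact
  have "\<not> place_ring P \<subseteq> place_ring P'" "\<not> place_ring P' \<subseteq> place_ring P"
    using place_ring_mono_eq assms by metis+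
  then obtain a b where a: "a \<in> place_ring P" "a \<notin> place_ring P'"
    and b: "b \<in> place_ring P'" "b \<notin> place_ring P" by blast
  have n: "a \<noteq> 0" "b \<noteq> 0" using a b p.zero p'.zero by auto
  then have "val P a \<ge> 0" "val P' a < 0" "val P b < 0" "val P' b \<ge> 0"
    using a b unfolding p.R_iff p'.R_iff vge_def by auto
  then have "0 < val P (a / b)" "val P' (a / b) < 0" using n by (simp_all add: p.val_divide p'.val_divide)
  then show ?thesis using n by (intro exI[of _ "a / b"]) simp
qed

text \<open>If the function found for \<open>S\<close> is not yet negative at the new place, a high
  power of a function separating \<open>P\<close> from that place is added to it.\<close>

lemma separate_places:
  assumes "finite S" "discrete P" "\<And>P'. P' \<in> S \<Longrightarrow> discrete P'" "P \<notin> S"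
  shows "\<exists>u. u \<noteq> 0 \<and> 0 < val P u \<and> (\<forall>P'\<in>S. val P' u < 0)"
  using assms
proof (induction S rule: finite_induct)
  case empty
  interpret p: dplace P by unfold_locales fact
  show ?case using p.unif p.val_unif by (intro exI[of _ p.unif]) simp
next
  case (insert P' S)
  interpret p: dplace P by unfold_locales fact
  interpret p': dplace P' using insert by unfold_locales simp
  obtain u where u: "u \<noteq> 0" "0 < val P u" "\<And>Q. Q \<in> S \<Longrightarrow> val Q u < 0"
    using insert by (metis insert_iff)
  show ?case
  proof (cases "val P' u < 0")
    case False
    have "P \<noteq> P'" using insert by blast
    then obtain v where v: "v \<noteq> 0" "0 < val P v" "val P' v < 0"
      using separate_two_places p.disc p'.disc by blast
    \<comment> \<open>Larger than every |val Q u|, so \<open>val Q u\<close> and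
      \<open>s * val Q v\<close> never agree and nothing cancels at the old places.\<close>
    define s where "s = Suc (\<Sum>Q\<in>S. nat \<bar>val Q u\<bar>)"
    have vs: "v ^ s \<noteq> 0" using v by simp
    have s0: "0 < s" by (simp add: s_def)
    have P': "u + v ^ s \<noteq> 0 \<and> val P' (u + v ^ s) < 0"
    proof -
      have neg: "val P' (v ^ s) < 0" unfolding p'.val_power[OF v(1)] using v s0 by (simp add: mult_less_0_iff)
      then show ?thesis using p'.val_add_distinct[OF u(1) vs] False by auto
    qed
    have "0 < val P (u + v ^ s)"
    proof -
      have "0 < val P (v ^ s)" unfolding p.val_power[OF v(1)] using v s0 by simp
      then have "vge P (u + v ^ s) 1" using u by (intro p.vge_add) (auto simp: vge_def)
      then show ?thesis using P' by (simp add: vge_def)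
    qed
    moreover have "val Q (u + v ^ s) < 0" if Q: "Q \<in> S" for Q
    proof -
      interpret q: dplace Q using insert Q by unfold_locales simp
      have "nat \<bar>val Q u\<bar> \<le> (\<Sum>Q\<in>S. nat \<bar>val Q u\<bar>)"
        using Q insert.hyps by (intro member_le_sum) auto
      then have "nat \<bar>val Q u\<bar> < s" by (simp only: s_def)
      then have s: "\<bar>val Q u\<bar> < int s" by linarith
      have "val Q u \<noteq> int s * val Q v"
      proof
        assume eq: "val Q u = int s * val Q v"
        then have "val Q v \<noteq> 0" using u(3)[OF Q] by auto
        then have "int s * 1 \<le> int s * \<bar>val Q v\<bar>" by (intro mult_left_mono) auto
        then show False using s by (simp add: eq abs_mult)
      qed
      then have "val Q u \<noteq> val Q (v ^ s)" using v by (simp add: q.val_power)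
      then show ?thesis using q.val_add_distinct[OF u(1) vs] u(3)[OF Q] by auto
    qed
    ultimately show ?thesis using P' by (intro exI[of _ "u + v ^ s"]) auto
  qed (use u in blast)
qed

text \<open>For \<open>u\<close> with a zero at \<open>P\<close> and poles on \<open>S\<close>, the
  function 1 / (1 + u^s) tends to 1 at \<open>P\<close> and to 0 on \<open>S\<close> as s
  grows.\<close>

lemma approximate_one:
  assumes "finite S" "discrete P" "\<And>P'. P' \<in> S \<Longrightarrow> discrete P'" "P \<notin> S"
  shows "\<exists>w. vge P (w - 1) N \<and> (\<forall>P'\<in>S. vge P' w N)"
proof -
  interpret p: dplace P by unfold_locales fact
  obtain u where u: "u \<noteq> 0" "0 < val P u" "\<And>Q. Q \<in> S \<Longrightarrow> val Q u < 0"
    using separate_places[OF assms] by blast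
  define s where "s = Suc (nat N)"
  have us: "u ^ s \<noteq> 0" using u by simp
  define w where "w = inverse (1 + u ^ s)"
  have "int s * 1 \<le> int s * val P u" using u(2) by (intro mult_left_mono) auto
  moreover have Ns: "N \<le> int s" "1 \<le> int s" by (simp_all add: s_def)
  ultimately have big: "N \<le> val P (u ^ s)" "1 \<le> val P (u ^ s)" unfolding p.val_power[OF u(1)] mult_1_right
    by (meson order_trans)+
  have ne: "1 + u ^ s \<noteq> 0" and v0: "val P (1 + u ^ s) = 0"
    using p.val_add_eq[of 1 "u ^ s"] big by (auto simp: vge_def)
  have "w - 1 = - (u ^ s * w)" using ne by (simp add: w_def field_simps)
  moreover have "val P (u ^ s * w) = val P (u ^ s)" using us ne v0 by (simp add: w_def p.val_mult p.val_inverse)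
  ultimately have "vge P (w - 1) N" using big by (simp add: vge_def p.val_uminus)
  moreover have "vge Q w N" if Q: "Q \<in> S" for Q
  proof -
    interpret q: dplace Q using assms Q by unfold_locales simp
    have "int s * val Q u \<le> int s * (- 1)" using u(3)[OF Q] by (intro mult_left_mono) auto
    then have "val Q (u ^ s) \<le> - int s" using u by (simp add: q.val_power)
    then have "val Q (1 + u ^ s) \<le> - int s"
      using q.val_add_distinct[OF one_neq_zero us] by (auto simp: s_def)
    then show ?thesis using ne Ns by (simp add: w_def vge_def q.val_inverse)
  qed
  ultimately show ?thesis by blast
qed

lemma weak_approximation:
  assumes "finite S" and S: "\<And>P. P \<in> S \<Longrightarrow> discrete P"
  shows "\<exists>w. \<forall>P\<in>S. vge P (w - x P) N"
proof -
  \<comment> \<open>The margin over \<open>N\<close> compensates for poles of the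
    \<open>x P'\<close> in the products \<open>w P' * x P'\<close>.\<close>
  define K where "K = N + (\<Sum>P\<in>S. \<Sum>P'\<in>S. \<bar>val P (x P')\<bar>)"
  have K: "K \<ge> N + \<bar>val P (x P')\<bar>" if "P \<in> S" "P' \<in> S" for P P'
  proof -
    have "\<bar>val P (x P')\<bar> \<le> (\<Sum>P'\<in>S. \<bar>val P (x P')\<bar>)" using that assms by (intro member_le_sum) auto
    also have "\<dots> \<le> (\<Sum>P\<in>S. \<Sum>P'\<in>S. \<bar>val P (x P')\<bar>)"
      using that assms by (intro member_le_sum sum_nonneg) auto
    finally show ?thesis by (simp add: K_def)
  qed
  have "\<exists>w. vge P (w - 1) K \<and> (\<forall>P'\<in>S - {P}. vge P' w K)" if "P \<in> S" for P
    using that assms by (intro approximate_one) auto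
  then obtain w where w: "\<And>P. P \<in> S \<Longrightarrow> vge P (w P - 1) K"
    "\<And>P P'. P \<in> S \<Longrightarrow> P' \<in> S \<Longrightarrow> P' \<noteq> P \<Longrightarrow> vge P' (w P) K"
    by (metis DiffI singletonD)
  have "vge P ((\<Sum>P'\<in>S. w P' * x P') - x P) N" if P: "P \<in> S" for P
  proof -
    interpret dplace P using P S by unfold_locales simp
    have m: "vge P (a * x P') N" if "vge P a K" "P' \<in> S" for a P'
    proof (cases "x P' = 0")
      case False
      have "vge P (a * x P') (K + val P (x P'))" using that False by (intro vge_mult) (auto simp: vge_def)
      then show ?thesis by (rule vge_mono) (use K[OF P that(2)] in linarith)
    qed simp
    have "(\<Sum>P'\<in>S. w P' * x P') - x P = (w P - 1) * x P + (\<Sum>P'\<in>S - {P}. w P' * x P')"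
      using assms P by (simp add: sum.remove[of S P] algebra_simps)
    also have "vge P \<dots> N" using w P by (intro vge_add vge_sum m) auto
    finally show ?thesis .
  qed
  then show ?thesis by blast
qed

section \<open>Counting the zeros of a rational function\<close>

context ff begin

lemma iota_in: "place \<iota> Q \<Longrightarrow> \<iota> c \<in> place_ring Q"
  using place_valring(3)[of \<iota> Q] by auto

lemma place_degree_pos:
  assumes "place \<iota> Q" shows "0 < place_degree \<iota> Q"
proof (rule ccontr)
  interpret dplace Q using place_discrete[OF assms] by unfold_locales
  assume "\<not> ?thesis"
  then have "\<exists>z. residue_spans \<iota> Q 0 z" using exists_residue_basis[OF assms] by auto
  then have "1 \<in> Q" using one by (auto simp: residue_spans_def)
  then show False using one_not_nonunit P_eq by simp
qed

text \<open>Truncated expansion in powers of a uniformizer: the coefficient of the lowest power lies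
  in \<open>Q\<close>, hence vanishes, and the uniformizer is divided out.\<close>

lemma residue_indep_powers:
  assumes Q: "place \<iota> Q" and z: "residue_indep \<iota> Q n z"
    and "vge Q (\<Sum>a<e. dplace.unif Q ^ a * (\<Sum>b<n. \<iota> (c a b) * z b)) (int e)"
    and "a < e" "b < n"
  shows "c a b = 0"
proof -
  interpret dplace Q using place_discrete[OF Q] by unfold_locales
  show ?thesis using assms(3-)
  proof (induction e arbitrary: c a)
    case (Suc e)
    define h where "h a = (\<Sum>b<n. \<iota> (c a b) * z b)" for a
    define T where "T = (\<Sum>a<e. unif ^ a * h (Suc a))"
    have zR: "z b \<in> R" if "b < n" for b using z that by (auto simp: residue_indep_def)
    have hR: "h a \<in> R" for a unfolding h_def using zR iota_in[OF Q] by (intro sum mult) auto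
    have uR: "unif \<in> R" using unif P_iff by simp
    have T: "T \<in> R" unfolding T_def using hR uR by (intro sum mult power)
    have s: "(\<Sum>a<Suc e. unif ^ a * h a) = h 0 + unif * T"
      unfolding T_def by (simp add: sum.lessThan_Suc_shift sum_distrib_left mult_ac del: sum.lessThan_Suc)
    have v: "vge Q (h 0 + unif * T) (int (Suc e))" using Suc.prems(1) unfolding h_def[symmetric] s .
    then have "vge Q (h 0 + unif * T) 1" by (rule vge_mono) simp
    moreover have "vge Q (unif * T) 1" using P_ideal(1)[OF unif(2) T] by (simp only: P_vge mult.commute)
    ultimately have "vge Q (h 0 + unif * T - unif * T) 1" by (rule vge_diff)
    then have h0: "h 0 \<in> Q" by (simp only: P_vge add_diff_cancel_right')
    have c0: "c 0 b = 0" if "b < n" for b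
      using residue_indepD[OF z h0[unfolded h_def] that] .
    then have "h 0 = 0" unfolding h_def by (intro sum.neutral) auto
    then have "vge Q (unif * T) (int (Suc e))" using v by simp
    then have "vge Q T (int (Suc e) - val Q unif)" using vge_mult_iff unif(1) by blast
    then have "vge Q (\<Sum>a<e. unif ^ a * (\<Sum>b<n. \<iota> (c (Suc a) b) * z b)) (int e)"
      unfolding T_def h_def by simp
    note IH = Suc.IH[OF this]
    show ?case
    proof (cases a)
      case 0 then show ?thesis using c0 Suc.prems by simp
    next
      case (Suc a')
      then show ?thesis using IH[of a'] Suc.prems by simp
    qed
  qed simp
qed

text \<open>The inequality between ramification indices, residue degrees and field degree. At each
  zero of order e and degree f the e f elements \<open>unif ^ a * z b\<close> are independent modulo
  \<open>t\<close>; weak approximation realizes all these local families by global functions, to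
  which the counting bound applies.\<close>

lemma degree_of_zeros_le:
  assumes uv: "degree u \<le> d" "degree v \<le> d" "v \<noteq> 0"
    and t: "t = pol u / pol v" "t \<noteq> 0"
    and Z: "finite Z" "\<And>Q. Q \<in> Z \<Longrightarrow> place \<iota> Q" "\<And>Q. Q \<in> Z \<Longrightarrow> 0 < val Q t"
  shows "(\<Sum>Q\<in>Z. val Q t * int (place_degree \<iota> Q)) \<le> int (m * d)"
proof -
  define e where "e Q = nat (val Q t)" for Q
  define n where "n Q = place_degree \<iota> Q" for Q
  have "\<forall>Q\<in>Z. \<exists>z. residue_indep \<iota> Q (n Q) z" using exists_residue_basis Z unfolding n_def by blast
  then obtain z where z: "\<And>Q. Q \<in> Z \<Longrightarrow> residue_indep \<iota> Q (n Q) (z Q)" by metis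
  define x where "x Q a b = dplace.unif Q ^ a * z Q b" for Q a b
  \<comment> \<open>A precision of at least \<open>val Q t\<close> for each \<open>Q\<close> in
    \<open>Z\<close>, so that approximation errors do not matter modulo \<open>t\<close>.\<close>
  define N where "N = (\<Sum>Q\<in>Z. val Q t)"
  have N: "val Q t \<le> N" if "Q \<in> Z" for Q
    unfolding N_def using that Z by (intro member_le_sum) (auto intro: less_imp_le)
  have "\<exists>w. \<forall>Q'\<in>Z. vge Q' (w - (if Q' = Q then x Q a b else 0)) N" for Q a b
    by (rule weak_approximation) (use Z place_discrete in auto)
  then obtain W where W: "\<And>Q a b Q'. Q' \<in> Z \<Longrightarrow> vge Q' (W Q a b - (if Q' = Q then x Q a b else 0)) N"
    by metis
  define I where "I = (SIGMA Q:Z. {..<e Q} \<times> {..<n Q})"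
  define w where "w = (\<lambda>(Q, a, b). W Q a b)"
  \<comment> \<open>Functions without poles on \<open>Z\<close>: the module in which independence
    modulo \<open>t\<close> is tested.\<close>
  define M where "M = {y. \<forall>Q\<in>Z. y \<in> place_ring Q}"
  have finI: "finite I" unfolding I_def using Z by auto
  have N0: "0 \<le> N" unfolding N_def using Z by (intro sum_nonneg) (auto intro: less_imp_le)
  have xR: "x Q a b \<in> place_ring Q" if "Q \<in> Z" "b < n Q" for Q a b
  proof -
    interpret dplace Q by (rule dplace.intro) (use place_discrete Z that in blast)
    show ?thesis unfolding x_def using z[OF that(1)] that unif P_iff
      by (intro mult power) (auto simp: residue_indep_def)
  qed
  have WR: "W Q a b \<in> place_ring Q'" if "Q \<in> Z" "b < n Q" "Q' \<in> Z" for Q a b Q'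
  proof -
    interpret dplace Q' by (rule dplace.intro) (use place_discrete Z that in blast)
    let ?y = "if Q' = Q then x Q a b else 0"
    have "W Q a b - ?y \<in> place_ring Q'" using vge_mono[OF W[OF that(3)] N0] R_iff by blast
    moreover have "?y \<in> place_ring Q'" using xR that zero by auto
    ultimately show ?thesis using add[of "W Q a b - ?y" ?y] by simp
  qed
  have sub: "subring (place_ring Q)" if "Q \<in> Z" for Q
    using place_discrete[OF Z(2)[OF that]] by (simp add: subring_def discrete_def val_ring_def)
  have "card I \<le> m * d"
  proof (rule card_le_if_indep_mod[OF finI uv t, of M w])
    show "0 \<in> M" unfolding M_def using subring.zero[OF sub] by blast
  next
    fix a b assume "a \<in> M" "b \<in> M"
    then show "a + b \<in> M" unfolding M_def using subring.add[OF sub] by blast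
  next
    fix c a assume "a \<in> M"
    then show "\<iota> c * a \<in> M" unfolding M_def using subring.mult[OF sub _] iota_in Z(2) by blast
  next
    fix a assume a: "a \<in> M"
    have "t * a \<in> place_ring Q" if "Q \<in> Z" for Q
    proof -
      interpret dplace Q by (rule dplace.intro) (use place_discrete Z that in blast)
      have "t \<in> place_ring Q" using Z that by (auto simp: R_iff vge_def intro: less_imp_le)
      then show ?thesis using a that by (auto simp: M_def intro: mult)
    qed
    then show "t * a \<in> M" by (simp add: M_def)
  next
    fix i assume "i \<in> I" then show "w i \<in> M" unfolding M_def w_def I_def using WR by auto
  next
    fix c s assume s: "s \<in> M" "(\<Sum>i\<in>I. \<iota> (c i) * w i) = t * s"
    have "c (Q, a, b) = 0" if Q: "Q \<in> Z" and ab: "a < e Q" "b < n Q" for Q a b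
    proof -
      interpret dplace Q by (rule dplace.intro) (use place_discrete Z that in blast)
      have eQ: "int (e Q) = val Q t" using Z Q by (simp add: e_def less_imp_le)
      \<comment> \<open>What the \<open>w i\<close> approximate at \<open>Q\<close>: only indices
        belonging to \<open>Q\<close> have a nonzero target there, so a global relation becomes a
        local one.\<close>
      define tgt where "tgt = (\<lambda>(Q', a, b). if Q = Q' then x Q' a b else 0)"
      have "vge Q (\<Sum>i\<in>I. \<iota> (c i) * (w i - tgt i)) (int (e Q))"
      proof (intro vge_sum)
        fix i assume "i \<in> I"
        then have "vge Q (w i - tgt i) N" using W[OF Q] by (auto simp: w_def tgt_def split: prod.splits)
        moreover have "vge Q (\<iota> (c i)) 0" using iota_in Z Q R_iff by blast
        ultimately have "vge Q (\<iota> (c i) * (w i - tgt i)) (0 + N)" by (intro vge_mult)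
        then show "vge Q (\<iota> (c i) * (w i - tgt i)) (int (e Q))" by (rule vge_mono) (simp add: eQ N Q)
      qed
      moreover have "vge Q (\<Sum>i\<in>I. \<iota> (c i) * w i) (int (e Q))"
      proof -
        have "vge Q (t * s) (val Q t + 0)" using s(1) Q R_iff by (intro vge_mult) (auto simp: vge_def M_def)
        then show ?thesis unfolding s(2) eQ by simp
      qed
      ultimately have "vge Q ((\<Sum>i\<in>I. \<iota> (c i) * w i) - (\<Sum>i\<in>I. \<iota> (c i) * (w i - tgt i))) (int (e Q))"
        using vge_diff by blast
      moreover have "(\<Sum>i\<in>I. \<iota> (c i) * w i) - (\<Sum>i\<in>I. \<iota> (c i) * (w i - tgt i)) = (\<Sum>i\<in>I. \<iota> (c i) * tgt i)"
        by (simp only: right_diff_distrib sum_subtractf) simp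
      moreover have "(\<Sum>i\<in>I. \<iota> (c i) * tgt i) = (\<Sum>a<e Q. unif ^ a * (\<Sum>b<n Q. \<iota> (c (Q, a, b)) * z Q b))"
      proof -
        have "(\<Sum>i\<in>I. \<iota> (c i) * tgt i) = (\<Sum>Q'\<in>Z. \<Sum>(a, b)\<in>{..<e Q'} \<times> {..<n Q'}. \<iota> (c (Q', a, b)) * tgt (Q', a, b))"
          unfolding I_def using Z by (subst sum.Sigma) (auto simp: split_beta simp del: o_apply)
        also have "\<dots> = (\<Sum>Q'\<in>Z. if Q = Q' then \<Sum>(a, b)\<in>{..<e Q} \<times> {..<n Q}. \<iota> (c (Q, a, b)) * x Q a b else 0)"
          by (intro sum.cong refl) (auto simp: tgt_def intro!: sum.neutral)
        also have "\<dots> = (\<Sum>(a, b)\<in>{..<e Q} \<times> {..<n Q}. \<iota> (c (Q, a, b)) * x Q a b)"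
          using Z Q by simp
        also have "\<dots> = (\<Sum>a<e Q. unif ^ a * (\<Sum>b<n Q. \<iota> (c (Q, a, b)) * z Q b))"
          by (simp add: sum.cartesian_product[symmetric] x_def sum_distrib_left mult_ac)
        finally show ?thesis .
      qed
      ultimately have "vge Q (\<Sum>a<e Q. unif ^ a * (\<Sum>b<n Q. \<iota> (c (Q, a, b)) * z Q b)) (int (e Q))"
        by argo
      from residue_indep_powers[OF Z(2)[OF Q] z[OF Q] this ab] show ?thesis .
    qed
    then show "\<forall>i\<in>I. c i = 0" by (auto simp: I_def)
  qed
  moreover have "int (card I) = (\<Sum>Q\<in>Z. val Q t * int (place_degree \<iota> Q))"
    unfolding I_def using Z by (simp add: card_SigmaI e_def n_def less_imp_le)
  ultimately show ?thesis by linarith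
qed

text \<open>Every zero contributes at least 1 to the sum in \<open>degree_of_zeros_le\<close>, which
  bounds the size of all finite sets of zeros.\<close>

lemma finite_zeros:
  assumes uv: "degree u \<le> d" "degree v \<le> d" "v \<noteq> 0"
    and t: "t = pol u / pol v" "t \<noteq> 0"
  shows "finite {Q. place \<iota> Q \<and> 0 < val Q t}"
proof (rule conjunct1[OF finite_if_finite_subsets_card_bdd[of _ "m * d"]])
  fix Z assume Z: "Z \<subseteq> {Q. place \<iota> Q \<and> 0 < val Q t}" "finite Z"
  have "1 \<le> val Q t * int (place_degree \<iota> Q)" if "Q \<in> Z" for Q
    using that Z place_degree_pos[of Q] mult_mono[of 1 "val Q t" 1 "int (place_degree \<iota> Q)"] by force
  then have "(\<Sum>Q\<in>Z. 1) \<le> (\<Sum>Q\<in>Z. val Q t * int (place_degree \<iota> Q))" by (intro sum_mono)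
  also have "\<dots> \<le> int (m * d)" using Z by (intro degree_of_zeros_le[OF uv t]) auto
  finally show "card Z \<le> m * d" by (simp only: sum_constant of_nat_1 mult_1_right of_nat_le_iff)
qed

end

section \<open>Riemann-Roch spaces\<close>

locale linear_space = V: vector_space scale
  for scale :: "'k::field \<Rightarrow> 'v::ab_group_add \<Rightarrow> 'v"
begin

text \<open>Accompanies statements about \<open>V.dim\<close>, which is a cardinality and therefore
  0 for a space of infinite dimension.\<close>

definition fin_spanned where "fin_spanned W \<longleftrightarrow> (\<exists>B. finite B \<and> W \<subseteq> V.span B)"

lemma fin_spanned_mono: "fin_spanned V \<Longrightarrow> W \<subseteq> V \<Longrightarrow> fin_spanned W"
  by (auto simp: fin_spanned_def)

lemma fin_spanned_basis:
  assumes "fin_spanned W"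
  shows "\<exists>B. finite B \<and> B \<subseteq> W \<and> V.independent B \<and> W \<subseteq> V.span B \<and> card B = V.dim W"
proof -
  obtain B where B: "B \<subseteq> W" "V.independent B" "W \<subseteq> V.span B" "card B = V.dim W" by (rule V.basis_exists)
  obtain T where "finite T" "W \<subseteq> V.span T" using assms by (auto simp: fin_spanned_def)
  then have "finite B" using V.independent_span_bound[of T B] B by auto
  then show ?thesis using B by blast
qed

text \<open>One vector with \<open>g v \<noteq> 0\<close> together with a basis of the kernel spans
  \<open>U\<close>. Linearity is asked on \<open>U\<close> only, because the residue coordinates to
  which this is applied make sense only for functions that are integral after scaling.\<close>

lemma dim_le_functional_kernel:
  assumes U: "V.subspace U" and add: "\<And>a b. a \<in> U \<Longrightarrow> b \<in> U \<Longrightarrow> g (a + b) = g a + g b"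
    and scale: "\<And>c a. a \<in> U \<Longrightarrow> g (scale c a) = c * g a"
    and W: "fin_spanned {a \<in> U. g a = 0}"
  shows "fin_spanned U \<and> V.dim U \<le> V.dim {a \<in> U. g a = 0} + 1"
proof (cases "\<exists>v\<in>U. g v \<noteq> 0")
  case True
  then obtain v where v: "v \<in> U" "g v \<noteq> 0" by blast
  obtain B where B: "finite B" "{a \<in> U. g a = 0} \<subseteq> V.span B" "card B = V.dim {a \<in> U. g a = 0}"
    using fin_spanned_basis[OF W] by blast
  have "a \<in> V.span (insert v B)" if a: "a \<in> U" for a
  proof -
    let ?r = "a + scale (- (g a / g v)) v"
    have "?r \<in> {a \<in> U. g a = 0}"
      using a v U by (simp add: V.subspace_add V.subspace_scale add scale del: V.scale_minus_left)
    then have "?r \<in> V.span (insert v B)" using B(2) V.span_mono[of B "insert v B"] by auto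
    moreover have "scale (g a / g v) v \<in> V.span (insert v B)" by (simp add: V.span_base V.span_scale)
    ultimately have "?r + scale (g a / g v) v \<in> V.span (insert v B)" by (rule V.span_add)
    then show ?thesis by simp
  qed
  then have s: "U \<subseteq> V.span (insert v B)" by blast
  then have "V.dim U \<le> card (insert v B)" using B by (intro V.dim_le_card) auto
  also have "\<dots> \<le> card B + 1" using B by (simp add: card_insert_if)
  finally show ?thesis using s B unfolding fin_spanned_def by (metis finite_insert)
next
  case False
  then have "{a \<in> U. g a = 0} = U" by auto
  then show ?thesis using W by simp
qed

lemma dim_le_functionals_kernel:
  assumes U: "V.subspace U" and add: "\<And>i a b. i < d \<Longrightarrow> a \<in> U \<Longrightarrow> b \<in> U \<Longrightarrow> g (a + b) i = g a i + g b i"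
    and scale: "\<And>i c a. i < d \<Longrightarrow> a \<in> U \<Longrightarrow> g (scale c a) i = c * g a i"
    and W: "fin_spanned {a \<in> U. \<forall>i<d. g a i = 0}"
  shows "fin_spanned U \<and> V.dim U \<le> V.dim {a \<in> U. \<forall>i<d. g a i = 0} + (d :: nat)"
  using assms
proof (induction d arbitrary: U)
  case (Suc d)
  let ?V = "{a \<in> U. g a d = 0}"
  have e: "{a \<in> ?V. \<forall>i<d. g a i = 0} = {a \<in> U. \<forall>i<Suc d. g a i = 0}"
    by (auto simp: less_Suc_eq)
  have z: "g 0 d = 0"
    using Suc.prems(3)[of d 0 0] Suc.prems(1) by (simp add: V.subspace_0)
  have "V.subspace ?V"
    using Suc.prems(1-3) z by (auto simp: V.subspace_def)
  then have "fin_spanned ?V \<and> V.dim ?V \<le> V.dim {a \<in> ?V. \<forall>i<d. g a i = 0} + d"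
    using Suc.prems unfolding e[symmetric] by (intro Suc.IH) auto
  moreover from this have "fin_spanned U \<and> V.dim U \<le> V.dim ?V + 1"
    using Suc.prems(1-3) by (intro dim_le_functional_kernel) auto
  ultimately show ?case unfolding e by linarith
qed simp

end

section \<open>Growth of L(A) with the divisor A\<close>

context ff begin

declare o_apply [simp del] o_def [simp del]

sublocale linear_space "\<lambda>c z. \<iota> c * z"
  by unfold_locales (simp_all add: algebra_simps)

lemma mem_rr: "z \<in> riemann_roch_space \<iota> A \<longleftrightarrow> (\<forall>Q. place \<iota> Q \<longrightarrow> vge Q z (- Poly_Mapping.lookup A Q))"
  by (auto simp: riemann_roch_space_def vge_def)

lemma vge_iota: "place \<iota> Q \<Longrightarrow> vge Q z n \<Longrightarrow> vge Q (\<iota> c * z) n"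
proof -
  assume Q: "place \<iota> Q" and z: "vge Q z n"
  interpret dplace Q using place_discrete[OF Q] by unfold_locales
  have "vge Q (\<iota> c) 0" using iota_in[OF Q] R_iff by blast
  then show ?thesis using vge_mult[of "\<iota> c" 0 z n] z by simp
qed

lemma subspace_rr: "V.subspace (riemann_roch_space \<iota> A)"
proof (rule V.subspaceI)
  fix x y assume "x \<in> riemann_roch_space \<iota> A" "y \<in> riemann_roch_space \<iota> A"
  then show "x + y \<in> riemann_roch_space \<iota> A"
    unfolding mem_rr using dplace.vge_add dplace.intro place_discrete by metis
qed (auto simp: mem_rr intro!: vge_iota, simp add: vge_def)

lemma div_degree_superset:
  assumes "finite S" "Poly_Mapping.keys A \<subseteq> S"
  shows "div_degree \<iota> A = (\<Sum>P\<in>S. Poly_Mapping.lookup A P * int (place_degree \<iota> P))"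
  unfolding div_degree_def using assms by (intro sum.mono_neutral_left) (auto simp: in_keys_iff)

lemma div_degree_add: "div_degree \<iota> (A + B) = div_degree \<iota> A + div_degree \<iota> B"
proof -
  let ?S = "Poly_Mapping.keys A \<union> Poly_Mapping.keys B"
  have "finite ?S" by simp
  then show ?thesis
    using div_degree_superset[of ?S "A + B"] div_degree_superset[of ?S A] div_degree_superset[of ?S B]
      Poly_Mapping.keys_add[of A B]
    by (simp add: lookup_add distrib_right sum.distrib)
qed

lemma div_degree_single: "div_degree \<iota> (Poly_Mapping.single Q n) = n * int (place_degree \<iota> Q)"
  by (subst div_degree_superset[of "{Q}"]) auto

lemma div_degree_sum: "div_degree \<iota> (sum A S) = (\<Sum>i\<in>S. div_degree \<iota> (A i))"
proof (induction S rule: infinite_finite_induct)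
  case (insert x F)
  then show ?case by (simp add: div_degree_add)
qed (simp_all add: div_degree_def)

abbreviation "rr A \<equiv> riemann_roch_space \<iota> A"

lemma ell_eq_dim: "ell \<iota> A = V.dim (rr A)"
  by (simp add: ell_def)

text \<open>Scaled by \<open>u\<close>, the functions of \<open>rr B\<close> become integral at
  \<open>Q\<close>, and those of \<open>rr A\<close> are exactly the ones with residue 0. The
  coordinates of the residue are therefore \<open>place_degree \<iota> Q\<close> functionals with
  common kernel \<open>rr A\<close>.\<close>

lemma ell_add_place:
  assumes Q: "place \<iota> Q" and fin: "fin_spanned (rr A)"
  defines "B \<equiv> A + Poly_Mapping.single Q 1"
  shows "fin_spanned (rr B) \<and> ell \<iota> B \<le> ell \<iota> A + place_degree \<iota> Q"
proof -
  interpret dplace Q using place_discrete[OF Q] by unfold_locales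
  define n where "n = place_degree \<iota> Q"
  obtain z where z: "residue_indep \<iota> Q n z" "residue_spans \<iota> Q n z"
    using exists_residue_basis[OF Q] unfolding n_def by blast
  have "\<forall>w\<in>R. \<exists>c. w - (\<Sum>i<n. \<iota> (c i) * z i) \<in> Q" using z(2) unfolding residue_spans_def .
  then obtain C where C: "\<And>w. w \<in> R \<Longrightarrow> w - (\<Sum>i<n. \<iota> (C w i) * z i) \<in> Q" by metis
  \<comment> \<open>\<open>C\<close> is an arbitrary choice of coefficients; independence determines
    those with index below \<open>n\<close>, which is what makes \<open>g\<close> linear.\<close>
  have Cuniq: "C w i = c i" if w: "w \<in> R" "w - (\<Sum>i<n. \<iota> (c i) * z i) \<in> Q" and i: "i < n" for w c i
  proof -
    have "(w - (\<Sum>i<n. \<iota> (c i) * z i)) - (w - (\<Sum>i<n. \<iota> (C w i) * z i)) \<in> Q"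
      using C[OF w(1)] w(2) vge_diff unfolding P_vge by blast
    moreover have "(w - (\<Sum>i<n. \<iota> (c i) * z i)) - (w - (\<Sum>i<n. \<iota> (C w i) * z i))
        = (\<Sum>i<n. \<iota> (C w i - c i) * z i)"
      by (simp only: iota.diff left_diff_distrib sum_subtractf) simp
    ultimately have "(\<Sum>i<n. \<iota> (C w i - c i) * z i) \<in> Q" by argo
    from residue_indepD[OF z(1) this i] show ?thesis by simp
  qed
  define u where "u = unif powi (Poly_Mapping.lookup A Q + 1)"
  have u: "u \<noteq> 0" "val Q u = Poly_Mapping.lookup A Q + 1" using unif by (simp_all add: u_def val_powi)
  have uR: "u * w \<in> R" if "w \<in> rr B" for w
  proof -
    have "vge Q w (- Poly_Mapping.lookup A Q - 1)" using that Q unfolding mem_rr B_def by (auto simp: lookup_add)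
    then show ?thesis using vge_mult_iff[OF u(1), of w 0] by (simp add: R_iff u)
  qed
  define g where "g w = C (u * w)" for w
  have ker: "{w \<in> rr B. \<forall>i<n. g w i = 0} = rr A"
  proof (intro equalityI subsetI)
    fix w assume w: "w \<in> {w \<in> rr B. \<forall>i<n. g w i = 0}"
    then have "(\<Sum>i<n. \<iota> (C (u * w) i) * z i) = 0" by (intro sum.neutral) (auto simp: g_def)
    then have "u * w \<in> Q" using C[OF uR[of w]] w by simp
    then have "vge Q w (1 - val Q u)" unfolding P_vge using vge_mult_iff[OF u(1), of w 1] by simp
    then have Qw: "vge Q w (- Poly_Mapping.lookup A Q)" by (simp add: u)
    show "w \<in> rr A" unfolding mem_rr
    proof (intro allI impI)
      fix Q' assume Q': "place \<iota> Q'"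
      have "vge Q' w (- Poly_Mapping.lookup B Q')" using w Q' mem_rr by blast
      then show "vge Q' w (- Poly_Mapping.lookup A Q')"
        using Qw by (cases "Q' = Q") (auto simp: B_def lookup_add lookup_single)
    qed
  next
    fix w assume w: "w \<in> rr A"
    have wB: "w \<in> rr B" unfolding mem_rr
    proof (intro allI impI)
      fix Q' assume Q': "place \<iota> Q'"
      have "vge Q' w (- Poly_Mapping.lookup A Q')" using w Q' mem_rr by blast
      then show "vge Q' w (- Poly_Mapping.lookup B Q')"
        by (auto simp: B_def lookup_add lookup_single vge_def when_def)
    qed
    have "vge Q w (1 - val Q u)" using w Q unfolding mem_rr by (simp add: u)
    then have "u * w \<in> Q" unfolding P_vge using vge_mult_iff[OF u(1), of w 1] by simp
    moreover have "u * w - (\<Sum>i<n. \<iota> 0 * z i) = u * w" by (simp only: iota.zero) simp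
    ultimately have "C (u * w) i = 0" if "i < n" for i
      using Cuniq[OF uR[OF wB], of "\<lambda>_. 0" i] that by argo
    then show "w \<in> {w \<in> rr B. \<forall>i<n. g w i = 0}" using wB by (simp add: g_def)
  qed
  have "fin_spanned (rr B) \<and> V.dim (rr B) \<le> V.dim {w \<in> rr B. \<forall>i<n. g w i = 0} + n"
  proof (rule dim_le_functionals_kernel[OF subspace_rr])
    fix i a b assume i: "i < n" and ab: "a \<in> rr B" "b \<in> rr B"
    have abB: "a + b \<in> rr B" using V.subspace_add[OF subspace_rr ab] .
    have "(u * a - (\<Sum>i<n. \<iota> (g a i) * z i)) + (u * b - (\<Sum>i<n. \<iota> (g b i) * z i)) \<in> Q"
      using C[OF uR[OF ab(1)]] C[OF uR[OF ab(2)]] P_ideal(2) unfolding g_def by blast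
    moreover have "(u * a - (\<Sum>i<n. \<iota> (g a i) * z i)) + (u * b - (\<Sum>i<n. \<iota> (g b i) * z i))
        = u * (a + b) - (\<Sum>i<n. \<iota> (g a i + g b i) * z i)"
      by (simp only: iota.add distrib_right sum.distrib) (simp add: algebra_simps)
    ultimately have "u * (a + b) - (\<Sum>i<n. \<iota> (g a i + g b i) * z i) \<in> Q" by argo
    then show "g (a + b) i = g a i + g b i"
      using Cuniq[OF uR[OF abB], of "\<lambda>i. g a i + g b i" i] i by (simp add: g_def)
  next
    fix i c a assume i: "i < n" and a: "a \<in> rr B"
    have caB: "\<iota> c * a \<in> rr B" using V.subspace_scale[OF subspace_rr a] .
    have "\<iota> c * (u * a - (\<Sum>i<n. \<iota> (g a i) * z i)) \<in> Q"
      using C[OF uR[OF a]] P_ideal(1) iota_in[OF Q] unfolding g_def by blast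
    moreover have "\<iota> c * (u * a - (\<Sum>i<n. \<iota> (g a i) * z i))
        = u * (\<iota> c * a) - (\<Sum>i<n. \<iota> (c * g a i) * z i)"
      by (simp only: iota.mult right_diff_distrib sum_distrib_left mult_ac)
    ultimately have "u * (\<iota> c * a) - (\<Sum>i<n. \<iota> (c * g a i) * z i) \<in> Q" by argo
    then show "g (\<iota> c * a) i = c * g a i"
      using Cuniq[OF uR[OF caB], of "\<lambda>i. c * g a i" i] i unfolding g_def by blast
  qed (use fin ker in simp)
  then show ?thesis unfolding ker ell_eq_dim n_def[symmetric] .
qed

lemma ell_add_place_multiple:
  assumes Q: "place \<iota> Q" and fin: "fin_spanned (rr A)"
  shows "fin_spanned (rr (A + Poly_Mapping.single Q (int n))) \<and>
    ell \<iota> (A + Poly_Mapping.single Q (int n)) \<le> ell \<iota> A + n * place_degree \<iota> Q"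
proof (induction n)
  case (Suc n)
  let ?A = "A + Poly_Mapping.single Q (int n)"
  have "int (Suc n) = int n + 1" by simp
  then have e: "A + Poly_Mapping.single Q (int (Suc n)) = ?A + Poly_Mapping.single Q 1"
    by (metis add.assoc single_add)
  have "fin_spanned (rr (?A + Poly_Mapping.single Q 1)) \<and>
      ell \<iota> (?A + Poly_Mapping.single Q 1) \<le> ell \<iota> ?A + place_degree \<iota> Q"
    using Suc by (intro ell_add_place[OF Q]) blast
  then show ?case unfolding e using Suc by auto
qed (use fin in simp)

text \<open>Each added place raises the degree by its own degree and \<open>ell\<close> by at most
  as much; \<open>B\<close> is reached from \<open>A\<close> one support point at a time.\<close>

lemma degree_minus_ell_mono:
  assumes A: "is_divisor \<iota> A" and B: "is_divisor \<iota> B" and fin: "fin_spanned (rr A)"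
    and le: "\<And>Q. Poly_Mapping.lookup A Q \<le> Poly_Mapping.lookup B Q"
  shows "div_degree \<iota> A - int (ell \<iota> A) \<le> div_degree \<iota> B - int (ell \<iota> B)"
proof -
  define S where "S = Poly_Mapping.keys A \<union> Poly_Mapping.keys B"
  have S: "finite S" "\<And>Q. Q \<in> S \<Longrightarrow> place \<iota> Q" using A B by (auto simp: S_def is_divisor_def)
  define e where "e Q = nat (Poly_Mapping.lookup B Q - Poly_Mapping.lookup A Q)" for Q
  define E where "E T = (\<Sum>Q\<in>T. Poly_Mapping.single Q (int (e Q)))" for T
  have main: "fin_spanned (rr (A + E T)) \<and>
      div_degree \<iota> A - int (ell \<iota> A) \<le> div_degree \<iota> (A + E T) - int (ell \<iota> (A + E T))"
    if "finite T" "T \<subseteq> S" for T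
    using that
  proof (induction T rule: finite_induct)
    case (insert Q T)
    let ?C = "A + E T"
    have IH: "fin_spanned (rr ?C)"
        "div_degree \<iota> A - int (ell \<iota> A) \<le> div_degree \<iota> ?C - int (ell \<iota> ?C)"
      using insert.IH insert.prems by blast+
    have e: "A + E (insert Q T) = ?C + Poly_Mapping.single Q (int (e Q))"
      using insert by (simp add: E_def add_ac)
    have "place \<iota> Q" using insert S by blast
    from ell_add_place_multiple[OF this IH(1), of "e Q"] IH(2) show ?case
      unfolding e div_degree_add[of ?C] div_degree_single
      by (auto simp flip: of_nat_mult)
  qed (use fin in \<open>simp add: E_def\<close>)
  have AB: "A + E S = B"
  proof (rule poly_mapping_eqI)
    fix Q
    have "Poly_Mapping.lookup (E S) Q = (\<Sum>Q'\<in>S. int (e Q') when Q' = Q)"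
      by (simp add: E_def lookup_sum lookup_single)
    also have "\<dots> = (if Q \<in> S then int (e Q) else 0)" using S(1) by (simp add: when_def)
    finally show "Poly_Mapping.lookup (A + E S) Q = Poly_Mapping.lookup B Q"
      using le[of Q] by (auto simp: lookup_add e_def S_def in_keys_iff)
  qed
  show ?thesis using main[OF S(1) order.refl] unfolding AB by blast
qed

end

section \<open>Places of the rational function field\<close>

text \<open>The rational function field is an extension of itself with m = 1, so discreteness of its
  places is an instance of the general result.\<close>

interpretation rat: ff "id :: 'a::{field,finite} poly fract \<Rightarrow> 'a poly fract" 1 1 1
proof unfold_locales
  fix z :: "'a poly fract"
  show "\<exists>c. z = (\<Sum>i<1. id (c i) * 1 ^ i)" by (intro exI[of _ "\<lambda>_. z"]) simp
qed (auto simp: field_hom_def)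

lemma rat_discrete: "place (rat_const :: 'a::{field,finite} \<Rightarrow> _) P \<Longrightarrow> discrete P"
  using rat.place_discrete[of P] by simp

abbreviation "xx \<equiv> to_fract [:0, 1 :: 'a :: {field,finite}:]"

lemma xx_not_const: "xx \<noteq> rat_const c" "inverse xx \<noteq> rat_const c"
proof -
  show "xx \<noteq> rat_const c" by (simp add: rat_const_def)
  show "inverse xx \<noteq> rat_const c"
  proof
    assume "inverse xx = rat_const c"
    then have "1 = rat_const c * xx" by (metis left_inverse to_fract_eq_0_iff pCons_eq_0_iff one_neq_zero)
    also have "\<dots> = to_fract [:0, c:]" by (simp add: rat_const_def flip: to_fract_mult)
    finally have "[:0, c:] = 1" by (metis to_fract_1 to_fract_eq_iff)
    then show False by (simp add: one_pCons)
  qed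
qed

text \<open>The point is that the constants form a proper subset of \<open>R\<close>: either
  \<open>x\<close> or 1 / x is in \<open>R\<close>, and neither is constant.\<close>

lemma (in ff) valuation_ringI:
  assumes "val_ring R" "range \<iota> \<subseteq> R" shows "valuation_ring \<iota> R"
proof -
  interpret valring R by unfold_locales fact
  have "\<exists>z. z \<in> R \<and> z \<notin> range \<iota>"
  proof (cases "\<phi> xx \<in> R")
    case True
    then show ?thesis by (intro exI[of _ "\<phi> xx"]) (auto simp: o_apply xx_not_const)
  next
    case False
    then have "inverse (\<phi> xx) \<in> R" by (rule total)
    then have "\<phi> (inverse xx) \<in> R" by simp
    then show ?thesis
      by (intro exI[of _ "\<phi> (inverse xx)"]) (auto simp: o_apply xx_not_const simp del: phi.inverse)
  qed
  then show ?thesis using assms unfolding valuation_ring_def val_ring_def by auto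
qed

lemma (in ff) place_nonunits:
  assumes "val_ring R" "range \<iota> \<subseteq> R"
  shows "place \<iota> (nonunits R)" "place_ring (nonunits R) = R"
proof -
  interpret valring R by unfold_locales fact
  show "place \<iota> (nonunits R)" using valuation_ringI[OF assms] place_iff by blast
  show "place_ring (nonunits R) = R" by (rule place_ring_nonunits)
qed

text \<open>A divisor \<open>p\<close> of least positive degree is prime. If p divides u v, let
  \<open>w\<close> be of least degree with p | w v; then \<open>w\<close> divides every such
  multiplier, in particular \<open>p\<close> and \<open>u\<close>. Unless p | v, \<open>w\<close> is
  not constant, so by minimality it is associated to \<open>p\<close>.\<close>

lemma prime_divisor_exists:
  fixes b :: "'a::field poly"
  assumes "0 < degree b"
  shows "\<exists>p. prime_elem p \<and> p dvd b"
proof -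
  obtain p where p: "p dvd b" "0 < degree p"
    and min: "\<And>p'. p' dvd b \<Longrightarrow> 0 < degree p' \<Longrightarrow> degree p \<le> degree p'"
    using ex_has_least_nat[of "\<lambda>p. p dvd b \<and> 0 < degree p" b degree] assms by auto
  have p0: "p \<noteq> 0" using p by auto
  have "p dvd u \<or> p dvd v" if uv: "p dvd u * v" for u v
  proof (rule disjCI)
    assume nv: "\<not> p dvd v"
    have "p \<noteq> 0 \<and> p dvd p * v" using p0 by simp
    then obtain w where w: "w \<noteq> 0" "p dvd w * v"
      and wmin: "\<And>w'. w' \<noteq> 0 \<Longrightarrow> p dvd w' * v \<Longrightarrow> degree w \<le> degree w'"
      using ex_has_least_nat[of "\<lambda>w. w \<noteq> 0 \<and> p dvd w * v" p degree] by metis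
    have wd: "w dvd u'" if "p dvd u' * v" for u'
    proof -
      have e: "u' mod w = u' - u' div w * w" by (simp add: minus_div_mult_eq_mod)
      have "p dvd u' mod w * v" unfolding e left_diff_distrib
        using that w(2) by (intro dvd_diff) (auto simp: mult.assoc)
      then have "u' mod w = 0" using wmin[of "u' mod w"] degree_mod_less[OF w(1), of u'] by force
      then show ?thesis by auto
    qed
    have "w dvd p" by (rule wd) simp
    then obtain k where k: "p = w * k" by blast
    have dw: "0 < degree w"
    proof (rule ccontr)
      assume "\<not> 0 < degree w"
      then obtain c where c: "w = [:c:]" by (metis degree_eq_zeroE gr0I)
      then have "c \<noteq> 0" using w by simp
      then show False using w(2) nv by (simp add: c dvd_smult_iff)
    qed
    have "degree p \<le> degree w" using min[OF _ dw] \<open>w dvd p\<close> p dvd_trans by blast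
    then have "degree k = 0" using k p0 by (simp add: degree_mult_eq)
    then obtain c where "k = [:c:]" by (metis degree_eq_zeroE)
    then have "w = smult (inverse c) p" using k p0 by auto
    then have "p dvd w" by (simp add: dvd_smult)
    then show "p dvd u" using wd[OF uv] dvd_trans by blast
  qed
  moreover have "\<not> p dvd 1" using p by (simp add: is_unit_iff_degree[OF p0])
  ultimately show ?thesis using p p0 unfolding prime_elem_def by blast
qed

text \<open>A denominator of least degree shares no prime factor with its numerator, since such a
  factor could be cancelled.\<close>

lemma reduced_fraction:
  fixes z :: "'a::field poly fract"
  assumes "z \<noteq> 0"
  shows "\<exists>a b. a \<noteq> 0 \<and> b \<noteq> 0 \<and> z = to_fract a / to_fract b \<and>
    (\<forall>p. prime_elem p \<longrightarrow> \<not> (p dvd a \<and> p dvd b))"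
proof -
  obtain a0 b0 where "b0 \<noteq> 0" "z = to_fract a0 / to_fract b0" using to_fract_surj by blast
  then have "b0 \<noteq> 0 \<and> (\<exists>a. z * to_fract b0 = to_fract a)" by auto
  then obtain b where b: "b \<noteq> 0" "\<exists>a. z * to_fract b = to_fract a"
    and min: "\<And>b'. b' \<noteq> 0 \<Longrightarrow> \<exists>a. z * to_fract b' = to_fract a \<Longrightarrow> degree b \<le> degree b'"
    using ex_has_least_nat[of "\<lambda>b. b \<noteq> 0 \<and> (\<exists>a. z * to_fract b = to_fract a)" b0 degree] by metis
  obtain a where a: "z * to_fract b = to_fract a" using b by blast
  have "\<not> (p dvd a \<and> p dvd b)" if p: "prime_elem p" for p
  proof
    assume "p dvd a \<and> p dvd b"
    then obtain a' b' where ab: "a = p * a'" "b = p * b'" by (meson dvdE)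
    have p0: "p \<noteq> 0" and pu: "\<not> p dvd 1" using p by (auto simp: prime_elem_def)
    have "z * to_fract b' = to_fract a'" using a p0 unfolding ab by (simp add: mult.left_commute)
    then have "degree b \<le> degree b'" using min[of b'] b ab by auto
    moreover have "degree p \<noteq> 0" using pu is_unit_iff_degree[OF p0] by blast
    ultimately show False using b ab p0 by (simp add: degree_mult_eq)
  qed
  moreover have "a \<noteq> 0" using a b assms by auto
  moreover have "z = to_fract a / to_fract b" using a b by (simp add: field_simps)
  ultimately show ?thesis using b by blast
qed

text \<open>For prime \<open>p\<close>, the localization of k[x] at \<open>p\<close>;
  \<open>ring_inf\<close> is the valuation ring of minus the degree.\<close>

definition ring_at :: "'a::field poly \<Rightarrow> 'a poly fract set" where
  "ring_at p = {to_fract a / to_fract b | a b. \<not> p dvd b}"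

definition ring_inf :: "'a::field poly fract set" where
  "ring_inf = {to_fract a / to_fract b | a b. b \<noteq> 0 \<and> degree a \<le> degree b}"

lemma ring_atI: "\<not> p dvd b \<Longrightarrow> to_fract a / to_fract b \<in> ring_at p"
  by (auto simp: ring_at_def)

lemma ring_infI: "b \<noteq> 0 \<Longrightarrow> degree a \<le> degree b \<Longrightarrow> to_fract a / to_fract b \<in> ring_inf"
  by (auto simp: ring_inf_def)

lemma to_fract_ring_at: "prime_elem p \<Longrightarrow> to_fract a \<in> ring_at p"
  using ring_atI[of p 1 a] by (auto simp: prime_elem_def)

lemma const_ring_inf: "rat_const c \<in> ring_inf"
  using ring_infI[of 1 "[:c:]"] by (simp add: rat_const_def)

lemma inverse_notin_ring_at:
  assumes "prime_elem p" shows "inverse (to_fract p) \<notin> ring_at p"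
proof
  assume "inverse (to_fract p) \<in> ring_at p"
  then obtain a b where ab: "inverse (to_fract p) = to_fract a / to_fract b" "\<not> p dvd b"
    by (auto simp: ring_at_def)
  moreover have "p \<noteq> 0" using assms by (simp add: prime_elem_def)
  moreover have "b \<noteq> 0" using ab by auto
  ultimately have "to_fract b = to_fract (p * a)" by (simp add: field_simps)
  then have "b = p * a" by (simp only: to_fract_eq_iff)
  then show False using ab by simp
qed

lemma xx_notin_ring_inf: "to_fract [:0, 1:] \<notin> (ring_inf :: 'a::field poly fract set)"
proof
  assume "to_fract [:0, 1:] \<in> (ring_inf :: 'a poly fract set)"
  then obtain a b :: "'a poly" where ab: "to_fract [:0, 1:] = to_fract a / to_fract b" "b \<noteq> 0" "degree a \<le> degree b"
    by (auto simp: ring_inf_def)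
  then have "to_fract a = to_fract ([:0, 1:] * b)" unfolding to_fract_mult by (simp add: field_simps)
  then have "a = [:0, 1:] * b" by (simp only: to_fract_eq_iff)
  then show False using ab by (simp add: degree_mult_eq del: mult_pCons_left)
qed

lemma val_ring_at:
  assumes p: "prime_elem p" shows "val_ring (ring_at p)"
proof -
  have p0: "p \<noteq> 0" and pu: "\<not> p dvd 1" and pm: "\<And>a b. p dvd a * b \<Longrightarrow> p dvd a \<or> p dvd b"
    using p by (auto simp: prime_elem_def)
  have "is_subring (ring_at p)"
    unfolding is_subring_def
  proof (intro conjI ballI)
    show "1 \<in> ring_at p" using to_fract_ring_at[OF p, of 1] by simp
  next
    fix x y assume "x \<in> ring_at p" "y \<in> ring_at p"
    then obtain a b c d where x: "x = to_fract a / to_fract b" "\<not> p dvd b"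
      and y: "y = to_fract c / to_fract d" "\<not> p dvd d" by (auto simp: ring_at_def)
    have n: "b \<noteq> 0" "d \<noteq> 0" "\<not> p dvd b * d" using x y pm by auto
    have "x - y = to_fract (a * d - c * b) / to_fract (b * d)" using n by (simp add: x y field_simps)
    then show "x - y \<in> ring_at p" using ring_atI[OF n(3)] by metis
    have "x * y = to_fract (a * c) / to_fract (b * d)" by (simp add: x y)
    then show "x * y \<in> ring_at p" using ring_atI[OF n(3)] by metis
  qed
  moreover have "inverse (to_fract p) \<notin> ring_at p" by (rule inverse_notin_ring_at[OF p])
  moreover have "z \<in> ring_at p \<or> inverse z \<in> ring_at p" for z
  proof (cases "z = 0")
    case False
    then obtain a b where "z = to_fract a / to_fract b" "\<not> (p dvd a \<and> p dvd b)"
      using reduced_fraction[OF False] p by blast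
    then show ?thesis using ring_atI[of p b a] ring_atI[of p a b] by auto
  qed (use to_fract_ring_at[OF p, of 0] in simp)
  ultimately show ?thesis unfolding val_ring_def by blast
qed

lemma val_ring_inf: "val_ring (ring_inf :: 'a::field poly fract set)"
proof -
  have "is_subring (ring_inf :: 'a poly fract set)"
    unfolding is_subring_def
  proof (intro conjI ballI)
    show "1 \<in> (ring_inf :: 'a poly fract set)" using ring_infI[of 1 "1 :: 'a poly"] by simp
  next
    fix x y :: "'a poly fract" assume "x \<in> ring_inf" "y \<in> ring_inf"
    then obtain a b c d where x: "x = to_fract a / to_fract b" "b \<noteq> 0" "degree a \<le> degree b"
      and y: "y = to_fract c / to_fract d" "d \<noteq> 0" "degree c \<le> degree d" by (auto simp: ring_inf_def)
    have n: "b * d \<noteq> 0" "degree (b * d) = degree b + degree d" using x y by (auto simp: degree_mult_eq)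
    have "degree (a * d) \<le> degree (b * d)" "degree (c * b) \<le> degree (b * d)" "degree (a * c) \<le> degree (b * d)"
      unfolding n(2) by (rule order_trans[OF degree_mult_le]; use x y in simp)+
    then have d: "degree (a * d - c * b) \<le> degree (b * d)" "degree (a * c) \<le> degree (b * d)"
      by (auto intro: degree_diff_le)
    have "x - y = to_fract (a * d - c * b) / to_fract (b * d)" using x y by (simp add: x y field_simps)
    then show "x - y \<in> ring_inf" using ring_infI[OF n(1) d(1)] by metis
    have "x * y = to_fract (a * c) / to_fract (b * d)" by (simp add: x y)
    then show "x * y \<in> ring_inf" using ring_infI[OF n(1) d(2)] by metis
  qed
  moreover have "to_fract [:0, 1:] \<notin> (ring_inf :: 'a poly fract set)" by (rule xx_notin_ring_inf)
  moreover have "z \<in> ring_inf \<or> inverse z \<in> ring_inf" for z :: "'a poly fract"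
  proof -
    obtain a b where "b \<noteq> 0" "z = to_fract a / to_fract b" using to_fract_surj by blast
    then show ?thesis using ring_infI[of b a] ring_infI[of a b] ring_infI[of 1 "0 :: 'a poly"]
      by (cases "a = 0"; cases "degree a \<le> degree b") auto
  qed
  ultimately show ?thesis unfolding val_ring_def by blast
qed

section \<open>The places of prime polynomials and the place at infinity\<close>

definition "place_poly p = nonunits (ring_at p)"
definition "place_inf = nonunits ring_inf"
abbreviation "place_at a \<equiv> place_poly [:- a, 1:]"

lemma place_poly:
  fixes p :: "'a::{field,finite} poly"
  assumes "prime_elem p"
  shows "place rat_const (place_poly p)" "place_ring (place_poly p) = ring_at p" "discrete (place_poly p)"
proof -
  have c: "range rat_const \<subseteq> ring_at p" using to_fract_ring_at[OF assms] by (auto simp: rat_const_def)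
  show "place rat_const (place_poly p)" "place_ring (place_poly p) = ring_at p"
    using rat.place_nonunits[OF val_ring_at[OF assms]] c unfolding place_poly_def by simp_all
  then show "discrete (place_poly p)" using rat_discrete by blast
qed

lemma place_inf:
  shows "place rat_const (place_inf :: 'a::{field,finite} poly fract set)"
    "place_ring place_inf = (ring_inf :: 'a poly fract set)" "discrete (place_inf :: 'a poly fract set)"
proof -
  have c: "range rat_const \<subseteq> (ring_inf :: 'a poly fract set)" using const_ring_inf by auto
  show "place rat_const (place_inf :: 'a::{field,finite} poly fract set)"
    "place_ring place_inf = (ring_inf :: 'a poly fract set)"
    using rat.place_nonunits[OF val_ring_inf] c unfolding place_inf_def by simp_all
  then show "discrete (place_inf :: 'a poly fract set)" using rat_discrete by blast
qed

lemma prime_elem_linear: "prime_elem [:- a, 1 :: 'a::field:]"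
  unfolding prime_elem_def by (auto simp: poly_eq_0_iff_dvd[symmetric] is_unit_poly_iff)

lemma val_place_poly_unit:
  fixes p :: "'a::{field,finite} poly"
  assumes p: "prime_elem p" and g: "\<not> p dvd g" shows "val (place_poly p) (to_fract g) = 0"
proof -
  interpret dplace "place_poly p" using place_poly[OF p] by unfold_locales
  have "g \<noteq> 0" using g by auto
  then have "unit (to_fract g)" unfolding unit_def place_poly[OF p]
    using to_fract_ring_at[OF p] ring_atI[OF g, of 1] by (simp add: inverse_eq_divide)
  then show ?thesis by (rule val_unit)
qed

lemma val_place_poly_self:
  fixes p :: "'a::{field,finite} poly"
  assumes p: "prime_elem p" shows "val (place_poly p) (to_fract p) = 1"
proof -
  interpret dplace "place_poly p" using place_poly[OF p] by unfold_locales
  have p0: "p \<noteq> 0" and pu: "\<not> p dvd 1" using p by (auto simp: prime_elem_def)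
  have pP: "to_fract p \<in> place_poly p"
    using to_fract_ring_at[OF p] inverse_notin_ring_at[OF p] by (simp add: place_poly_def nonunits_def)
  have "prime_element (place_poly p) (to_fract p)"
    unfolding prime_element_def place_poly[OF p]
  proof (intro equalityI subsetI)
    fix z assume z: "z \<in> place_poly p"
    then have "z \<in> ring_at p" and nu: "z = 0 \<or> inverse z \<notin> ring_at p"
      by (auto simp: place_poly_def nonunits_def)
    then obtain a b where ab: "z = to_fract a / to_fract b" "\<not> p dvd b" by (auto simp: ring_at_def)
    have "p dvd a"
    proof (rule ccontr)
      assume a: "\<not> p dvd a"
      then have "inverse z \<in> ring_at p" using ring_atI[OF a, of b] ab by simp
      then have "z = 0" using nu by simp
      then show False using ab a by auto
    qed
    then obtain a' where "a = p * a'" by blast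
    then have "z = to_fract p * (to_fract a' / to_fract b)" using ab by simp
    then show "z \<in> (*) (to_fract p) ` ring_at p" using ring_atI[OF ab(2)] by blast
  next
    fix z assume "z \<in> (*) (to_fract p) ` ring_at p"
    then obtain w where "w \<in> ring_at p" "z = w * to_fract p" by (auto simp: mult.commute)
    then show "z \<in> place_poly p" using P_ideal(1)[OF pP] place_poly[OF p] by simp
  qed
  then show ?thesis by (rule val_prime)
qed

text \<open>At infinity 1 / x is a prime element and \<open>g\<close> divided by x^(deg g) is a
  unit.\<close>

lemma val_place_inf:
  fixes g :: "'a::{field,finite} poly"
  assumes "g \<noteq> 0" shows "val place_inf (to_fract g) = - int (degree g)"
proof -
  interpret dplace "place_inf :: 'a poly fract set" using place_inf by unfold_locales
  have x0: "xx \<noteq> (0 :: 'a poly fract)" by simp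
  have "prime_element place_inf (inverse xx :: 'a poly fract)"
    unfolding prime_element_def place_inf
  proof (intro equalityI subsetI)
    fix z :: "'a poly fract" assume z: "z \<in> place_inf"
    then have "z \<in> ring_inf" and nu: "z = 0 \<or> inverse z \<notin> ring_inf"
      by (auto simp: place_inf_def nonunits_def)
    then obtain a b where ab: "z = to_fract a / to_fract b" "b \<noteq> 0" "degree a \<le> degree b" by (auto simp: ring_inf_def)
    have deg: "a = 0 \<or> degree a < degree b"
      using nu ring_infI[of a b] ab by (cases "a = 0"; force)
    then have "degree (pCons 0 a) \<le> degree b" by auto
    then have "to_fract (pCons 0 a) / to_fract b \<in> ring_inf" using ab ring_infI by blast
    moreover have "pCons 0 a = [:0, 1:] * a" by simp
    then have "to_fract (pCons 0 a) = xx * to_fract a" by (metis to_fract_mult)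
    then have "z = inverse xx * (to_fract (pCons 0 a) / to_fract b)" using x0 ab by simp
    ultimately show "z \<in> (*) (inverse xx) ` ring_inf" by blast
  next
    have "inverse xx \<in> (ring_inf :: 'a poly fract set)" using ring_infI[of "[:0,1:]" "1 :: 'a poly"] by (simp add: inverse_eq_divide)
    moreover have "inverse (inverse xx) \<notin> (ring_inf :: 'a poly fract set)"
      using xx_notin_ring_inf by simp
    ultimately have P: "inverse xx \<in> (place_inf :: 'a poly fract set)" by (simp add: place_inf_def nonunits_def)
    fix z :: "'a poly fract" assume "z \<in> (*) (inverse xx) ` ring_inf"
    then obtain w where "w \<in> ring_inf" "z = w * inverse xx" by (auto simp: mult.commute)
    then show "z \<in> place_inf" using P_ideal(1)[OF P] by (simp add: place_inf(2))
  qed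
  then have 1: "val place_inf (inverse xx :: 'a poly fract) = 1" by (rule val_prime)
  have "to_fract ([:0, 1:] ^ degree g) = (xx :: 'a poly fract) ^ degree g"
    by (rule rat.to_fract_power)
  moreover have deg: "degree ([:0, 1 :: 'a:] ^ degree g) = degree g" by (simp add: degree_power_eq)
  moreover have "unit (to_fract g / to_fract ([:0, 1 :: 'a:] ^ degree g))"
    unfolding unit_def place_inf using ring_infI[of "[:0,1:] ^ degree g" g] ring_infI[of g "[:0,1:] ^ degree g"] assms deg
    by (simp del: mult_pCons_left)
  ultimately have "val place_inf (to_fract g / xx ^ degree g) = 0" using val_unit by metis
  then show ?thesis using 1 assms x0 by (simp add: val_divide val_power val_inverse)
qed

lemma place_at_inj:
  fixes a b :: "'a::{field,finite}"
  assumes "place_at a = place_at b" shows "a = b"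
proof (rule ccontr)
  assume "a \<noteq> b"
  then have "\<not> [:- a, 1:] dvd [:- b, 1:]" by (simp flip: poly_eq_0_iff_dvd)
  then show False using val_place_poly_unit[OF prime_elem_linear, of a "[:- b, 1:]"]
    val_place_poly_self[OF prime_elem_linear, of b] assms by simp
qed

text \<open>If \<open>x\<close> has a pole, a nonzero \<open>b\<close> divided by x^(deg b) is its
  leading coefficient plus an element of \<open>P\<close>, hence a unit. So \<open>ring_inf\<close>
  is contained in the ring of \<open>P\<close>, and \<open>place_ring_mono_eq\<close> gives
  equality.\<close>

lemma place_inf_if_xx_notin:
  fixes P :: "'a::{field,finite} poly fract set"
  assumes P: "place rat_const P" and x: "xx \<notin> place_ring P" shows "P = place_inf"
proof -
  interpret dplace P using rat_discrete[OF P] by unfold_locales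
  have x0: "xx \<noteq> (0 :: 'a poly fract)" by simp
  have cR: "rat_const c \<in> R" for c using place_valring(3)[OF P] by auto
  have sR: "inverse xx \<in> R" using total[OF x] .
  have sP: "inverse xx \<in> P" using sR x x0 P_iff[of "inverse xx"] by (auto simp: unit_def)
  have low: "to_fract g * inverse xx ^ n \<in> R" if "degree g \<le> n" for g n
    using that
  proof (induction g arbitrary: n)
    case (pCons a g)
    have e: "to_fract (pCons a g) = rat_const a + xx * to_fract g"
      by (simp add: rat_const_def flip: to_fract_mult to_fract_add)
    show ?case
    proof (cases "g = 0")
      case True
      then show ?thesis unfolding e using cR sR by (auto intro!: closed)
    next
      case False
      then obtain k where k: "n = Suc k" "degree g \<le> k" using pCons.prems by (cases n) auto
      have "to_fract (pCons a g) * inverse xx ^ n = rat_const a * inverse xx ^ n + to_fract g * inverse xx ^ k"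
        unfolding e k(1) using x0 by (simp add: field_simps)
      then show ?thesis using pCons.IH[OF k(2)] cR sR by (simp add: closed)
    qed
  qed (simp add: closed)
  have un: "unit (to_fract b * inverse xx ^ degree b)" if b: "b \<noteq> 0" for b
  proof (cases "degree b = 0")
    case True
    then obtain c where "b = [:c:]" by (metis degree_eq_zeroE)
    then show ?thesis using b cR[of c] cR[of "inverse c"] by (auto simp: unit_def rat_const_def[symmetric])
  next
    case False
    let ?n = "degree b"
    define b' where "b' = b - monom (lead_coeff b) ?n"
    have "degree b' \<le> ?n - 1"
    proof (rule degree_le, intro allI impI)
      fix i assume "?n - 1 < i"
      then show "coeff b' i = 0" using False by (cases "i = ?n") (auto simp: b'_def coeff_eq_0)
    qed
    then have "to_fract b' * inverse xx ^ (?n - 1) * inverse xx \<in> P" using P_ideal(1)[OF sP low] by blast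
    then have b'P: "to_fract b' * inverse xx ^ ?n \<in> P" using False by (cases ?n) (auto simp: mult_ac)
    have "monom (lead_coeff b) ?n = smult (lead_coeff b) ([:0, 1:] ^ ?n)" by (simp add: monom_altdef)
    then have "to_fract (monom (lead_coeff b) ?n) = rat_const (lead_coeff b) * xx ^ ?n"
      using rat.pol_smult rat.to_fract_power by (metis id_apply)
    moreover have "to_fract b = to_fract (monom (lead_coeff b) ?n) + to_fract b'"
      by (simp add: b'_def)
    ultimately have e: "to_fract b * inverse xx ^ ?n = rat_const (lead_coeff b) + to_fract b' * inverse xx ^ ?n"
      using x0 by (simp add: distrib_right power_inverse)
    have "to_fract b * inverse xx ^ ?n \<notin> P"
    proof
      assume "to_fract b * inverse xx ^ ?n \<in> P"
      then have "to_fract b * inverse xx ^ ?n - to_fract b' * inverse xx ^ ?n \<in> P"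
        using b'P vge_diff unfolding P_vge by blast
      then have "rat_const (lead_coeff b) \<in> P" using e by simp
      then show False using P_iff cR[of "lead_coeff b"] cR[of "inverse (lead_coeff b)"] b by (auto simp: unit_def)
    qed
    then show ?thesis using P_iff low[of b ?n] by blast
  qed
  have "ring_inf \<subseteq> place_ring P"
  proof
    fix z :: "'a poly fract" assume "z \<in> ring_inf"
    then obtain a b where ab: "z = to_fract a / to_fract b" "b \<noteq> 0" "degree a \<le> degree b" by (auto simp: ring_inf_def)
    have "inverse (to_fract b * inverse xx ^ degree b) \<in> R" using un[OF ab(2)] unfolding unit_def by blast
    then have "(to_fract a * inverse xx ^ degree b) * inverse (to_fract b * inverse xx ^ degree b) \<in> R"
      by (rule mult[OF low[OF ab(3)]])
    moreover have "z = (to_fract a * inverse xx ^ degree b) * inverse (to_fract b * inverse xx ^ degree b)"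
      using x0 ab by (simp add: field_simps)
    ultimately show "z \<in> R" by simp
  qed
  then show ?thesis using place_ring_mono_eq[OF place_inf(3) disc] by (simp add: place_inf(2))
qed

lemma poly_in_place_ring:
  fixes P :: "'a::{field,finite} poly fract set"
  assumes P: "place rat_const P" and x: "xx \<in> place_ring P" shows "to_fract g \<in> place_ring P"
  using rat.poly_in_subring[of "place_ring P" g] place_valring[OF P] x by (simp add: valring_def)

text \<open>As x - a lies in \<open>P\<close>, a polynomial \<open>v\<close> is congruent to v(a)
  modulo \<open>P\<close>. So those not vanishing at \<open>a\<close> are units, and
  \<open>ring_at\<close> is contained in the ring of \<open>P\<close>.\<close>

lemma place_at_if:
  fixes P :: "'a::{field,finite} poly fract set"
  assumes P: "place rat_const P" and x: "xx \<in> place_ring P" and a: "to_fract [:- a, 1:] \<in> P"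
  shows "P = place_at a"
proof -
  interpret dplace P using rat_discrete[OF P] by unfold_locales
  have cR: "rat_const c \<in> R" for c using place_valring(3)[OF P] by auto
  have pR: "to_fract g \<in> R" for g using poly_in_place_ring[OF P x] .
  have "ring_at [:- a, 1:] \<subseteq> R"
  proof
    fix z assume "z \<in> ring_at [:- a, 1:]"
    then obtain u v where uv: "z = to_fract u / to_fract v" "poly v a \<noteq> 0"
      by (auto simp: ring_at_def poly_eq_0_iff_dvd)
    have "[:- a, 1:] dvd v - [:poly v a:]" by (simp flip: poly_eq_0_iff_dvd)
    then obtain w where w: "v - [:poly v a:] = [:- a, 1:] * w" by blast
    have "to_fract v \<notin> P"
    proof
      assume "to_fract v \<in> P"
      moreover have "to_fract w * to_fract [:- a, 1:] \<in> P" using P_ideal(1)[OF a pR] .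
      then have "to_fract (v - [:poly v a:]) \<in> P" unfolding w by (simp only: to_fract_mult mult.commute)
      ultimately have "to_fract v - to_fract (v - [:poly v a:]) \<in> P" unfolding P_vge by (rule vge_diff)
      then have "rat_const (poly v a) \<in> P" by (simp add: rat_const_def)
      then show False using P_iff cR[of "poly v a"] cR[of "inverse (poly v a)"] uv by (auto simp: unit_def)
    qed
    then have "unit (to_fract v)" using P_iff pR by blast
    then have "to_fract u * inverse (to_fract v) \<in> R" using pR by (intro mult) (auto simp: unit_def)
    then show "z \<in> R" using uv by (simp add: divide_inverse)
  qed
  then show ?thesis
    using place_ring_mono_eq[OF place_poly(3)[OF prime_elem_linear[of a]] disc]
      place_poly(2)[OF prime_elem_linear[of a]] by simp
qed

text \<open>A root exists in the algebraic closure; the hypothesis puts it into the base field, and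
  its linear factor is split off.\<close>

lemma split_poly:
  fixes f :: "'a::{field,finite} poly"
  assumes "f \<noteq> 0" "\<forall>z :: 'a alg_closure. poly (map_poly to_ac f) z = 0 \<longrightarrow> z \<in> range to_ac"
  shows "\<exists>c as. c \<noteq> 0 \<and> f = smult c (\<Prod>a\<leftarrow>as. [:- a, 1:])"
  using assms
proof (induction "degree f" arbitrary: f)
  case 0
  then obtain c where "f = [:c:]" by (metis degree_eq_zeroE)
  then show ?case using 0 by (intro exI[of _ c] exI[of _ "[]"]) auto
next
  case (Suc n)
  interpret ac: field_homo "to_ac :: 'a \<Rightarrow> 'a alg_closure" by unfold_locales (simp add: field_hom_def)
  have deg: "degree (map_poly to_ac g) = degree g" for g :: "'a poly" by (rule degree_map_poly) simp
  have "0 < degree (map_poly to_ac f)" using Suc deg[of f] by simp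
  then obtain z where z: "poly (map_poly to_ac f) z = 0" using alg_closed_imp_poly_has_root by blast
  then obtain a where a: "z = to_ac a" using Suc.prems by blast
  have ev: "poly (map_poly to_ac g) (to_ac b) = to_ac (poly g b)" for g :: "'a poly" and b
    by (induction g) (auto simp: map_poly_pCons)
  have mp: "map_poly to_ac (g * h) = map_poly to_ac g * map_poly to_ac h" for g h :: "'a poly"
  proof (rule poly_eqI)
    fix n show "coeff (map_poly to_ac (g * h)) n = coeff (map_poly to_ac g * map_poly to_ac h) n"
      by (simp add: coeff_map_poly coeff_mult to_ac_sum)
  qed
  have "poly f a = 0" using z a ev by simp
  then obtain g where g: "f = [:- a, 1:] * g" using poly_eq_0_iff_dvd by blast
  have g0: "g \<noteq> 0" using Suc g by auto
  have "\<forall>z :: 'a alg_closure. poly (map_poly to_ac g) z = 0 \<longrightarrow> z \<in> range to_ac"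
    using Suc.prems(2) unfolding g mp poly_mult by simp
  moreover have "n = degree g" using Suc(2) g0 unfolding g by (simp add: degree_mult_eq del: mult_pCons_left)
  ultimately obtain c as where "c \<noteq> 0" "g = smult c (\<Prod>a\<leftarrow>as. [:- a, 1:])" using Suc(1)[of g] g0 by blast
  then show ?case using g by (intro exI[of _ c] exI[of _ "a # as"]) (simp del: mult_pCons_left)
qed

lemma val_rat_const:
  fixes P :: "'a::{field,finite} poly fract set"
  assumes P: "place rat_const P" and "c \<noteq> 0" shows "val P (rat_const c) = 0"
proof -
  interpret dplace P using rat_discrete[OF P] by unfold_locales
  have cR: "rat_const c \<in> R" for c using place_valring(3)[OF P] by auto
  have "unit (rat_const c)" unfolding unit_def using cR[of c] cR[of "inverse c"] assms(2) by auto
  then show ?thesis by (rule val_unit)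
qed

text \<open>As \<open>f\<close> is a product of linear factors, a place where \<open>x\<close> is
  integral and \<open>f\<close> is not a unit must contain some x - a. Infinity always occurs
  because \<open>f\<close> is not constant.\<close>

lemma zero_or_pole_iff:
  fixes f :: "'a::{field,finite} poly"
  assumes f: "0 < degree f" "\<forall>z :: 'a alg_closure. poly (map_poly to_ac f) z = 0 \<longrightarrow> z \<in> range to_ac"
  shows "zero_or_pole f P \<longleftrightarrow> P = place_inf \<or> (\<exists>a. poly f a = 0 \<and> P = place_at a)"
proof
  assume zp: "zero_or_pole f P"
  then have P: "place rat_const P" and v: "val P (to_fract f) \<noteq> 0" by (auto simp: zero_or_pole_def)
  interpret dplace P using rat_discrete[OF P] by unfold_locales
  have f0: "f \<noteq> 0" using f by auto
  obtain c as where cas: "c \<noteq> 0" "f = smult c (\<Prod>a\<leftarrow>as. [:- a, 1:])" using split_poly[OF f0 f(2)] by blast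
  have "\<exists>a\<in>set as. to_fract [:- a, 1:] \<in> P" if x: "xx \<in> R"
  proof (rule ccontr)
    assume *: "\<not> ?thesis"
    have "val P (to_fract (\<Prod>a\<leftarrow>as. [:- a, 1:])) = 0" using *
    proof (induction as)
      case (Cons a as)
      have "to_fract [:- a, 1:] \<in> R" by (rule poly_in_place_ring[OF P x])
      then have "unit (to_fract [:- a, 1:])" using Cons.prems P_iff by auto
      then have "val P (to_fract [:- a, 1:]) = 0" by (rule val_unit)
      moreover have "to_fract (\<Prod>a\<leftarrow>as. [:- a, 1:]) \<noteq> 0" by (auto simp: prod_list_zero_iff)
      ultimately show ?case using Cons by (simp add: val_mult del: mult_pCons_left)
    qed simp
    moreover have "to_fract (\<Prod>a\<leftarrow>as. [:- a, 1:]) \<noteq> 0" by (auto simp: prod_list_zero_iff)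
    ultimately have "val P (to_fract f) = 0"
      using val_rat_const[OF P cas(1)] cas rat.pol_smult[of c "\<Prod>a\<leftarrow>as. [:- a, 1:]"]
      by (simp add: val_mult)
    then show False using v by simp
  qed
  then show "P = place_inf \<or> (\<exists>a. poly f a = 0 \<and> P = place_at a)"
  proof (cases "xx \<in> R")
    case True
    then obtain a where a: "a \<in> set as" "to_fract [:- a, 1:] \<in> P" using \<open>_ \<Longrightarrow> _\<close> by blast
    have "[:- a, 1:] dvd (\<Prod>a\<leftarrow>as. [:- a, 1:])" using a by (intro prod_list_dvd) auto
    then have "poly f a = 0" unfolding cas(2) by (simp add: poly_eq_0_iff_dvd dvd_smult)
    then show ?thesis using place_at_if[OF P True a(2)] by blast
  next
    case False
    then show ?thesis using place_inf_if_xx_notin[OF P] by blast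
  qed
next
  assume "P = place_inf \<or> (\<exists>a. poly f a = 0 \<and> P = place_at a)"
  then show "zero_or_pole f P"
  proof (elim disjE exE conjE)
    assume "P = place_inf"
    moreover have "f \<noteq> 0" using f by auto
    ultimately show ?thesis using f(1) by (simp add: zero_or_pole_def place_inf val_place_inf)
  next
    fix a assume a: "poly f a = 0" "P = place_at a"
    interpret dplace P using place_poly(3)[OF prime_elem_linear] a by unfold_locales simp
    obtain g where g: "f = [:- a, 1:] * g" using a poly_eq_0_iff_dvd by blast
    have "g \<noteq> 0" using f g by auto
    moreover have "to_fract g \<in> R"
      by (simp add: place_poly(2)[OF prime_elem_linear] to_fract_ring_at[OF prime_elem_linear] a)
    ultimately have "0 \<le> val P (to_fract g)" using R_iff by (simp add: vge_def)
    moreover have "val P (to_fract [:- a, 1:]) = 1"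
      using val_place_poly_self[OF prime_elem_linear, of a] a by simp
    then have "val P (to_fract f) = 1 + val P (to_fract g)"
      unfolding g to_fract_mult using \<open>g \<noteq> 0\<close> by (simp add: val_mult)
    ultimately show ?thesis using place_poly(1)[OF prime_elem_linear] a by (simp add: zero_or_pole_def)
  qed
qed

text \<open>The residue is the value u(a) / v(a). That these places have residue field k is used for
  \<open>place_degree_Q\<close>.\<close>

lemma rational_place_at:
  fixes a :: "'a::{field,finite}"
  assumes "w \<in> place_ring (place_at a)" shows "\<exists>c. w - rat_const c \<in> place_at a"
proof -
  interpret dplace "place_at a" using place_poly(3)[OF prime_elem_linear] by unfold_locales
  obtain u v where uv: "w = to_fract u / to_fract v" "poly v a \<noteq> 0"
    using assms unfolding place_poly(2)[OF prime_elem_linear] by (auto simp: ring_at_def poly_eq_0_iff_dvd)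
  let ?c = "poly u a / poly v a"
  let ?n = "u - smult ?c v"
  have v0: "v \<noteq> 0" using uv by auto
  have "[:- a, 1:] dvd ?n" using uv by (simp flip: poly_eq_0_iff_dvd)
  then obtain h where h: "?n = [:- a, 1:] * h" by blast
  have "w - rat_const ?c = to_fract ?n / to_fract v"
    using uv v0 rat.pol_smult[of ?c v] by (simp add: diff_divide_distrib)
  also have "\<dots> = (to_fract h / to_fract v) * to_fract [:- a, 1:]" unfolding h to_fract_mult by simp
  finally have e: "w - rat_const ?c = (to_fract h / to_fract v) * to_fract [:- a, 1:]" .
  have "to_fract h / to_fract v \<in> R" using uv ring_atI[of "[:- a, 1:]" v h]
    unfolding place_poly(2)[OF prime_elem_linear] by (simp add: poly_eq_0_iff_dvd)
  moreover have "to_fract [:- a, 1:] \<in> place_at a"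
    using val_place_poly_self[OF prime_elem_linear, of a] P_vge by (simp add: vge_def)
  ultimately show ?thesis unfolding e[symmetric] using P_ideal(1) e by metis
qed

text \<open>The residue is the quotient of the coefficients in degree \<open>degree v\<close>, which
  is 0 when \<open>u\<close> has smaller degree.\<close>

lemma rational_place_inf:
  fixes w :: "'a::{field,finite} poly fract"
  assumes "w \<in> place_ring place_inf" shows "\<exists>c. w - rat_const c \<in> place_inf"
proof -
  interpret dplace "place_inf :: 'a poly fract set" using place_inf(3) by unfold_locales
  obtain u v where uv: "w = to_fract u / to_fract v" "v \<noteq> 0" "degree u \<le> degree v"
    using assms unfolding place_inf(2) by (auto simp: ring_inf_def)
  let ?c = "coeff u (degree v) / lead_coeff v"
  define n where "n = u - smult ?c v"
  have e: "w - rat_const ?c = to_fract n / to_fract v"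
    using uv rat.pol_smult[of ?c v] by (simp add: n_def diff_divide_distrib)
  have "coeff n (degree v) = 0" using uv by (simp add: n_def)
  moreover have "degree n \<le> degree v" unfolding n_def using uv degree_smult_le[of ?c v] by (intro degree_diff_le) auto
  ultimately have "n = 0 \<or> degree n < degree v" by (metis leading_coeff_0_iff le_neq_implies_less)
  then have "vge place_inf (to_fract n / to_fract v) 1"
    using uv(2) by (cases "n = 0") (simp_all add: vge_def val_divide val_place_inf)
  then show ?thesis unfolding e[symmetric] P_vge[symmetric] by blast
qed

text \<open>A prime factor of the reduced denominator would give a pole at its finite place.\<close>

lemma polynomial_if_no_finite_poles:
  fixes h :: "'a::{field,finite} poly fract"
  assumes "\<And>P. place rat_const P \<Longrightarrow> P \<noteq> place_inf \<Longrightarrow> h \<in> place_ring P"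
  shows "\<exists>g. h = to_fract g"
proof (cases "h = 0")
  case False
  obtain a b where ab: "a \<noteq> 0" "b \<noteq> 0" "h = to_fract a / to_fract b"
    "\<And>p. prime_elem p \<Longrightarrow> \<not> (p dvd a \<and> p dvd b)" using reduced_fraction[OF False] by blast
  have "degree b = 0"
  proof (rule ccontr)
    assume "degree b \<noteq> 0"
    then obtain p where p: "prime_elem p" "p dvd b" using prime_divisor_exists by blast
    have "xx \<in> place_ring (place_poly p)" using place_poly[OF p(1)] to_fract_ring_at[OF p(1)] by simp
    moreover have "xx \<notin> place_ring (place_inf :: 'a poly fract set)"
      using val_place_inf[of "[:0, 1 :: 'a:]"] dplace.R_iff[OF dplace.intro[OF place_inf(3)], of "xx :: 'a poly fract"]
      by (simp add: vge_def)
    ultimately have "place_poly p \<noteq> place_inf" by auto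
    then have "h \<in> ring_at p" using assms place_poly[OF p(1)] by metis
    then obtain a' b' where ab': "h = to_fract a' / to_fract b'" "\<not> p dvd b'" by (auto simp: ring_at_def)
    then have "b' \<noteq> 0" by auto
    then have "to_fract (a * b') = to_fract (a' * b)" using ab ab' by (simp add: field_simps)
    then have "a * b' = a' * b" by (simp only: to_fract_eq_iff)
    then have "p dvd a * b'" using p(2) by simp
    then have "p dvd a" using p ab' by (auto simp: prime_elem_def)
    then show False using ab(4) p by blast
  qed
  then obtain c where c: "b = [:c:]" by (metis degree_eq_zeroE)
  then have "h = to_fract (smult (inverse c) a)"
    using ab rat.pol_smult[of "inverse c" a] rat.rc.inverse[of c]
    by (simp add: rat_const_def divide_inverse mult.commute)
  then show ?thesis by blast
qed (intro exI[of _ 0], simp)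

lemma vge_place_at_poly:
  fixes P :: "'a::{field,finite} poly fract set"
  assumes P: "place rat_const P" "P \<noteq> place_inf"
  shows "vge P (to_fract g) 0" "P \<noteq> place_at a \<Longrightarrow> val P (to_fract [:- a, 1:]) = 0"
proof -
  interpret dplace P using rat_discrete[OF P(1)] by unfold_locales
  have x: "xx \<in> R" using P place_inf_if_xx_notin by blast
  then have R: "to_fract g \<in> R" for g by (rule poly_in_place_ring[OF P(1)])
  then show "vge P (to_fract g) 0" using R_iff by blast
  assume "P \<noteq> place_at a"
  then have "to_fract [:- a, 1:] \<notin> P" using place_at_if[OF P(1) x] by blast
  then show "val P (to_fract [:- a, 1:]) = 0" using R[of "[:- a, 1:]"] P_iff val_unit by blast
qed

text \<open>At finite places \<open>z\<close> has exactly the valuations prescribed by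
  \<open>d\<close>. Multiplication by \<open>z\<close> therefore turns the conditions at finite
  places into being a polynomial, and the condition at infinity into a bound by the degree of the
  divisor.\<close>

lemma rational_riemann_roch_space:
  fixes A :: "'a::{field,finite} set" and d :: "'a poly fract set \<Rightarrow> int"
  assumes d: "\<And>P. place rat_const P \<Longrightarrow> d P \<noteq> 0 \<Longrightarrow> P = place_inf \<or> (\<exists>a\<in>A. P = place_at a)"
  defines "z \<equiv> (\<Prod>a\<in>A. to_fract [:- a, 1:] powi d (place_at a))"
  shows "(\<forall>P. place rat_const P \<longrightarrow> vge P c (- d P)) \<longleftrightarrow>
    (\<exists>g. c = to_fract g / z \<and> (g = 0 \<or> int (degree g) \<le> d place_inf + (\<Sum>a\<in>A. d (place_at a))))"
proof -
  have z0: "z \<noteq> 0" unfolding z_def by simp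
  have vz: "val P z = (\<Sum>a\<in>A. d (place_at a) * val P (to_fract [:- a, 1:]))" if "place rat_const P" for P
  proof -
    interpret dplace P using rat_discrete[OF that] by unfold_locales
    show ?thesis unfolding z_def by (subst val_prod) (auto simp: val_powi)
  qed
  have inf: "val place_inf z = - (\<Sum>a\<in>A. d (place_at a))"
    unfolding vz[OF place_inf(1)] by (simp add: val_place_inf sum_negf)
  have fin: "val P z = d P" if P: "place rat_const P" "P \<noteq> place_inf" for P
  proof (cases "\<exists>a\<in>A. P = place_at a")
    case True
    then obtain a where a: "a \<in> A" "P = place_at a" by blast
    have "val P z = (\<Sum>b\<in>A. if b = a then d (place_at a) else 0)"
      unfolding vz[OF P(1)]
    proof (intro sum.cong refl)
      fix b assume "b \<in> A"
      show "d (place_at b) * val P (to_fract [:- b, 1:]) = (if b = a then d (place_at a) else 0)"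
        using val_place_poly_self[OF prime_elem_linear, of a] vge_place_at_poly(2)[OF P, of b] place_at_inj a by auto
    qed
    then show ?thesis using a by simp
  next
    case False
    then have "val P (to_fract [:- a, 1:]) = 0" if "a \<in> A" for a using vge_place_at_poly(2)[OF P] that by blast
    then have "val P z = 0" unfolding vz[OF P(1)] by simp
    then show ?thesis using d[OF P(1)] False P(2) by auto
  qed
  have key: "vge P c (- d P) \<longleftrightarrow> vge P (c * z) (val P z - d P)" if "place rat_const P" for P
    using dplace.vge_mult_iff[OF dplace.intro[OF rat_discrete[OF that]] z0, of c "val P z - d P"]
    by (simp add: mult.commute)
  show ?thesis
  proof
    assume L: "\<forall>P. place rat_const P \<longrightarrow> vge P c (- d P)"
    have "c * z \<in> place_ring P" if "place rat_const P" "P \<noteq> place_inf" for P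
      using L key[OF that(1)] fin[OF that] dplace.R_iff[OF dplace.intro[OF rat_discrete[OF that(1)]]] that by simp
    then obtain g where g: "c * z = to_fract g" using polynomial_if_no_finite_poles by blast
    have "vge place_inf (to_fract g) (val place_inf z - d place_inf)"
      using L key[OF place_inf(1)] place_inf(1) g by metis
    then have "g = 0 \<or> int (degree g) \<le> d place_inf + (\<Sum>a\<in>A. d (place_at a))"
      unfolding inf by (cases "g = 0") (auto simp: vge_def val_place_inf)
    moreover have "c = to_fract g / z" using g z0 by (simp add: field_simps)
    ultimately show "\<exists>g. c = to_fract g / z \<and> (g = 0 \<or> int (degree g) \<le> d place_inf + (\<Sum>a\<in>A. d (place_at a)))"
      by blast
  next
    assume "\<exists>g. c = to_fract g / z \<and> (g = 0 \<or> int (degree g) \<le> d place_inf + (\<Sum>a\<in>A. d (place_at a)))"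
    then obtain g where g: "c = to_fract g / z" "g = 0 \<or> int (degree g) \<le> d place_inf + (\<Sum>a\<in>A. d (place_at a))" by blast
    show "\<forall>P. place rat_const P \<longrightarrow> vge P c (- d P)"
    proof (intro allI impI)
      fix P :: "'a poly fract set" assume P: "place rat_const P"
      have cz: "c * z = to_fract g" using g z0 by simp
      show "vge P c (- d P)"
      proof (cases "P = place_inf")
        case True
        then show ?thesis unfolding key[OF P] cz using g(2) inf by (cases "g = 0") (auto simp: vge_def val_place_inf)
      next
        case False
        then show ?thesis unfolding key[OF P] cz using vge_place_at_poly(1)[OF P False] fin[OF P False] by simp
      qed
    qed
  qed
qed

text \<open>The only possible pole is at \<open>a\<close>; the degree bound takes care of
  infinity.\<close>

lemma vge_over_linear_power:
  fixes P :: "'a::{field,finite} poly fract set"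
  assumes P: "place rat_const P" "P \<noteq> place_at a" and u: "degree u \<le> n"
  shows "vge P (to_fract u / to_fract ([:- a, 1:] ^ n)) 0"
proof (cases "u = 0")
  case False
  interpret dplace P using rat_discrete[OF P(1)] by unfold_locales
  have "val P (to_fract u / to_fract ([:- a, 1:] ^ n)) = val P (to_fract u) - int n * val P (to_fract [:- a, 1:])"
    using False by (simp add: rat.to_fract_power val_divide val_power)
  moreover have "int n * val P (to_fract [:- a, 1:]) \<le> val P (to_fract u)"
  proof (cases "P = place_inf")
    case True then show ?thesis using False u by (simp add: val_place_inf)
  next
    case False then show ?thesis using vge_place_at_poly(1)[OF P(1) False, of u] vge_place_at_poly(2)[OF P(1) False P(2)] \<open>u \<noteq> 0\<close>
      by (simp add: vge_def)
  qed
  ultimately show ?thesis by (simp add: vge_def)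
qed (simp add: vge_def)

text \<open>Yields a function with a prescribed zero and its only pole at \<open>a\<close>. At
  infinity 1 / (x - a) works; at a finite place a polynomial of least degree vanishing there does,
  since a factor x - a could be removed. The condition \<open>poly u a \<noteq> 0\<close> makes the
  pole order exactly \<open>n\<close>.\<close>

lemma exists_zero_over_linear_power:
  fixes P :: "'a::{field,finite} poly fract set"
  assumes P: "place rat_const P" "P \<noteq> place_at a"
  shows "\<exists>u n. poly u a \<noteq> 0 \<and> degree u \<le> n \<and> 0 < val P (to_fract u / to_fract ([:- a, 1:] ^ n))"
proof -
  interpret dplace P using rat_discrete[OF P(1)] by unfold_locales
  have v: "val P (to_fract u / to_fract ([:- a, 1:] ^ n)) = val P (to_fract u) - int n * val P (to_fract [:- a, 1:])"
    if "u \<noteq> 0" for u n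
    using that by (simp add: rat.to_fract_power val_divide val_power)
  show ?thesis
  proof (cases "P = place_inf")
    case True
    then show ?thesis using v[of 1 1] val_one by (intro exI[of _ 1] exI[of _ 1]) (simp add: val_place_inf)
  next
    case False
    obtain u w where uw: "u \<noteq> 0" "w \<noteq> 0" "to_fract u / to_fract w \<in> nonunits (place_ring P)"
      using rat.exists_base_nonunit[of "place_ring P"] place_valring[OF P(1)] by auto
    then have "0 < val P (to_fract u / to_fract w)"
      using P_vge P_eq by (simp add: vge_def)
    then have "u \<noteq> 0 \<and> 0 < val P (to_fract u)"
      using uw vge_place_at_poly(1)[OF P(1) False, of w] by (simp add: val_divide vge_def)
    then obtain u where u: "u \<noteq> 0" "0 < val P (to_fract u)"
      and min: "\<And>u'. u' \<noteq> 0 \<Longrightarrow> 0 < val P (to_fract u') \<Longrightarrow> degree u \<le> degree u'"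
      using ex_has_least_nat[of "\<lambda>u. u \<noteq> 0 \<and> 0 < val P (to_fract u)" u degree] by metis
    have l0: "val P (to_fract [:- a, 1:]) = 0" using vge_place_at_poly(2)[OF P(1) False P(2)] .
    have "poly u a \<noteq> 0"
    proof
      assume "poly u a = 0"
      then obtain u' where u': "u = [:- a, 1:] * u'" using poly_eq_0_iff_dvd by blast
      have "u' \<noteq> 0" using u u' by auto
      then have "val P (to_fract u) = val P (to_fract u')"
        unfolding u' to_fract_mult using l0 by (simp add: val_mult)
      then have "degree u \<le> degree u'" using min[OF \<open>u' \<noteq> 0\<close>] u by simp
      then show False using \<open>u' \<noteq> 0\<close> unfolding u' by (simp add: degree_mult_eq del: mult_pCons_left)
    qed
    then show ?thesis using v[OF u(1), of "degree u"] l0 u(2)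
      by (intro exI[of _ u] exI[of _ "degree u"]) simp
  qed
qed

section \<open>Ramification in Kummer extensions\<close>

context linear_space begin

lemma independent_family:
  assumes J: "finite J" and indep: "\<And>u j. (\<Sum>j\<in>J. scale (u j) (b j)) = 0 \<Longrightarrow> j \<in> J \<Longrightarrow> u j = 0"
  shows "inj_on b J" "V.independent (b ` J)" "V.span (b ` J) = range (\<lambda>u. \<Sum>j\<in>J. scale (u j) (b j))"
proof -
  show inj: "inj_on b J"
  proof (rule inj_onI, rule ccontr)
    fix i j assume ij: "i \<in> J" "j \<in> J" "b i = b j" "i \<noteq> j"
    let ?c = "\<lambda>k. if k = i then 1 else if k = j then -1 else 0"
    have "(\<Sum>k\<in>J. scale (?c k) (b k)) = (\<Sum>k\<in>{i, j}. scale (?c k) (b k))"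
      using ij J by (intro sum.mono_neutral_right) auto
    also have "\<dots> = 0" using ij by simp
    finally show False using indep[of ?c i] ij by auto
  qed
  let ?B = "b ` J"
  show "V.independent ?B"
  proof (rule V.independent_if_scalars_zero)
    fix f x assume f: "(\<Sum>x\<in>?B. scale (f x) x) = 0" and x: "x \<in> ?B"
    then have "(\<Sum>i\<in>J. scale (f (b i)) (b i)) = 0" by (simp add: sum.reindex[OF inj] o_def)
    then show "f x = 0" using indep[of "\<lambda>i. f (b i)"] x by auto
  qed (use J in simp)
  show "V.span ?B = range (\<lambda>u. \<Sum>j\<in>J. scale (u j) (b j))"
  proof (intro equalityI subsetI)
    fix w assume "w \<in> range (\<lambda>u. \<Sum>j\<in>J. scale (u j) (b j))"
    then obtain u where w: "w = (\<Sum>j\<in>J. scale (u j) (b j))" by blast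
    show "w \<in> V.span ?B" unfolding w by (rule V.span_sum, rule V.span_scale, rule V.span_base) auto
  next
    fix w assume "w \<in> V.span ?B"
    then obtain u where "w = (\<Sum>v\<in>?B. scale (u v) v)" using V.span_finite[of ?B] J by auto
    then have "w = (\<Sum>j\<in>J. scale (u (b j)) (b j))" by (simp add: sum.reindex[OF inj] o_def)
    then show "w \<in> range (\<lambda>u. \<Sum>j\<in>J. scale (u j) (b j))" by (rule image_eqI[of _ _ "\<lambda>j. u (b j)"]) simp
  qed
qed

lemma dim_family:
  assumes J: "finite J" and indep: "\<And>u j. (\<Sum>j\<in>J. scale (u j) (b j)) = 0 \<Longrightarrow> j \<in> J \<Longrightarrow> u j = 0"
    and W: "W = range (\<lambda>u. \<Sum>j\<in>J. scale (u j) (b j))"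
  shows "fin_spanned W \<and> V.dim W = card J"
proof -
  have fam: "inj_on b J" "V.independent (b ` J)"
    "V.span (b ` J) = range (\<lambda>u. \<Sum>j\<in>J. scale (u j) (b j))"
    by ((rule independent_family, rule J, erule (1) indep)+)
  have "W = V.span (b ` J)" unfolding W fam(3) ..
  then show ?thesis
    using V.dim_span_eq_card_independent[OF fam(2)] card_image[OF fam(1)] J unfolding fin_spanned_def by auto
qed

lemma independent_family_spans:
  assumes fin: "fin_spanned UNIV" and n: "n = V.dim UNIV"
    and indep: "\<And>c i. (\<Sum>i<n. scale (c i) (b i)) = 0 \<Longrightarrow> i < n \<Longrightarrow> c i = 0"
  shows "\<exists>c. z = (\<Sum>i<n. scale (c i) (b i))"
proof -
  let ?B = "b ` {..<n}"
  have indep': "c i = 0" if "(\<Sum>i\<in>{..<n}. scale (c i) (b i)) = 0" "i \<in> {..<n}" for c i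
    using indep[OF that(1)] that(2) by simp
  have fam: "inj_on b {..<n}" "V.independent (b ` {..<n})"
    "V.span (b ` {..<n}) = range (\<lambda>u. \<Sum>j\<in>{..<n}. scale (u j) (b j))"
    by ((rule independent_family, simp, erule (1) indep')+)
  obtain B where B: "finite B" "UNIV \<subseteq> V.span B" "card B = n" using fin_spanned_basis[OF fin] n by blast
  have "z \<in> V.span ?B"
  proof (rule ccontr)
    assume z: "z \<notin> V.span ?B"
    then have "V.independent (insert z ?B)" using fam(2) by (simp add: V.independent_insert)
    then have "card (insert z ?B) \<le> card B" using V.independent_span_bound[OF B(1)] B(2) by blast
    moreover have "z \<notin> ?B" using z V.span_base[of z ?B] by fast
    then have "card (insert z ?B) = Suc n" by (simp add: card_image[OF fam(1)])
    ultimately show False unfolding B(3) by simp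
  qed
  then show ?thesis unfolding fam(3) by (rule rangeE) (rule exI)
qed

end

section \<open>Contraction of places and ramification indices\<close>

context ff begin

definition "contraction Q = nonunits (\<phi> -` place_ring Q)"

lemma contraction:
  assumes Q: "place \<iota> Q"
  shows "place rat_const (contraction Q)" "place_ring (contraction Q) = \<phi> -` place_ring Q"
    "z \<in> contraction Q \<longleftrightarrow> \<phi> z \<in> Q"
proof -
  interpret dplace Q using place_discrete[OF Q] by unfold_locales
  have sub: "is_subring (\<phi> -` R)" unfolding is_subring_def by (auto intro: closed)
  have "\<phi> -` R \<noteq> UNIV" using base_not_in_val_ring[OF val_ring] by auto
  moreover have "z \<in> \<phi> -` R \<or> inverse z \<in> \<phi> -` R" for z using total[of "\<phi> z"] by auto
  ultimately have vr: "val_ring (\<phi> -` R)" using sub unfolding val_ring_def by blast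
  have c: "range rat_const \<subseteq> \<phi> -` R" using iota_in[OF Q] by (auto simp: o_apply)
  show "place rat_const (contraction Q)" "place_ring (contraction Q) = \<phi> -` place_ring Q"
    using rat.place_nonunits[OF vr] c unfolding contraction_def by simp_all
  show "z \<in> contraction Q \<longleftrightarrow> \<phi> z \<in> Q"
    unfolding contraction_def nonunits_def P_iff unit_def by auto
qed

text \<open>\<open>lies_over\<close> only demands that \<open>P\<close> maps into \<open>Q\<close>.
  A function integral at \<open>P\<close> but not at the contraction would, through its powers, push
  a uniformizer of \<open>P\<close> out of \<open>Q\<close>; so the rings are nested and hence
  equal.\<close>

lemma lies_over_iff: "lies_over rat_const \<phi> Q P \<longleftrightarrow> place \<iota> Q \<and> P = contraction Q"
proof
  assume l: "lies_over rat_const \<phi> Q P"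
  then have Q: "place \<iota> Q" and P: "place rat_const P" and sub: "\<phi> ` P \<subseteq> Q" by (auto simp: lies_over_def)
  let ?C = "contraction Q"
  interpret p: dplace P using rat_discrete[OF P] by unfold_locales
  interpret c: dplace ?C using rat_discrete[OF contraction(1)[OF Q]] by unfold_locales
  have "place_ring P \<subseteq> place_ring ?C"
  proof (rule ccontr)
    assume "\<not> place_ring P \<subseteq> place_ring ?C"
    then obtain u where u: "u \<in> place_ring P" "u \<notin> place_ring ?C" by blast
    then have u0: "u \<noteq> 0" "val ?C u < 0" using c.zero c.R_iff by (auto simp: vge_def)
    define N where "N = nat (val ?C p.unif)"
    have "u ^ N * p.unif \<in> P" using u by (intro p.P_ideal p.unif p.power)
    then have "u ^ N * p.unif \<in> ?C" using sub contraction(3)[OF Q] by blast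
    then have "0 < val ?C (u ^ N * p.unif)" using c.P_vge u0 p.unif by (auto simp: vge_def)
    also have "\<dots> = int N * val ?C u + val ?C p.unif" using u0 p.unif by (simp add: c.val_mult c.val_power)
    also have "\<dots> \<le> int N * (-1) + val ?C p.unif" using u0 by (intro add_right_mono mult_left_mono) auto
    also have "\<dots> \<le> 0" by (simp add: N_def)
    finally show False by simp
  qed
  then show "place \<iota> Q \<and> P = contraction Q" using place_ring_mono_eq[OF p.disc c.disc] Q by blast
next
  assume "place \<iota> Q \<and> P = contraction Q"
  then show "lies_over rat_const \<phi> Q P" using contraction[of Q] by (auto simp: lies_over_def)
qed

text \<open>Units at the contraction map to units at \<open>Q\<close>, so on the base field
  \<open>val Q\<close> is determined by its value at one uniformizer. This gives the
  \<open>THE\<close> in \<open>ramification_index\<close> a value.\<close>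

lemma ramification:
  assumes Q: "place \<iota> Q"
  shows "0 < ramification_index \<phi> Q (contraction Q)"
    "z \<noteq> 0 \<Longrightarrow> val Q (\<phi> z) = int (ramification_index \<phi> Q (contraction Q)) * val (contraction Q) z"
proof -
  let ?P = "contraction Q"
  interpret q: dplace Q using place_discrete[OF Q] by unfold_locales
  interpret p: dplace ?P using rat_discrete[OF contraction(1)[OF Q]] by unfold_locales
  define e where "e = val Q (\<phi> p.unif)"
  have "\<phi> p.unif \<in> Q" using p.unif contraction(3)[OF Q] by blast
  then have e: "0 < e" using q.P_vge p.unif by (auto simp: vge_def e_def)
  have eq: "val Q (\<phi> z) = e * val ?P z" if "z \<noteq> 0" for z
  proof -
    obtain v where v: "p.unit v" "z = p.unif powi val ?P z * v" using p.val_decomp \<open>z \<noteq> 0\<close> by blast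
    have "q.unit (\<phi> v)" using v(1) contraction(2)[OF Q] unfolding p.unit_def q.unit_def by auto
    then have "val Q (\<phi> v) = 0" "\<phi> v \<noteq> 0" using q.val_unit q.unit_def by auto
    moreover have "\<phi> (p.unif powi n) = \<phi> p.unif powi n" for n by (simp add: power_int_def)
    then have "\<phi> z = \<phi> p.unif powi val ?P z * \<phi> v" by (metis v(2) phi.mult)
    ultimately show ?thesis using p.unif by (simp add: q.val_mult q.val_powi e_def mult.commute)
  qed
  have ri: "ramification_index \<phi> Q ?P = nat e"
    unfolding ramification_index_def
  proof (rule the_equality)
    show "\<forall>z. z \<noteq> 0 \<longrightarrow> val Q (\<phi> z) = int (nat e) * val ?P z" using eq e by simp
  next
    fix k assume "\<forall>z. z \<noteq> 0 \<longrightarrow> val Q (\<phi> z) = int k * val ?P z"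
    then have "val Q (\<phi> p.unif) = int k" using p.unif p.val_unif by auto
    then show "k = nat e" by (simp add: e_def)
  qed
  show "0 < ramification_index \<phi> Q ?P" using ri e by simp
  show "z \<noteq> 0 \<Longrightarrow> val Q (\<phi> z) = int (ramification_index \<phi> Q ?P) * val ?P z" using ri e eq by simp
qed

lemma Y0: "Y \<noteq> 0"
  using Ym m f0 by (metis phi.eq_0_iff power_eq_0_iff)

lemma val_Y:
  assumes "place \<iota> Q"
  shows "int m * val Q Y = int (ramification_index \<phi> Q (contraction Q)) * val (contraction Q) f0"
proof -
  interpret dplace Q using place_discrete[OF assms] by unfold_locales
  have "int m * val Q Y = val Q (Y ^ m)" using Y0 by (simp add: val_power)
  then show ?thesis using ramification(2)[OF assms f0] Ym by simp
qed

text \<open>Elements of the base field have valuation divisible by the ramification index, so the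
  summands have distinct valuations whatever the coefficients. Applied to powers of \<open>Y\<close>
  and also to powers of a uniformizer.\<close>

lemma sum_distinct_residues:
  fixes c :: "'i \<Rightarrow> 'a poly fract"
  assumes Q: "place \<iota> Q" and I: "finite I" "\<And>i. i \<in> I \<Longrightarrow> b i \<noteq> 0"
    and inj: "inj_on (\<lambda>i. val Q (b i) mod int (ramification_index \<phi> Q (contraction Q))) I"
    and ex: "\<exists>i\<in>I. c i \<noteq> 0"
  shows "(\<Sum>i\<in>I. \<phi> (c i) * b i) \<noteq> 0"
    "\<exists>i\<in>I. c i \<noteq> 0 \<and> val Q (\<Sum>i\<in>I. \<phi> (c i) * b i) = val Q (\<phi> (c i) * b i)"
    "\<And>i. i \<in> I \<Longrightarrow> c i \<noteq> 0 \<Longrightarrow> val Q (\<Sum>i\<in>I. \<phi> (c i) * b i) \<le> val Q (\<phi> (c i) * b i)"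
proof -
  interpret dplace Q using place_discrete[OF Q] by unfold_locales
  let ?e = "int (ramification_index \<phi> Q (contraction Q))"
  let ?J = "{i \<in> I. c i \<noteq> 0}"
  let ?a = "\<lambda>i. \<phi> (c i) * b i"
  have v: "val Q (?a i) mod ?e = val Q (b i) mod ?e" if "i \<in> ?J" for i
    using that I ramification(2)[OF Q, of "c i"] by (simp add: val_mult)
  have S: "sum ?a I = sum ?a ?J" using I(1) by (intro sum.mono_neutral_right) auto
  have "sum ?a ?J \<noteq> 0 \<and> val Q (sum ?a ?J) = Min ((\<lambda>i. val Q (?a i)) ` ?J)"
  proof (rule val_sum_distinct)
    show "inj_on (\<lambda>i. val Q (?a i)) ?J"
    proof (rule inj_onI)
      fix i j assume ij: "i \<in> ?J" "j \<in> ?J" "val Q (?a i) = val Q (?a j)"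
      then have "val Q (b i) mod ?e = val Q (b j) mod ?e" using v[OF ij(1)] v[OF ij(2)] by simp
      then show "i = j" using inj_onD[OF inj, of i j] ij by simp
    qed
  next
    fix i assume "i \<in> ?J"
    then show "?a i \<noteq> 0" using I(2)[of i] by simp
  next
    show "?J \<noteq> {}" using ex by blast
  qed (use I(1) in simp)
  note * = this[folded S]
  have fin: "finite ((\<lambda>i. val Q (?a i)) ` ?J)" and ne: "(\<lambda>i. val Q (?a i)) ` ?J \<noteq> {}" using I ex by auto
  show "sum ?a I \<noteq> 0" using * by blast
  show "\<exists>i\<in>I. c i \<noteq> 0 \<and> val Q (sum ?a I) = val Q (?a i)" using * Min_in[OF fin ne] by auto
  show "\<And>i. i \<in> I \<Longrightarrow> c i \<noteq> 0 \<Longrightarrow> val Q (sum ?a I) \<le> val Q (?a i)" using * Min_le[OF fin] by simp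
qed

lemma vge_sum_distinct_residues:
  fixes c :: "'i \<Rightarrow> 'a poly fract"
  assumes Q: "place \<iota> Q" and I: "finite I" "\<And>i. i \<in> I \<Longrightarrow> b i \<noteq> 0"
    and inj: "inj_on (\<lambda>i. val Q (b i) mod int (ramification_index \<phi> Q (contraction Q))) I"
  shows "vge Q (\<Sum>i\<in>I. \<phi> (c i) * b i) n \<longleftrightarrow> (\<forall>i\<in>I. vge Q (\<phi> (c i) * b i) n)"
proof
  assume L: "vge Q (\<Sum>i\<in>I. \<phi> (c i) * b i) n"
  show "\<forall>i\<in>I. vge Q (\<phi> (c i) * b i) n"
  proof
    fix i assume i: "i \<in> I"
    show "vge Q (\<phi> (c i) * b i) n"
    proof (cases "c i = 0")
      case False
      then show ?thesis using L sum_distinct_residues[OF Q I inj, of c] i by (force simp: vge_def)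
    qed (simp add: vge_def)
  qed
next
  assume "\<forall>i\<in>I. vge Q (\<phi> (c i) * b i) n"
  then show "vge Q (\<Sum>i\<in>I. \<phi> (c i) * b i) n"
    by (intro dplace.vge_sum[OF dplace.intro[OF place_discrete[OF Q]]]) simp
qed

sublocale K: linear_space "\<lambda>a z. \<phi> a * z"
  by unfold_locales (simp_all add: algebra_simps)

lemma ext_degree_le: "ext_degree \<phi> \<le> m" and K_fin_spanned: "K.fin_spanned UNIV"
proof -
  let ?B = "(\<lambda>i. Y ^ i) ` {..<m}"
  have s: "UNIV \<subseteq> K.V.span ?B"
  proof
    fix z
    obtain c where z: "z = (\<Sum>i<m. \<phi> (c i) * Y ^ i)" using gen by blast
    show "z \<in> K.V.span ?B" unfolding z by (rule K.V.span_sum, rule K.V.span_scale, rule K.V.span_base) auto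
  qed
  then show "K.fin_spanned UNIV" unfolding K.fin_spanned_def by blast
  have "ext_degree \<phi> \<le> card ?B" unfolding ext_degree_def using s by (intro K.V.dim_le_card) auto
  also have "\<dots> \<le> m" using card_image_le[of "{..<m}"] by fastforce
  finally show "ext_degree \<phi> \<le> m" .
qed

text \<open>At a totally ramified place with \<open>g = gcd m \<lambda>\<close>, the element \<open>w = Y\<^sup>m\<^sup>/\<^sup>g / h\<close> with
  \<open>v\<^sub>P(h) = \<lambda>/g\<close> is a unit whose \<open>g\<close>-th power lies in the base field. If \<open>w = a + \<delta>\<close> with \<open>a\<close> in the
  base field and \<open>v\<^sub>Q(\<delta>)\<close> is not the valuation of a base element, then \<open>w\<^sup>g - a\<^sup>g\<close> has the valuation
  of \<open>\<delta>\<close>, which is impossible; so \<open>w\<close> is in the base field and \<open>f\<^sub>0\<close> is a \<open>g\<close>-th power.\<close>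

lemma totally_ramified_coprime:
  assumes Q: "place \<iota> Q" and tr: "ramification_index \<phi> Q (contraction Q) = ext_degree \<phi>"
    and char: "of_nat m \<noteq> (0 :: 'a)"
    and np: "\<And>d. d dvd m \<Longrightarrow> 2 \<le> d \<Longrightarrow> \<not> (\<exists>h. f0 = h ^ d)"
  shows "coprime (int m) (val (contraction Q) f0)" "ramification_index \<phi> Q (contraction Q) = m"
proof -
  let ?P = "contraction Q"
  interpret q: dplace Q using place_discrete[OF Q] by unfold_locales
  interpret p: dplace ?P using rat_discrete[OF contraction(1)[OF Q]] by unfold_locales
  define e where "e = ext_degree \<phi>"
  have e: "0 < e" and ram: "\<And>z. z \<noteq> 0 \<Longrightarrow> val Q (\<phi> z) = int e * val ?P z"
    using ramification[OF Q] unfolding tr e_def by auto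
  have inj: "inj_on (\<lambda>i. val Q (q.unif ^ i) mod int (ramification_index \<phi> Q (contraction Q))) {..<e}"
    by (rule inj_onI) (simp add: q.val_power q.unif tr flip: e_def)
  \<comment> \<open>The powers of a uniformizer with exponents below \<open>e\<close> are
    independent over the base field, and there are [F : K] = e of them, so they form a basis. The
    corresponding claim for \<open>Y\<close> needs the coprimality still to be shown.\<close>
  have rep: "\<exists>a. z = (\<Sum>i<e. \<phi> (a i) * q.unif ^ i)" for z
  proof (rule K.independent_family_spans[OF K_fin_spanned])
    fix c i assume "(\<Sum>i<e. \<phi> (c i) * q.unif ^ i) = 0" "i < e"
    then show "c i = 0" using sum_distinct_residues(1)[OF Q _ _ inj, of c] q.unif by auto
  qed (simp add: e_def ext_degree_def)
  define l where "l = val ?P f0"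
  define g where "g = nat (gcd (int m) l)"
  have gi: "int g = gcd (int m) l" by (simp add: g_def)
  have "gcd (int m) l \<noteq> 0" using m by simp
  then have g0: "0 < g" using gi by (metis gr0I of_nat_0)
  have "int g dvd int m" unfolding gi by simp
  then have gm: "g dvd m" by (simp only: int_dvd_int_iff)
  have "int g dvd l" unfolding gi by simp
  note g = g0 gi gm this
  define h where "h = p.unif powi (l div int g)"
  have h: "h \<noteq> 0" "val ?P h = l div int g" using p.unif by (simp_all add: h_def p.val_powi)
  define w where "w = Y ^ (m div g) / \<phi> h"
  have w0: "w \<noteq> 0" using Y0 h by (simp add: w_def)
  have wg: "w ^ g = \<phi> (f0 / h ^ g)"
    using g Ym by (simp add: w_def power_divide flip: power_mult)
  have "int g * val Q w = int e * (l - int g * (l div int g))"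
    using q.val_power[OF w0, of g] h f0 ram[of "f0 / h ^ g"] unfolding wg
    by (simp add: p.val_divide p.val_power l_def)
  moreover have "l - int g * (l div int g) = 0" using g(4) by simp
  ultimately have vw: "val Q w = 0" using g0 by (metis mult_eq_0_iff of_nat_0_eq_iff less_numeral_extra(3))
  obtain a where a: "w = (\<Sum>i<e. \<phi> (a i) * q.unif ^ i)" using rep by blast
  define \<delta> where "\<delta> = (\<Sum>i\<in>{1..<e}. \<phi> (a i) * q.unif ^ i)"
  define A where "A = \<phi> (a 0)"
  have wA: "w = A + \<delta>"
  proof -
    have "{..<e} = insert 0 {1..<e}" using e by auto
    then show ?thesis unfolding a A_def \<delta>_def by simp
  qed
  have "\<delta> = 0"
  proof (rule ccontr)
    assume d0: "\<delta> \<noteq> 0"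
    then have ex: "\<exists>i\<in>{1..<e}. a i \<noteq> 0" unfolding \<delta>_def using sum.not_neutral_contains_not_neutral by force
    have inj': "inj_on (\<lambda>i. val Q (q.unif ^ i) mod int (ramification_index \<phi> Q (contraction Q))) {1..<e}"
      by (rule inj_on_subset[OF inj]) auto
    obtain i where i: "i \<in> {1..<e}" "a i \<noteq> 0" "val Q \<delta> = val Q (\<phi> (a i) * q.unif ^ i)"
      using sum_distinct_residues(2)[OF Q _ _ inj' ex] q.unif unfolding \<delta>_def by auto
    then have "val Q \<delta> = int e * val ?P (a i) + int i"
      using ram[of "a i"] q.unif by (simp add: q.val_mult q.val_power)
    then have "val Q \<delta> mod int e = int i mod int e" by simp
    \<comment> \<open>The exponent \<open>i\<close> lies strictly between 0 and \<open>e\<close>,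
      because the constant term of the expansion was split off as \<open>A\<close>.\<close>
    then have dm: "val Q \<delta> mod int e \<noteq> 0" using i by simp
    have a0: "a 0 \<noteq> 0" using wA vw dm by (auto simp: A_def)
    then have A0: "A \<noteq> 0" "val Q A mod int e = 0" using ram[OF a0] by (auto simp: A_def)
    have "val Q A \<noteq> val Q \<delta>" using A0 dm by auto
    then have "val Q w = min (val Q A) (val Q \<delta>)" using q.val_add_distinct[OF A0(1) d0] wA by simp
    moreover have "val Q \<delta> \<noteq> 0" using dm by auto
    ultimately have vA: "val Q A = 0" and vd: "0 < val Q \<delta>" using vw by auto
    have wR: "w \<in> q.R" and AR: "A \<in> q.R" and dQ: "\<delta> \<in> Q"
      using vw vA vd w0 A0 q.R_iff q.P_vge by (auto simp: vge_def)
    have dd: "w ^ k - A ^ k \<in> Q" for k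
    proof -
      have "w ^ k - A ^ k = (\<Sum>i<k. A ^ (k - Suc i) * w ^ i) * \<delta>"
        unfolding power_diff_sumr2 wA by (simp add: mult.commute)
      moreover have "(\<Sum>i<k. A ^ (k - Suc i) * w ^ i) \<in> q.R" by (intro q.sum q.mult q.power wR AR)
      ultimately show ?thesis using q.P_ideal(1)[OF dQ] by metis
    qed
    \<comment> \<open>\<open>w ^ g - A ^ g\<close> equals \<open>\<delta> * S\<close>, and modulo
      \<open>Q\<close> the cofactor is g A^(g - 1), a unit because the characteristic does not
      divide \<open>m\<close>.\<close>
    define S where "S = (\<Sum>i<g. A ^ (g - Suc i) * w ^ i)"
    define u where "u = of_nat g * A ^ (g - 1)"
    have "S = u + (\<Sum>i<g. A ^ (g - Suc i) * (w ^ i - A ^ i))"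
    proof -
      have "(\<Sum>i<g. A ^ (g - Suc i) * A ^ i) = (\<Sum>i<g. A ^ (g - 1))"
        by (intro sum.cong refl) (simp flip: power_add)
      then show ?thesis unfolding S_def u_def right_diff_distrib sum_subtractf by simp
    qed
    moreover have "(\<Sum>i<g. A ^ (g - Suc i) * (w ^ i - A ^ i)) \<in> Q"
      unfolding q.P_vge using q.P_ideal(1)[OF dd q.power[OF AR]] unfolding q.P_vge by (intro q.vge_sum) blast
    moreover have u: "u \<noteq> 0" "val Q u = 0"
    proof -
      have gn: "of_nat g \<noteq> (0 :: 'a)" using char g(3) by (metis dvdE mult_zero_left of_nat_mult)
      have "q.unit (\<iota> (of_nat g))"
        unfolding q.unit_def using gn iota_in[OF Q, of "of_nat g"] iota_in[OF Q, of "inverse (of_nat g)"]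
        by (simp only: iota.inverse iota.eq_0_iff not_False_eq_True simp_thms)
      then have "val Q (of_nat g) = 0" "of_nat g \<noteq> (0 :: 'f)" using q.val_unit[of "\<iota> (of_nat g)"] by (auto simp: q.unit_def)
      then show "u \<noteq> 0" "val Q u = 0" using A0 vA by (simp_all add: u_def q.val_mult q.val_power)
    qed
    ultimately have S: "S \<noteq> 0" "val Q S = 0"
      using q.val_add_eq[OF u(1), of "\<Sum>i<g. A ^ (g - Suc i) * (w ^ i - A ^ i)"] q.P_vge by auto
    have "w ^ g - A ^ g = \<delta> * S" unfolding power_diff_sumr2 S_def wA by simp
    then have ne: "w ^ g - A ^ g \<noteq> 0" and v: "val Q (w ^ g - A ^ g) = val Q \<delta>"
      using S d0 by (simp_all add: q.val_mult)
    define k where "k = f0 / h ^ g - a 0 ^ g"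
    have wk: "w ^ g - A ^ g = \<phi> k" unfolding wg k_def by (simp add: A_def)
    then have "k \<noteq> 0" using ne by auto
    then have "val Q (w ^ g - A ^ g) mod int e = 0" unfolding wk using ram[of k] by simp
    then show False using v dm by simp
  qed
  then have "Y ^ (m div g) = \<phi> (a 0 * h)" using wA h by (simp add: w_def A_def field_simps)
  then have "(Y ^ (m div g)) ^ g = \<phi> ((a 0 * h) ^ g)" by simp
  then have "\<phi> f0 = \<phi> ((a 0 * h) ^ g)" using g(3) by (simp add: Ym flip: power_mult)
  then have "f0 = (a 0 * h) ^ g" unfolding phi.eq_iff .
  then have "\<not> 2 \<le> g" using np[OF g(3)] by blast
  then have g1: "g = 1" using g(1) by simp
  then show cop: "coprime (int m) (val ?P f0)" using g(2) by (simp add: l_def coprime_iff_gcd_eq_1)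
  \<comment> \<open>Comparing \<open>Y ^ m\<close> with \<open>f0\<close> shows that m divides e
    times a number prime to m, so m <= e; the converse is \<open>ext_degree_le\<close>.\<close>
  have "int m * val Q Y = int e * val ?P f0" using val_Y[OF Q] unfolding tr e_def .
  then have "int m dvd int e * val ?P f0" by (metis dvd_triv_left)
  then have "int m dvd int e" using cop by (simp add: coprime_dvd_mult_left_iff)
  then have "m \<le> e" using e by (simp add: dvd_imp_le)
  then show "ramification_index \<phi> Q (contraction Q) = m" using ext_degree_le tr unfolding e_def by simp
qed

text \<open>Here \<open>val Q Y\<close> equals the valuation of \<open>f0\<close> below, which is
  prime to \<open>m\<close>, so its multiples by 0, ..., m - 1 are distinct modulo
  \<open>m\<close>.\<close>

lemma inj_on_val_powers:
  assumes Q: "place \<iota> Q" and e: "ramification_index \<phi> Q (contraction Q) = m"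
    and cop: "coprime (int m) (val (contraction Q) f0)"
  shows "inj_on (\<lambda>i. val Q (Y ^ i) mod int (ramification_index \<phi> Q (contraction Q))) {..<m}"
proof (rule inj_onI)
  interpret dplace Q using place_discrete[OF Q] by unfold_locales
  let ?l = "val (contraction Q) f0"
  have v: "val Q Y = ?l" using val_Y[OF Q] m unfolding e by simp
  fix i j assume ij: "i \<in> {..<m}" "j \<in> {..<m}"
    "val Q (Y ^ i) mod int (ramification_index \<phi> Q (contraction Q)) =
     val Q (Y ^ j) mod int (ramification_index \<phi> Q (contraction Q))"
  then have "(int i * ?l) mod int m = (int j * ?l) mod int m" unfolding e val_power[OF Y0] v by simp
  then have "int m dvd (int i - int j) * ?l" by (simp only: mod_eq_dvd_iff left_diff_distrib)
  then have "int m dvd int i - int j" using cop by (simp add: coprime_dvd_mult_left_iff)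
  then have "int i mod int m = int j mod int m" by (simp only: mod_eq_dvd_iff)
  then show "i = j" using ij by simp
qed

end

section \<open>Extension of places and conjugates\<close>

definition adjoin :: "'f::field set \<Rightarrow> 'f \<Rightarrow> 'f set" where
  "adjoin B z = {poly p z | p. \<forall>i. coeff p i \<in> B}"

lemma (in subring) adjoin:
  shows "is_subring (adjoin R z)" "R \<subseteq> adjoin R z" "z \<in> adjoin R z"
proof -
  show "is_subring (adjoin R z)" unfolding is_subring_def
  proof (intro conjI ballI)
    have "poly 1 z \<in> adjoin R z" unfolding adjoin_def using one zero
      by (intro CollectI exI[of _ 1]) (auto simp: one_pCons coeff_pCons split: nat.splits)
    then show "1 \<in> adjoin R z" by simp
  next
    fix a b assume "a \<in> adjoin R z" "b \<in> adjoin R z"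
    then obtain p q where pq: "a = poly p z" "b = poly q z" "\<And>i. coeff p i \<in> R" "\<And>i. coeff q i \<in> R"
      by (auto simp: adjoin_def)
    show "a - b \<in> adjoin R z" unfolding adjoin_def using pq diff
      by (intro CollectI exI[of _ "p - q"]) auto
    show "a * b \<in> adjoin R z" unfolding adjoin_def using pq
      by (intro CollectI exI[of _ "p * q"]) (auto simp: coeff_mult intro!: closed)
  qed
  show "R \<subseteq> adjoin R z"
  proof
    fix b assume "b \<in> R"
    then show "b \<in> adjoin R z" unfolding adjoin_def using zero
      by (intro CollectI exI[of _ "[:b:]"]) (auto simp: coeff_pCons split: nat.splits)
  qed
  show "z \<in> adjoin R z" unfolding adjoin_def using zero one
    by (intro CollectI exI[of _ "[:0, 1:]"]) (auto simp: coeff_pCons split: nat.splits)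
qed

text \<open>Maximality among the subrings that miss \<open>inverse s\<close>, expressed through
  adjoining a single element. Such a ring turns out to be a valuation ring.\<close>

locale maximal_subring = subring B for B :: "'f::field set" +
  fixes s :: 'f
  assumes s0: "s \<noteq> 0" and s: "s \<in> B" and s_inv: "inverse s \<notin> B"
    and maximal: "\<And>z. inverse s \<notin> adjoin B z \<Longrightarrow> z \<in> B"
begin

text \<open>\<open>s\<close> lies in the Jacobson radical of \<open>B\<close>: if 1 / s were a
  polynomial in 1 / r for r = 1 + s b, multiplying by a power of \<open>r\<close>, which is 1 modulo
  \<open>s\<close>, would put 1 / s into \<open>B\<close>.\<close>

lemma one_plus:
  assumes b: "b \<in> B" shows "1 + s * b \<noteq> 0" "inverse (1 + s * b) \<in> B"
proof -
  let ?r = "1 + s * b"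
  show r0: "?r \<noteq> 0"
  proof
    assume "?r = 0"
    then have "inverse s = - b" using s0 by (metis add_eq_0_iff inverse_unique minus_equation_iff mult_minus_right)
    then show False using s_inv b uminus by simp
  qed
  show "inverse ?r \<in> B"
  proof (rule maximal, rule notI)
    assume "inverse s \<in> adjoin B (inverse ?r)"
    then obtain p where p: "inverse s = poly p (inverse ?r)" "\<And>i. coeff p i \<in> B" by (auto simp: adjoin_def)
    let ?n = "degree p"
    have "inverse s * ?r ^ ?n = (\<Sum>i\<le>?n. coeff p i * inverse ?r ^ i * ?r ^ ?n)"
      unfolding p(1) poly_altdef by (simp add: sum_distrib_right)
    also have "\<dots> = (\<Sum>i\<le>?n. coeff p i * ?r ^ (?n - i))"
    proof (intro sum.cong refl)
      fix i assume "i \<in> {..?n}"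
      then have "?r ^ ?n = ?r ^ i * ?r ^ (?n - i)" by (simp flip: power_add)
      then have "coeff p i * inverse ?r ^ i * ?r ^ ?n = coeff p i * (inverse ?r ^ i * ?r ^ i) * ?r ^ (?n - i)"
        by (simp only: mult.assoc)
      moreover have "inverse ?r ^ i * ?r ^ i = 1" using r0 by (simp flip: power_mult_distrib)
      ultimately show "coeff p i * inverse ?r ^ i * ?r ^ ?n = coeff p i * ?r ^ (?n - i)"
        by (simp only: mult_1_right)
    qed
    also have "\<dots> \<in> B" using p(2) s b by (intro sum mult power add one) auto
    finally have 1: "inverse s * ?r ^ ?n \<in> B" .
    have "\<exists>b'\<in>B. ?r ^ k = 1 + s * b'" for k
    proof (induction k)
      case (Suc k)
      then obtain b' where b': "b' \<in> B" "?r ^ k = 1 + s * b'" by blast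
      have "?r ^ Suc k = 1 + s * (b + b' + s * b * b')" using b' by (simp add: algebra_simps)
      moreover have "b + b' + s * b * b' \<in> B" using b b' s by (intro add mult)
      ultimately show ?case by blast
    qed (auto intro: bexI[of _ 0] simp: zero)
    then obtain b' where b': "b' \<in> B" "?r ^ ?n = 1 + s * b'" by blast
    have "inverse s * ?r ^ ?n - b' = inverse s" using b' s0 by (simp add: field_simps)
    then show False using diff[OF 1 b'(1)] s_inv by argo
  qed
qed

text \<open>As \<open>1 - s * coeff q 0\<close> is a unit, the relation
  \<open>1 = s * poly q (inverse z)\<close> expresses \<open>z ^ n\<close> through lower powers of
  \<open>z\<close>; no negative ones occur because \<open>degree q \<le> degree p\<close>. This is
  substituted for the leading term of \<open>p\<close>.\<close>

lemma reduce_degree: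
  assumes p: "inverse s = poly p z" "\<And>i. coeff p i \<in> B"
    and q: "inverse s = poly q (inverse z)" "\<And>i. coeff q i \<in> B"
    and deg: "degree q \<le> degree p" and z: "z \<noteq> 0"
  shows "\<exists>p'. inverse s = poly p' z \<and> (\<forall>i. coeff p' i \<in> B) \<and> degree p' < degree p"
proof -
  define n where "n = degree p"
  define l where "l = degree q"
  have n0: "0 < n"
  proof (rule ccontr)
    assume "\<not> 0 < n"
    then obtain c where "p = [:c:]" unfolding n_def by (metis degree_eq_zeroE gr0I)
    then show False using p(1) p(2)[of 0] s_inv by simp
  qed
  define r where "r = 1 + s * (- coeff q 0)"
  have r: "r \<noteq> 0" "inverse r \<in> B" using one_plus[OF uminus[OF q(2)[of 0]]] by (auto simp: r_def)
  define c where "c i = s * coeff q i * inverse r" for i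
  have cB: "c i \<in> B" for i unfolding c_def using s q r by (intro mult)
  have zn: "z ^ n = (\<Sum>i\<in>{1..l}. c i * z ^ (n - i))"
  proof -
    have "{..l} = insert 0 {1..l}" by auto
    then have split: "(\<Sum>i\<le>l. coeff q i * inverse z ^ i) = coeff q 0 + (\<Sum>i\<in>{1..l}. coeff q i * inverse z ^ i)"
      by simp
    have "1 = s * poly q (inverse z)" using q(1) s0 by (metis right_inverse)
    also have "\<dots> = s * coeff q 0 + (\<Sum>i\<in>{1..l}. s * coeff q i * inverse z ^ i)"
      unfolding poly_altdef l_def[symmetric] split by (simp add: distrib_left sum_distrib_left mult.assoc)
    finally have "r = (\<Sum>i\<in>{1..l}. s * coeff q i * inverse z ^ i)" unfolding r_def by (simp add: algebra_simps)
    then have "z ^ n * (inverse r * r) = z ^ n * (inverse r * (\<Sum>i\<in>{1..l}. s * coeff q i * inverse z ^ i))" by simp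
    then have "z ^ n = (\<Sum>i\<in>{1..l}. c i * (z ^ n * inverse z ^ i))"
      using r by (simp add: c_def sum_distrib_left mult_ac)
    also have "\<dots> = (\<Sum>i\<in>{1..l}. c i * z ^ (n - i))"
    proof (intro sum.cong refl)
      fix i assume "i \<in> {1..l}"
      then have "i \<le> n" using deg by (simp add: n_def l_def)
      then have "z ^ n = z ^ (n - i) * z ^ i" by (simp flip: power_add)
      moreover have "z ^ i * inverse z ^ i = 1" using z by (simp flip: power_mult_distrib)
      ultimately show "c i * (z ^ n * inverse z ^ i) = c i * z ^ (n - i)" by (simp only: mult.assoc mult_1_right)
    qed
    finally show ?thesis .
  qed
  define a where "a = coeff p n"
  define p' where "p' = (p - monom a n) + (\<Sum>i\<in>{1..l}. monom (a * c i) (n - i))"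
  have "poly p' z = poly p z - a * z ^ n + a * (\<Sum>i\<in>{1..l}. c i * z ^ (n - i))"
    by (simp add: p'_def poly_monom poly_sum sum_distrib_left mult.assoc)
  then have "inverse s = poly p' z" using zn p(1) by simp
  moreover have "coeff p' i \<in> B" for i
    unfolding p'_def using p(2) cB by (auto simp: coeff_sum a_def intro!: closed)
  moreover have "degree p' < n"
  proof -
    have "coeff p' i = 0" if "n - 1 < i" for i
    proof -
      have "coeff (p - monom a n) i = 0" using that by (cases "i = n") (auto simp: a_def n_def coeff_eq_0)
      moreover have "coeff (monom (a * c j) (n - j)) i = 0" if "j \<in> {1..l}" for j
        using \<open>n - 1 < i\<close> that n0 by auto
      ultimately show ?thesis by (simp add: p'_def coeff_sum)
    qed
    then have "degree p' \<le> n - 1" by (intro degree_le) auto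
    then show ?thesis using n0 by simp
  qed
  ultimately show ?thesis unfolding n_def by blast
qed

text \<open>Descent on the two degrees, with \<open>z\<close> and \<open>inverse z\<close>
  exchanging roles when \<open>q\<close> has the larger one.\<close>

lemma not_both:
  assumes "inverse s = poly p z" "\<And>i. coeff p i \<in> B" "inverse s = poly q (inverse z)" "\<And>i. coeff q i \<in> B" "z \<noteq> 0"
  shows False
  using assms
proof (induction "degree p + degree q" arbitrary: p q z rule: less_induct)
  case less
  show ?case
  proof (cases "degree q \<le> degree p")
    case True
    from reduce_degree[OF less.prems(1-4) True less.prems(5)]
    obtain p' where "inverse s = poly p' z" "\<And>i. coeff p' i \<in> B" "degree p' < degree p" by blast
    then show False using less.hyps[of p' q z] less.prems by auto
  next
    case False
    have "inverse s = poly p (inverse (inverse z))" "inverse z \<noteq> 0" using less.prems by auto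
    from reduce_degree[OF less.prems(3,4) this(1) less.prems(2) _ this(2)] False
    obtain q' where "inverse s = poly q' (inverse z)" "\<And>i. coeff q' i \<in> B" "degree q' < degree q" by auto
    then show False using less.hyps[of p q' z] less.prems by auto
  qed
qed

lemma val_ring: "val_ring B"
proof -
  have "z \<in> B \<or> inverse z \<in> B" for z
  proof (rule ccontr)
    assume n: "\<not> ?thesis"
    then have "inverse s \<in> adjoin B z" "inverse s \<in> adjoin B (inverse z)" using maximal by blast+
    then obtain p q where "inverse s = poly p z" "\<And>i. coeff p i \<in> B"
      "inverse s = poly q (inverse z)" "\<And>i. coeff q i \<in> B" by (auto simp: adjoin_def)
    moreover have "z \<noteq> 0" using n zero by auto
    ultimately show False by (rule not_both)
  qed
  then show ?thesis unfolding val_ring_def using subring s_inv by blast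
qed

end

text \<open>Zorn's lemma for the subrings above \<open>A\<close> that avoid 1 / s. One excluded
  element is enough: for the ring of a discrete place it already fixes the intersection with the
  base field.\<close>

lemma exists_valuation_ring:
  assumes A: "is_subring A" and s: "s \<in> A" "s \<noteq> 0" "inverse s \<notin> A"
  shows "\<exists>B. A \<subseteq> B \<and> val_ring B \<and> inverse s \<notin> B"
proof -
  define F where "F = {B. is_subring B \<and> A \<subseteq> B \<and> inverse s \<notin> B}"
  have "\<exists>M\<in>F. \<forall>N\<in>F. M \<subseteq> N \<longrightarrow> N = M"
  proof (rule subset_Zorn_nonempty)
    show "F \<noteq> {}" using A s by (auto simp: F_def)
  next
    fix C assume C: "C \<noteq> {}" "subset.chain F C"
    then have sub: "C \<subseteq> F" and chain: "\<And>S T. S \<in> C \<Longrightarrow> T \<in> C \<Longrightarrow> S \<subseteq> T \<or> T \<subseteq> S"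
      by (auto simp: subset_chain_def)
    have "is_subring (\<Union>C)" unfolding is_subring_def
    proof (intro conjI ballI)
      show "1 \<in> \<Union>C" using C(1) sub by (auto simp: F_def is_subring_def)
    next
      fix a b assume "a \<in> \<Union>C" "b \<in> \<Union>C"
      then obtain D E where DE: "D \<in> C" "a \<in> D" "E \<in> C" "b \<in> E" by blast
      then obtain G where G: "G \<in> C" "a \<in> G" "b \<in> G" using chain[of D E] by blast
      then have "is_subring G" using sub by (auto simp: F_def)
      then show "a - b \<in> \<Union>C" "a * b \<in> \<Union>C" using G by (auto simp: is_subring_def)
    qed
    then show "\<Union>C \<in> F" using C(1) sub by (auto simp: F_def)
  qed
  then obtain B where B: "B \<in> F" and max: "\<And>N. N \<in> F \<Longrightarrow> B \<subseteq> N \<Longrightarrow> N = B" by blast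
  interpret subring B using B by unfold_locales (simp add: F_def)
  interpret maximal_subring B s
  proof unfold_locales
    fix z assume "inverse s \<notin> adjoin B z"
    then have "adjoin B z \<in> F" using adjoin[of z] B by (auto simp: F_def)
    then show "z \<in> B" using max adjoin[of z] by blast
  qed (use B s in \<open>auto simp: F_def\<close>)
  show ?thesis using B val_ring by (auto simp: F_def)
qed

section \<open>Roots of unity in an algebraically closed field\<close>

lemma degree_monom_minus_const:
  fixes a :: "'l::field"
  assumes "0 < m" shows "degree (monom 1 m - [:a:]) = m"
proof (rule antisym)
  show "degree (monom 1 m - [:a:]) \<le> m" by (intro degree_diff_le) (auto simp: degree_monom_le)
  have "coeff (monom 1 m - [:a:]) m = 1" using assms by (cases m) simp_all
  then show "m \<le> degree (monom 1 m - [:a:])" by (intro le_degree) simp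
qed

text \<open>The derivative m x^(m - 1) does not vanish at a root of x^m - 1, so all m roots are
  simple.\<close>

lemma card_roots_of_unity:
  fixes m :: nat
  assumes m: "0 < m" and char: "of_nat m \<noteq> (0 :: 'l::alg_closed_field)"
  shows "finite {x :: 'l. x ^ m = 1}" "m \<le> card {x :: 'l. x ^ m = 1}"
proof -
  let ?U = "{x :: 'l. x ^ m = 1}"
  define p :: "'l poly" where "p = monom 1 m - 1"
  have ev: "poly p x = x ^ m - 1" for x by (simp add: p_def poly_monom)
  have p0: "p \<noteq> 0"
  proof
    assume "p = 0"
    then have "poly p 0 = 0" by simp
    then show False using m by (simp add: ev power_0_left)
  qed
  have "degree p = m" using degree_monom_minus_const[OF m, of "1 :: 'l"] by (simp add: p_def one_pCons)
  have U: "?U = {x. poly p x = 0}" by (simp add: ev)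
  show fin: "finite ?U" unfolding U by (rule poly_roots_finite[OF p0])
  obtain A where A: "size A = m" "p = smult (lead_coeff p) (\<Prod>x\<in>#A. [:- x, 1:])"
    using alg_closed_imp_factorization[OF p0] \<open>degree p = m\<close> by auto
  have sub: "set_mset A \<subseteq> ?U"
  proof
    fix x assume "x \<in># A"
    then obtain A' where "A = add_mset x A'" by (meson multi_member_split)
    then have "poly p x = 0" by (subst A(2)) simp
    then show "x \<in> ?U" unfolding U by simp
  qed
  have "count A x = 1" if x: "x \<in># A" for x
  proof (rule ccontr)
    assume n1: "count A x \<noteq> 1"
    obtain A' where A': "A = add_mset x A'" using x by (meson multi_member_split)
    then have "x \<in># A'" using n1 by (auto simp: not_in_iff)
    then obtain A'' where A'': "A' = add_mset x A''" by (meson multi_member_split)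
    define r where "r = smult (lead_coeff p) (\<Prod>x\<in>#A''. [:- x, 1:])"
    have r: "p = [:- x, 1:] * ([:- x, 1:] * r)"
      unfolding r_def by (subst (1) A(2)) (simp add: A' A'' del: mult_pCons_left)
    have "poly (pderiv p) x = 0" unfolding r pderiv_mult by simp
    moreover have "pderiv p = monom (of_nat m) (m - 1)" by (simp add: p_def pderiv_diff pderiv_monom)
    moreover have "x \<noteq> 0" using sub x m by (auto simp: power_0_left)
    ultimately show False using char by (simp add: poly_monom)
  qed
  then have "size A = card (set_mset A)" by (simp add: size_multiset_overloaded_eq)
  then show "m \<le> card ?U" using A(1) card_mono[OF fin sub] by simp
qed

text \<open>With j = k mod m > 0, some root of unity \<open>e\<close> has
  \<open>e ^ j \<noteq> 1\<close>, as x^j = 1 has at most j < m solutions. Multiplication by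
  \<open>e\<close> permutes the roots and multiplies the sum by \<open>e ^ j\<close>, which forces
  it to be 0.\<close>

lemma sum_roots_of_unity_power:
  fixes m :: nat
  assumes m: "0 < m" and char: "of_nat m \<noteq> (0 :: 'l::alg_closed_field)"
  defines "U \<equiv> {x :: 'l. x ^ m = 1}"
  shows "(\<Sum>x\<in>U. x ^ k) = (if m dvd k then of_nat m else 0)"
proof -
  note fin = card_roots_of_unity(1)[OF m char, folded U_def]
  note le = card_roots_of_unity(2)[OF m char, folded U_def]
  have bound: "card {x :: 'l. x ^ j = 1} \<le> j" if "0 < j" for j
  proof -
    define p :: "'l poly" where "p = monom 1 j - 1"
    have ev: "poly p x = x ^ j - 1" for x by (simp add: p_def poly_monom)
    have p0: "p \<noteq> 0"
    proof
      assume "p = 0"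
      then have "poly p 0 = 0" by simp
      then show False using that by (simp add: ev power_0_left)
    qed
    have "{x :: 'l. x ^ j = 1} = {x. poly p x = 0}" by (simp add: ev)
    moreover have "degree p \<le> j" unfolding p_def by (intro degree_diff_le) (auto simp: degree_monom_le)
    ultimately show ?thesis using card_poly_roots_bound[OF p0] by simp
  qed
  have card: "card U = m" using le bound[OF m] by (simp add: U_def)
  have one: "x ^ m = 1" if "x \<in> U" for x using that by (simp add: U_def)
  have red: "x ^ k = x ^ (k mod m)" if "x \<in> U" for x k
    using one[OF that] by (metis div_mult_mod_eq mult.commute mult_1 power_add power_mult power_one)
  show ?thesis
  proof (cases "m dvd k")
    case True
    then have "x ^ k = 1" if "x \<in> U" for x using red[OF that, of k] by simp
    then show ?thesis using True card by simp
  next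
    case False
    define j where "j = k mod m"
    have j: "0 < j" "j < m" using False m by (auto simp: j_def mod_greater_zero_iff_not_dvd)
    have "finite {x :: 'l. x ^ j = 1}"
    proof (rule finite_subset)
      show "{x :: 'l. x ^ j = 1} \<subseteq> {x. poly (monom 1 j - 1) x = 0}" by (auto simp: poly_monom)
      have "coeff (monom 1 j - 1 :: 'l poly) j = 1" using j by simp
      then have "monom 1 j - 1 \<noteq> (0 :: 'l poly)" by (metis coeff_0 zero_neq_one)
      then show "finite {x :: 'l. poly (monom 1 j - 1) x = 0}" by (rule poly_roots_finite)
    qed
    then have "\<not> U \<subseteq> {x. x ^ j = 1}" using card_mono[of "{x :: 'l. x ^ j = 1}" U] bound[OF j(1)] card j by auto
    then obtain e where e: "e \<in> U" "e ^ j \<noteq> 1" by blast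
    have e0: "e \<noteq> 0" using one[OF e(1)] m by (auto simp: power_0_left)
    have "bij_betw (\<lambda>x. e * x) U U"
    proof (rule bij_betw_byWitness[where f' = "\<lambda>x. x / e"])
      show "(\<lambda>x. e * x) ` U \<subseteq> U" "(\<lambda>x. x / e) ` U \<subseteq> U"
        using one[OF e(1)] by (auto simp: U_def power_mult_distrib power_divide)
    qed (use e0 in auto)
    then have "(\<Sum>x\<in>U. x ^ j) = (\<Sum>x\<in>U. (e * x) ^ j)" by (rule sum.reindex_bij_betw[symmetric])
    also have "\<dots> = e ^ j * (\<Sum>x\<in>U. x ^ j)" by (simp add: power_mult_distrib sum_distrib_left)
    finally have "(e ^ j - 1) * (\<Sum>x\<in>U. x ^ j) = 0" by (simp add: algebra_simps)
    then have "(\<Sum>x\<in>U. x ^ j) = 0" using e by simp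
    moreover have "(\<Sum>x\<in>U. x ^ k) = (\<Sum>x\<in>U. x ^ j)" unfolding j_def by (intro sum.cong refl) (rule red)
    ultimately show ?thesis using False by simp
  qed
qed

section \<open>Evaluation of polynomials through a field homomorphism\<close>

context field_homo begin

definition "ev y g = poly (map_poly h g) y"

lemma ev_0 [simp]: "ev y 0 = 0" and ev_pCons: "ev y (pCons a g) = h a + y * ev y g"
  by (simp_all add: ev_def map_poly_pCons)

lemma ev_const [simp]: "ev y [:a:] = h a"
  by (simp add: ev_pCons)

lemma ev_add: "ev y (f + g) = ev y f + ev y g"
proof (induction f g rule: poly_induct2)
  case (pCons a p b q)
  then show ?case by (simp add: ev_pCons algebra_simps)
qed simp

lemma ev_smult: "ev y (smult a g) = h a * ev y g"
  by (induction g) (simp_all add: ev_pCons algebra_simps)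

lemma ev_mult: "ev y (f * g) = ev y f * ev y g"
  by (induction f) (simp_all add: ev_pCons ev_add ev_smult algebra_simps)

lemma ev_1: "ev y 1 = 1"
  using ev_const[of y 1] by (simp add: one_pCons)

lemma ev_diff: "ev y (f - g) = ev y f - ev y g"
  using ev_add[of y "f - g" g] by (simp add: eq_diff_eq)

lemma ev_monom: "ev y (monom a n) = h a * y ^ n"
  by (simp add: ev_def map_poly_monom poly_monom)

lemma ev_sum: "ev y (sum f A) = (\<Sum>i\<in>A. ev y (f i))"
  by (induction A rule: infinite_finite_induct) (auto simp: ev_add)

lemma ev_low_degree:
  assumes "degree g < n" shows "ev y g = (\<Sum>i<n. h (coeff g i) * y ^ i)"
proof -
  have "g = (\<Sum>i\<le>n - 1. monom (coeff g i) i)" using assms by (simp add: poly_as_sum_of_monoms')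
  then have "ev y g = (\<Sum>i\<le>n - 1. h (coeff g i) * y ^ i)" by (metis (no_types, lifting) ev_sum ev_monom sum.cong)
  moreover have "{..n - 1} = {..<n}" using assms by auto
  ultimately show ?thesis by simp
qed

end


section \<open>Conjugate embeddings of F into its algebraic closure\<close>

locale kummer_ext = ff \<phi> Y m f0
  for \<phi> :: "'a::{field,finite} poly fract \<Rightarrow> 'f::field" and Y m f0 +
  assumes char: "of_nat m \<noteq> (0 :: 'a)"
    and unique: "(\<Sum>i<m. \<phi> (c i) * Y ^ i) = 0 \<Longrightarrow> i < m \<Longrightarrow> c i = 0"
begin

definition \<psi> :: "'a poly fract \<Rightarrow> 'f alg_closure" where "\<psi> = to_ac \<circ> \<phi>"

sublocale to_ac: field_homo "to_ac :: 'f \<Rightarrow> 'f alg_closure"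
  by unfold_locales (simp add: field_hom_def)

sublocale psi: field_homo \<psi>
  unfolding \<psi>_def by (rule field_homo_comp) unfold_locales

lemma psi: "\<psi> z = to_ac (\<phi> z)" by (simp add: \<psi>_def o_apply)

abbreviation "\<eta> \<equiv> to_ac Y"

definition roots :: "'f alg_closure set" where "roots = {z. z ^ m = 1}"

text \<open>The conjugate embedding \<open>F \<rightarrow> F\<^sup>a\<^sup>l\<^sup>g\<close> with \<open>Y \<mapsto> \<zeta> Y\<close>.\<close>

definition conj :: "'f alg_closure \<Rightarrow> 'f \<Rightarrow> 'f alg_closure" where
  "conj z w = psi.ev (z * \<eta>) (SOME g. phi.ev Y g = w)"

lemma ev_surj: "\<exists>g. phi.ev Y g = w"
proof -
  obtain c where "w = (\<Sum>i<m. \<phi> (c i) * Y ^ i)" using gen by blast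
  then have "phi.ev Y (\<Sum>i<m. monom (c i) i) = w" by (simp add: phi.ev_sum phi.ev_monom)
  then show ?thesis by blast
qed

text \<open>As the powers of \<open>Y\<close> below \<open>m\<close> are independent, a polynomial
  vanishing at \<open>Y\<close> is a multiple of X^m - f0, which vanishes at
  \<open>z * \<eta>\<close> too. So \<open>conj\<close> does not depend on the polynomial picked by
  \<open>SOME\<close>.\<close>

lemma ev_eq_0_conj:
  assumes z: "z \<in> roots" and g: "phi.ev Y g = 0" shows "psi.ev (z * \<eta>) g = 0"
proof -
  define M where "M = monom 1 m - [:f0:]"
  have dM: "degree M = m" unfolding M_def by (rule degree_monom_minus_const[OF m])
  then have M0: "M \<noteq> 0" using m by auto
  have "phi.ev Y M = 0" by (simp add: M_def phi.ev_diff phi.ev_monom Ym)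
  have "\<eta> ^ m = \<psi> f0" using Ym by (metis psi to_ac.power)
  then have "psi.ev (z * \<eta>) M = 0"
    using z by (simp add: M_def psi.ev_diff psi.ev_monom power_mult_distrib roots_def)
  let ?r = "g mod M"
  have gr: "g = g div M * M + ?r" by simp
  have "phi.ev Y (g div M * M + ?r) = phi.ev Y ?r"
    using \<open>phi.ev Y M = 0\<close> by (simp only: phi.ev_add phi.ev_mult) simp
  then have r: "phi.ev Y ?r = 0" using gr g by simp
  have deg: "degree ?r < m" using degree_mod_less'[of M g] M0 dM m by (cases "?r = 0") auto
  have "?r = 0"
  proof (rule poly_eqI)
    fix n
    have "n < m \<Longrightarrow> coeff ?r n = 0" using unique[of "coeff ?r" n] r phi.ev_low_degree[OF deg] by simp
    then show "coeff ?r n = coeff 0 n" using deg by (cases "n < m") (auto simp: coeff_eq_0)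
  qed
  then have "psi.ev (z * \<eta>) (g div M * M + ?r) = 0"
    using \<open>psi.ev (z * \<eta>) M = 0\<close> by (simp only: psi.ev_add psi.ev_mult) simp
  then show ?thesis using gr by simp
qed

lemma conj_ev:
  assumes "z \<in> roots" shows "conj z (phi.ev Y g) = psi.ev (z * \<eta>) g"
proof -
  define g' where "g' = (SOME g'. phi.ev Y g' = phi.ev Y g)"
  have "phi.ev Y g' = phi.ev Y g" unfolding g'_def by (rule someI_ex) blast
  then have "phi.ev Y (g' - g) = 0" by (simp add: phi.ev_diff)
  then have "psi.ev (z * \<eta>) (g' - g) = 0" by (rule ev_eq_0_conj[OF assms])
  then show ?thesis by (simp add: conj_def psi.ev_diff flip: g'_def)
qed

lemma conj_hom:
  assumes z: "z \<in> roots" shows "field_homo (conj z)"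
proof (unfold_locales, unfold field_hom_def, intro conjI allI)
  show "conj z 1 = 1" using conj_ev[OF z, of 1] by (simp add: phi.ev_1 psi.ev_1)
next
  fix a b :: 'f
  obtain f g where "phi.ev Y f = a" "phi.ev Y g = b" using ev_surj by meson
  then show "conj z (a + b) = conj z a + conj z b" "conj z (a * b) = conj z a * conj z b"
    using conj_ev[OF z, of "f + g"] conj_ev[OF z, of "f * g"] conj_ev[OF z, of f] conj_ev[OF z, of g]
    by (simp_all add: phi.ev_add phi.ev_mult psi.ev_add psi.ev_mult)
qed

lemma conj_phi: "z \<in> roots \<Longrightarrow> conj z (\<phi> a) = \<psi> a"
  using conj_ev[of z "[:a:]"] by simp

lemma conj_sum:
  assumes "z \<in> roots" shows "conj z (\<Sum>i<m. \<phi> (c i) * Y ^ i) = (\<Sum>i<m. \<psi> (c i) * (z * \<eta>) ^ i)"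
  using conj_ev[OF assms, of "\<Sum>i<m. monom (c i) i"]
  by (simp add: phi.ev_sum phi.ev_monom psi.ev_sum psi.ev_monom)

text \<open>Where total ramification is not assumed, valuations of the summands may coincide, so
  each summand is isolated by averaging the conjugates of the sum against powers of roots of unity.
  The conclusion concerns its m-th power because that lies in the base field.\<close>

lemma integral_components:
  assumes P: "place rat_const P"
    and w: "\<And>Q. place \<iota> Q \<Longrightarrow> contraction Q = P \<Longrightarrow> (\<Sum>i<m. \<phi> (c i) * Y ^ i) \<in> place_ring Q"
    and i: "i < m"
  shows "c i ^ m * f0 ^ i \<in> place_ring P"
proof -
  interpret p: dplace P using rat_discrete[OF P] by unfold_locales
  let ?t = "p.unif"
  have tR: "?t \<in> p.R" "inverse ?t \<notin> p.R" using p.unif p.P_iff by (auto simp: p.unit_def)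
  \<comment> \<open>Excluding the inverse of one uniformizer makes \<open>B\<close> meet the base
    field in exactly the ring of \<open>P\<close>: a function with a pole at \<open>P\<close> would
    produce that inverse.\<close>
  have "\<exists>B. \<psi> ` p.R \<subseteq> B \<and> val_ring B \<and> inverse (\<psi> ?t) \<notin> B"
  proof (rule exists_valuation_ring)
    show "is_subring (\<psi> ` p.R)" unfolding is_subring_def
    proof (intro conjI ballI)
      show "1 \<in> \<psi> ` p.R" using p.one by (intro image_eqI[of _ _ 1]) simp_all
      fix a b assume "a \<in> \<psi> ` p.R" "b \<in> \<psi> ` p.R"
      then obtain x y where xy: "x \<in> p.R" "y \<in> p.R" "a = \<psi> x" "b = \<psi> y" by blast
      show "a - b \<in> \<psi> ` p.R" using xy p.diff by (intro image_eqI[of _ _ "x - y"]) simp_all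
      show "a * b \<in> \<psi> ` p.R" using xy p.mult by (intro image_eqI[of _ _ "x * y"]) simp_all
    qed
    show "inverse (\<psi> ?t) \<notin> \<psi> ` p.R"
    proof
      assume "inverse (\<psi> ?t) \<in> \<psi> ` p.R"
      then obtain x where "x \<in> p.R" "\<psi> (inverse ?t) = \<psi> x" by auto
      then show False using tR(2) unfolding psi.eq_iff by blast
    qed
  qed (use tR p.unif in auto)
  then obtain B where B: "\<psi> ` p.R \<subseteq> B" "val_ring B" "inverse (\<psi> ?t) \<notin> B" by blast
  interpret B: valring B using B by unfold_locales
  have mem: "k \<in> p.R \<longleftrightarrow> \<psi> k \<in> B" for k
  proof
    assume k: "\<psi> k \<in> B"
    show "k \<in> p.R"
    proof (rule ccontr)
      assume nk: "k \<notin> p.R"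
      then have k0: "k \<noteq> 0" using p.zero by auto
      have "val P k < 0" using nk k0 p.R_iff by (auto simp: vge_def)
      then have "vge P (inverse ?t * inverse k) 0"
        using k0 p.unif by (simp add: vge_def p.val_mult p.val_inverse)
      then have "\<psi> (inverse ?t * inverse k) \<in> B" using B(1) p.R_iff by blast
      then have "\<psi> (inverse ?t * inverse k) * \<psi> k \<in> B" using k by (rule B.mult)
      moreover have "\<psi> (inverse ?t * inverse k) * \<psi> k = inverse (\<psi> ?t)"
        using k0 by simp
      ultimately show False using B(3) by metis
    qed
  qed (use B in blast)
  have cB: "\<psi> (rat_const a) \<in> B" for a using place_valring(3)[OF P] mem by blast
  \<comment> \<open>The preimage of \<open>B\<close> under a conjugate embedding is a valuation ring
    of F over \<open>P\<close>; the hypothesis at all places over \<open>P\<close> thus controls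
    every conjugate.\<close>
  have conjB: "conj z (\<Sum>i<m. \<phi> (c i) * Y ^ i) \<in> B" if z: "z \<in> roots" for z
  proof -
    interpret cz: field_homo "conj z" using conj_hom[OF z] .
    let ?R = "conj z -` B"
    have "is_subring ?R" unfolding is_subring_def by (auto intro: B.closed)
    moreover have "inverse (\<phi> ?t) \<notin> ?R" using B(3) conj_phi[OF z] by simp
    moreover have "x \<in> ?R \<or> inverse x \<in> ?R" for x using B.total[of "conj z x"] by auto
    ultimately have vr: "val_ring ?R" unfolding val_ring_def by blast
    have ir: "range \<iota> \<subseteq> ?R" using cB conj_phi[OF z] by (auto simp: o_apply)
    note Q = place_nonunits[OF vr ir]
    have "\<phi> -` ?R = p.R" using mem conj_phi[OF z] by auto
    then have "contraction (nonunits ?R) = P"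
      unfolding contraction_def Q(2) using p.P_eq by simp
    from w[OF Q(1) this] show ?thesis unfolding Q(2) by simp
  qed
  have charL: "of_nat m \<noteq> (0 :: 'f alg_closure)"
  proof -
    have "\<psi> (rat_const (of_nat m)) \<noteq> 0"
      unfolding psi.eq_0_iff rc.eq_0_iff using char .
    then show ?thesis by simp
  qed
  have rootsB: "z \<in> B" if "z \<in> roots" for z
  proof (rule ccontr)
    assume n: "z \<notin> B"
    then have z0: "z \<noteq> 0" using B.zero by auto
    have "z ^ m = 1" using that by (simp add: roots_def)
    then have "z * z ^ (m - 1) = 1" using m by (simp flip: power_Suc)
    then have "z ^ (m - 1) = inverse z" by (metis inverse_unique)
    then have "z = inverse z ^ (m - 1)" by (metis inverse_inverse_eq power_inverse)
    moreover have "inverse z ^ (m - 1) \<in> B" using B.total[OF n] by (rule B.power)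
    ultimately show False using n by simp
  qed
  \<comment> \<open>The exponent \<open>m - i\<close> stands for -i.\<close>
  have orth: "(\<Sum>z\<in>roots. z ^ (m - i) * z ^ j) = (if j = i then of_nat m else 0)" if "j < m" for j
  proof -
    have "m dvd m - i + j \<longleftrightarrow> j = i"
    proof
      assume "m dvd m - i + j"
      then have "m dvd (m - i + j) + i" if "i = 0" using that by simp
      from \<open>m dvd m - i + j\<close> obtain k where k: "m - i + j = m * k" by blast
      have "0 < m * k" "m * k < m * 2" using k i \<open>j < m\<close> by linarith+
      then have "k = 1" by simp
      then show "j = i" using k i by simp
    qed (use i in simp)
    then show ?thesis using sum_roots_of_unity_power[OF m charL, of "m - i + j"]
      unfolding roots_def power_add by simp
  qed
  have "(\<Sum>z\<in>roots. z ^ (m - i) * conj z (\<Sum>j<m. \<phi> (c j) * Y ^ j))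
      = (\<Sum>z\<in>roots. \<Sum>j<m. \<psi> (c j) * \<eta> ^ j * (z ^ (m - i) * z ^ j))"
  proof (intro sum.cong refl)
    fix z assume z: "z \<in> roots"
    show "z ^ (m - i) * conj z (\<Sum>j<m. \<phi> (c j) * Y ^ j) = (\<Sum>j<m. \<psi> (c j) * \<eta> ^ j * (z ^ (m - i) * z ^ j))"
      unfolding conj_sum[OF z] sum_distrib_left
      by (intro sum.cong refl) (simp add: power_mult_distrib mult_ac)
  qed
  also have "\<dots> = (\<Sum>j<m. \<psi> (c j) * \<eta> ^ j * (\<Sum>z\<in>roots. z ^ (m - i) * z ^ j))"
    by (subst sum.swap) (simp add: sum_distrib_left)
  also have "\<dots> = (\<Sum>j<m. if j = i then \<psi> (c j) * \<eta> ^ j * of_nat m else 0)"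
    by (intro sum.cong refl) (simp add: orth)
  also have "\<dots> = \<psi> (c i) * \<eta> ^ i * of_nat m" using i by simp
  finally have eq: "(\<Sum>z\<in>roots. z ^ (m - i) * conj z (\<Sum>j<m. \<phi> (c j) * Y ^ j)) = \<psi> (c i) * \<eta> ^ i * of_nat m" .
  have "(\<Sum>z\<in>roots. z ^ (m - i) * conj z (\<Sum>j<m. \<phi> (c j) * Y ^ j)) \<in> B"
    by (rule B.sum, rule B.mult, rule B.power, erule rootsB, erule conjB)
  then have "\<psi> (c i) * \<eta> ^ i * of_nat m \<in> B" unfolding eq .
  moreover have "\<psi> (rat_const (inverse (of_nat m))) \<in> B" by (rule cB)
  ultimately have "\<psi> (c i) * \<eta> ^ i * of_nat m * \<psi> (rat_const (inverse (of_nat m))) \<in> B" by (rule B.mult)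
  then have "\<psi> (c i) * \<eta> ^ i \<in> B" using charL by (simp add: mult.assoc)
  then have "(\<psi> (c i) * \<eta> ^ i) ^ m \<in> B" by (rule B.power)
  moreover have "(\<psi> (c i) * \<eta> ^ i) ^ m = \<psi> (c i ^ m * f0 ^ i)"
  proof -
    have "(\<eta> ^ i) ^ m = (\<eta> ^ m) ^ i" by (simp add: mult.commute flip: power_mult)
    moreover have "\<eta> ^ m = \<psi> f0" using Ym by (metis psi to_ac.power)
    ultimately show ?thesis by (simp add: power_mult_distrib)
  qed
  ultimately show ?thesis using mem by simp
qed

end

section \<open>Divisors supported at totally ramified places\<close>

text \<open>As \<open>l\<close> is prime to \<open>m\<close>, the residues of
  \<open>x + int i * l\<close> run through all classes and their sum is independent of
  \<open>x\<close>. So the quotients together grow by exactly m x / m = x.\<close>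

lemma sum_div_coprime:
  assumes m: "0 < m" and cop: "coprime (int m) l"
  shows "(\<Sum>i<m. (x + int i * l) div int m) = x + (\<Sum>i<m. (int i * l) div int m)"
proof -
  have perm: "(\<Sum>i<m. (y + int i * l) mod int m) = \<Sum>{0..<int m}" for y
  proof -
    let ?g = "\<lambda>i. (y + int i * l) mod int m"
    have inj: "inj_on ?g {..<m}"
    proof (rule inj_onI)
      fix i j assume ij: "i \<in> {..<m}" "j \<in> {..<m}" "?g i = ?g j"
      then have "int m dvd (y + int i * l) - (y + int j * l)" by (simp only: mod_eq_dvd_iff)
      then have "int m dvd (int i - int j) * l" by (simp add: algebra_simps)
      then have "int m dvd int i - int j" using cop by (simp add: coprime_dvd_mult_left_iff)
      then have "int i mod int m = int j mod int m" by (simp only: mod_eq_dvd_iff)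
      then show "i = j" using ij by simp
    qed
    have "?g ` {..<m} \<subseteq> {0..<int m}" using m by auto
    moreover have "card (?g ` {..<m}) = card {0..<int m}" using card_image[OF inj] by simp
    ultimately have im: "?g ` {..<m} = {0..<int m}" by (intro card_subset_eq) auto
    have "sum ?g {..<m} = sum (\<lambda>x. x) (?g ` {..<m})" using sum.reindex[OF inj, of "\<lambda>x. x"] by (simp add: o_def)
    then show ?thesis unfolding im .
  qed
  have split: "int m * (\<Sum>i<m. (y + int i * l) div int m) = (\<Sum>i<m. y + int i * l) - \<Sum>{0..<int m}" for y
  proof -
    have "(\<Sum>i<m. y + int i * l) = (\<Sum>i<m. int m * ((y + int i * l) div int m) + (y + int i * l) mod int m)"
      by simp
    then show ?thesis unfolding sum.distrib[of "\<lambda>i. int m * ((y + int i * l) div int m)"] perm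
      by (simp add: sum_distrib_left)
  qed
  have "int m * (\<Sum>i<m. (x + int i * l) div int m) = int m * (x + (\<Sum>i<m. (int i * l) div int m))"
    using split[of x] split[of 0] by (simp add: sum.distrib algebra_simps)
  then show ?thesis using m by simp
qed

lemma ge_div_iff:
  fixes v x :: int assumes "0 < m" shows "0 \<le> int m * v + x \<longleftrightarrow> - (x div int m) \<le> v"
proof -
  have "- v \<le> x div int m \<longleftrightarrow> - v * int m \<le> x"
  proof
    assume "- v \<le> x div int m"
    then have "- v * int m \<le> x div int m * int m" using assms by (intro mult_right_mono) auto
    also have "\<dots> = x - x mod int m" by (rule minus_mod_eq_div_mult[symmetric])
    also have "\<dots> \<le> x" using assms by simp
    finally show "- v * int m \<le> x" .
  next
    assume "- v * int m \<le> x"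
    then have "(- v * int m) div int m \<le> x div int m" using assms by (intro zdiv_mono1) auto
    then show "- v \<le> x div int m" using assms by (simp only: nonzero_mult_div_cancel_right of_nat_eq_0_iff neq0_conv)
  qed
  then show ?thesis by (auto simp: algebra_simps)
qed

context ff begin

lemma fin_spanned_scaled:
  assumes "fin_spanned W"
  shows "fin_spanned ((*) a ` W) \<and> V.dim ((*) a ` W) \<le> V.dim W"
proof -
  obtain B where B: "finite B" "W \<subseteq> V.span B" "card B = V.dim W" using fin_spanned_basis[OF assms] by blast
  let ?S = "{z. a * z \<in> V.span ((*) a ` B)}"
  have "V.subspace ?S"
  proof (rule V.subspaceI)
    fix c x assume "x \<in> ?S"
    then have "\<iota> c * (a * x) \<in> V.span ((*) a ` B)" by (intro V.span_scale) simp
    then show "\<iota> c * x \<in> ?S" by (simp add: mult.left_commute)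
  qed (auto simp: V.span_zero distrib_left intro: V.span_add)
  moreover have "B \<subseteq> ?S" by (auto intro: V.span_base)
  ultimately have "V.span B \<subseteq> ?S" by (intro V.span_minimal)
  then have s: "(*) a ` W \<subseteq> V.span ((*) a ` B)" using B(2) by auto
  have "V.dim ((*) a ` W) \<le> card ((*) a ` B)" using s B(1) by (intro V.dim_le_card) auto
  also have "\<dots> \<le> V.dim W" using card_image_le[OF B(1), of "(*) a"] B(3) by simp
  finally show ?thesis using s B(1) unfolding fin_spanned_def by blast
qed

end

text \<open>Meant for \<open>f0\<close> = 1 / f and \<open>A\<close> the zeros of f. Of total
  ramification, uniqueness of the place above, the index \<open>m\<close> and coprimality are kept.
  The index \<open>k0\<close> singles out a totally ramified place over the finite point
  \<open>a0\<close>, which will carry all poles in the genus computation.\<close>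

locale kummer_curve = kummer_ext \<phi> Y m f0
  for \<phi> :: "'a::{field,finite} poly fract \<Rightarrow> 'f::field" and Y m f0 +
  fixes A :: "'a set" and P :: "nat \<Rightarrow> 'a poly fract set" and Q :: "nat \<Rightarrow> 'f set" and n r k0 :: nat and a0 :: 'a
  assumes P: "bij_betw P {1..r} (insert place_inf (place_at ` A))" and A: "finite A"
    and f0_unit: "\<And>p. place rat_const p \<Longrightarrow> p \<notin> insert place_inf (place_at ` A) \<Longrightarrow> val p f0 = 0"
    and nr: "n \<le> r"
    and Q: "\<And>k. k \<in> {1..n} \<Longrightarrow> place \<iota> (Q k)" "\<And>k. k \<in> {1..n} \<Longrightarrow> contraction (Q k) = P k"
    and Q_unique: "\<And>k Q'. k \<in> {1..n} \<Longrightarrow> place \<iota> Q' \<Longrightarrow> contraction Q' = P k \<Longrightarrow> Q' = Q k"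
    and Q_ram: "\<And>k. k \<in> {1..n} \<Longrightarrow> ramification_index \<phi> (Q k) (P k) = m"
    and cop: "\<And>k. k \<in> {1..n} \<Longrightarrow> coprime (int m) (val (P k) f0)"
    and k0: "k0 \<in> {1..n}" "P k0 = place_at a0"
begin

text \<open>With \<open>f0\<close> = 1 / f this is minus the \<lambda> of the theorem.\<close>

definition \<mu> :: "nat \<Rightarrow> int" where "\<mu> k = val (P k) f0"

definition ext :: "(nat \<Rightarrow> int) \<Rightarrow> nat \<Rightarrow> int" where "ext \<alpha> k = (if k \<le> n then \<alpha> k else 0)"

text \<open>Degree of the base field divisor governing the coefficient of \<open>Y ^ i\<close>: each
  floor solves 0 <= m v + \<alpha>_k + i \<mu>_k for the valuation v of that coefficient.\<close>

definition N :: "(nat \<Rightarrow> int) \<Rightarrow> nat \<Rightarrow> int" where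
  "N \<alpha> i = (\<Sum>k=1..r. (ext \<alpha> k + int i * \<mu> k) div int m)"

definition D :: "(nat \<Rightarrow> int) \<Rightarrow> 'f divisor" where
  "D \<alpha> = (\<Sum>k=1..n. Poly_Mapping.single (Q k) (\<alpha> k))"

definition local_bound :: "(nat \<Rightarrow> int) \<Rightarrow> nat \<Rightarrow> 'a poly fract set \<Rightarrow> int" where
  "local_bound \<alpha> i p = (if p \<in> P ` {1..r} then
     let k = the_inv_into {1..r} P p in (ext \<alpha> k + int i * \<mu> k) div int m else 0)"

lemma P_inj: "inj_on P {1..r}" and P_image: "P ` {1..r} = insert place_inf (place_at ` A)"
  using P by (auto simp: bij_betw_def)

lemma local_bound_P: "k \<in> {1..r} \<Longrightarrow> local_bound \<alpha> i (P k) = (ext \<alpha> k + int i * \<mu> k) div int m"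
  using the_inv_into_f_f[OF P_inj, of k] by (simp add: local_bound_def Let_def)

lemma P_place: "k \<in> {1..r} \<Longrightarrow> place rat_const (P k)"
proof -
  assume "k \<in> {1..r}"
  then have "P k \<in> insert place_inf (place_at ` A)" using P_image by blast
  then show ?thesis using place_inf(1) place_poly(1)[OF prime_elem_linear] by fastforce
qed

lemma Q_inj: "inj_on Q {1..n}"
proof (rule inj_onI)
  fix k l assume kl: "k \<in> {1..n}" "l \<in> {1..n}" "Q k = Q l"
  then have "P k = P l" using Q(2) by metis
  then show "k = l" using inj_onD[OF P_inj] kl nr by auto
qed

lemma lookup_D: "Poly_Mapping.lookup (D \<alpha>) Q' = (\<Sum>k=1..n. if Q k = Q' then \<alpha> k else 0)"
  by (simp add: D_def lookup_sum lookup_single when_def)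

lemma lookup_D_Q: "k \<in> {1..n} \<Longrightarrow> Poly_Mapping.lookup (D \<alpha>) (Q k) = \<alpha> k"
proof -
  assume k: "k \<in> {1..n}"
  have "(\<Sum>j=1..n. if Q j = Q k then \<alpha> j else 0) = (\<Sum>j=1..n. if j = k then \<alpha> k else 0)"
    using inj_onD[OF Q_inj _ _ k] by (intro sum.cong refl) auto
  then show ?thesis unfolding lookup_D using k by simp
qed

lemma lookup_D_other: "Q' \<notin> Q ` {1..n} \<Longrightarrow> Poly_Mapping.lookup (D \<alpha>) Q' = 0"
  unfolding lookup_D by (intro sum.neutral) auto

lemma D_divisor: "is_divisor \<iota> (D \<alpha>)"
  unfolding is_divisor_def
proof
  fix Q' assume "Q' \<in> Poly_Mapping.keys (D \<alpha>)"
  then have "Q' \<in> Q ` {1..n}" using lookup_D_other[of Q' \<alpha>] in_keys_iff by metis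
  then show "place \<iota> Q'" using Q(1) by blast
qed

lemma val_Y_Q: "k \<in> {1..n} \<Longrightarrow> val (Q k) Y = \<mu> k"
  using val_Y[OF Q(1)[of k]] Q(2)[of k] Q_ram[of k] m by (simp add: \<mu>_def)

lemma val_phi_Q: "k \<in> {1..n} \<Longrightarrow> z \<noteq> 0 \<Longrightarrow> val (Q k) (\<phi> z) = int m * val (P k) z"
  using ramification(2)[OF Q(1)[of k]] Q(2)[of k] Q_ram[of k] by simp

lemma distinct_residues:
  assumes k: "k \<in> {1..n}"
  shows "inj_on (\<lambda>i. val (Q k) (Y ^ i) mod int (ramification_index \<phi> (Q k) (contraction (Q k)))) {..<m}"
  by (rule inj_on_val_powers[OF Q(1)[OF k]]) (use k Q(2) Q_ram cop in simp_all)

lemma vge_Q_iff: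
  assumes k: "k \<in> {1..n}"
  shows "vge (Q k) (\<Sum>i<m. \<phi> (c i) * Y ^ i) (- x) \<longleftrightarrow> (\<forall>i<m. vge (P k) (c i) (- ((x + int i * \<mu> k) div int m)))"
proof -
  interpret dplace "Q k" using place_discrete[OF Q(1)[OF k]] by unfold_locales
  have "vge (Q k) (\<phi> (c i) * Y ^ i) (- x) \<longleftrightarrow> vge (P k) (c i) (- ((x + int i * \<mu> k) div int m))" for i
  proof (cases "c i = 0")
    case False
    then have "vge (Q k) (\<phi> (c i) * Y ^ i) (- x) \<longleftrightarrow> 0 \<le> int m * val (P k) (c i) + (x + int i * \<mu> k)"
      using val_phi_Q[OF k False] val_Y_Q[OF k] Y0 by (auto simp: vge_def val_mult val_power)
    then show ?thesis using False ge_div_iff[OF m] by (simp add: vge_def)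
  qed (simp add: vge_def)
  then show ?thesis
    using vge_sum_distinct_residues[OF Q(1)[OF k] _ _ distinct_residues[OF k], of c "- x"] Y0 by auto
qed

text \<open>At the \<open>Q k\<close> the summands have distinct valuations; elsewhere
  \<open>D \<alpha>\<close> is 0 and \<open>integral_components\<close> separates them. Conversely,
  the ramification index scales each condition on the base field up to the place above.\<close>

lemma mem_rr_D:
  "(\<Sum>i<m. \<phi> (c i) * Y ^ i) \<in> rr (D \<alpha>) \<longleftrightarrow>
    (\<forall>i<m. \<forall>p. place rat_const p \<longrightarrow> vge p (c i) (- local_bound \<alpha> i p))"
proof
  assume w: "(\<Sum>i<m. \<phi> (c i) * Y ^ i) \<in> rr (D \<alpha>)"
  show "\<forall>i<m. \<forall>p. place rat_const p \<longrightarrow> vge p (c i) (- local_bound \<alpha> i p)"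
  proof (intro allI impI)
    fix i p assume i: "i < m" and p: "place rat_const (p :: 'a poly fract set)"
    show "vge p (c i) (- local_bound \<alpha> i p)"
    proof (cases "p \<in> P ` {1..n}")
      case True
      then obtain k where k: "k \<in> {1..n}" "p = P k" by blast
      have "vge (Q k) (\<Sum>i<m. \<phi> (c i) * Y ^ i) (- \<alpha> k)"
        using w Q(1)[OF k(1)] lookup_D_Q[OF k(1)] unfolding mem_rr by metis
      then have "vge (P k) (c i) (- ((\<alpha> k + int i * \<mu> k) div int m))" using vge_Q_iff[OF k(1)] i by blast
      then show ?thesis using k nr by (simp add: local_bound_P ext_def)
    next
      case False
      interpret p: dplace p using rat_discrete[OF p] by unfold_locales
      have "c i ^ m * f0 ^ i \<in> place_ring p"
      proof (rule integral_components[OF p _ i])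
        fix Q' assume Q': "place \<iota> Q'" "contraction Q' = p"
        then have "Q' \<notin> Q ` {1..n}" using False Q(2) by force
        then have "vge Q' (\<Sum>i<m. \<phi> (c i) * Y ^ i) 0"
          using w Q'(1) lookup_D_other[of Q' \<alpha>] unfolding mem_rr by force
        then show "(\<Sum>i<m. \<phi> (c i) * Y ^ i) \<in> place_ring Q'"
          using dplace.R_iff[OF dplace.intro[OF place_discrete[OF Q'(1)]]] by blast
      qed
      then have "c i = 0 \<or> 0 \<le> int m * val p (c i) + int i * val p f0"
        unfolding p.R_iff vge_def using f0 m by (cases "c i = 0") (simp_all add: p.val_mult p.val_power)
      then have v: "vge p (c i) (- ((int i * val p f0) div int m))" unfolding ge_div_iff[OF m] vge_def .
      show ?thesis
      proof (cases "p \<in> P ` {1..r}")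
        case True
        then obtain k where k: "k \<in> {1..r}" "p = P k" by blast
        then have "\<not> k \<le> n" using False by auto
        then show ?thesis using v k by (simp add: local_bound_P ext_def \<mu>_def)
      next
        case False
        then have "val p f0 = 0" using f0_unit[OF p] P_image by blast
        then show ?thesis using v False by (simp add: local_bound_def)
      qed
    qed
  qed
next
  assume c: "\<forall>i<m. \<forall>p. place rat_const p \<longrightarrow> vge p (c i) (- local_bound \<alpha> i p)"
  show "(\<Sum>i<m. \<phi> (c i) * Y ^ i) \<in> rr (D \<alpha>)"
    unfolding mem_rr
  proof (intro allI impI)
    fix Q' assume Q': "place \<iota> Q'"
    define p where "p = contraction Q'"
    have p: "place rat_const p" using contraction(1)[OF Q'] by (simp add: p_def)
    show "vge Q' (\<Sum>i<m. \<phi> (c i) * Y ^ i) (- Poly_Mapping.lookup (D \<alpha>) Q')"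
    proof (cases "Q' \<in> Q ` {1..n}")
      case True
      then obtain k where k: "k \<in> {1..n}" "Q' = Q k" by blast
      have "vge (P k) (c i) (- ((\<alpha> k + int i * \<mu> k) div int m))" if "i < m" for i
        using c[rule_format, OF that P_place[of k]] k nr by (simp add: local_bound_P ext_def)
      then show ?thesis using vge_Q_iff[OF k(1)] lookup_D_Q[OF k(1)] k(2) by simp
    next
      case False
      interpret q: dplace Q' using place_discrete[OF Q'] by unfold_locales
      define e where "e = int (ramification_index \<phi> Q' p)"
      have e: "0 < e" using ramification(1)[OF Q'] by (simp add: e_def p_def)
      have np: "p \<notin> P ` {1..n}" using False Q_unique Q' p_def by blast
      have "vge Q' (\<phi> (c i) * Y ^ i) 0" if i: "i < m" for i
      proof (cases "c i = 0")
        case c0: False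
        have "vge p (c i) (- ((int i * val p f0) div int m))"
        proof (cases "p \<in> P ` {1..r}")
          case True
          then obtain k where k: "k \<in> {1..r}" "p = P k" by blast
          then have "\<not> k \<le> n" using np by auto
          then show ?thesis using c[rule_format, OF i p] k by (simp add: local_bound_P ext_def \<mu>_def)
        next
          case False
          then have "val p f0 = 0" using f0_unit[OF p] P_image by blast
          then show ?thesis using c[rule_format, OF i p] False by (simp add: local_bound_def)
        qed
        then have "0 \<le> int m * val p (c i) + int i * val p f0" using c0 ge_div_iff[OF m] by (simp add: vge_def)
        then have "0 \<le> e * (int m * val p (c i) + int i * val p f0)" using e by simp
        also have "\<dots> = int m * (e * val p (c i)) + int i * (e * val p f0)" by (simp add: algebra_simps)
        also have "\<dots> = int m * val Q' (\<phi> (c i)) + int i * (int m * val Q' Y)"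
          using ramification(2)[OF Q' c0] val_Y[OF Q'] by (simp add: e_def p_def)
        also have "\<dots> = int m * val Q' (\<phi> (c i) * Y ^ i)" using c0 Y0 by (simp add: q.val_mult q.val_power algebra_simps)
        finally show ?thesis using m by (simp add: vge_def zero_le_mult_iff)
      qed (simp add: vge_def)
      then have "vge Q' (\<Sum>i<m. \<phi> (c i) * Y ^ i) 0" by (intro q.vge_sum) simp
      then show ?thesis using lookup_D_other[OF False] by simp
    qed
  qed
qed

lemma sum_local_bound:
  "local_bound \<alpha> i place_inf + (\<Sum>a\<in>A. local_bound \<alpha> i (place_at a)) = N \<alpha> i"
proof -
  have inf: "place_inf \<noteq> place_at a" for a :: 'a
    using val_place_poly_self[OF prime_elem_linear, of a] val_place_inf[of "[:- a, 1:]"] by auto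
  have "N \<alpha> i = (\<Sum>k\<in>{1..r}. local_bound \<alpha> i (P k))" unfolding N_def by (intro sum.cong refl) (simp add: local_bound_P)
  also have "\<dots> = (\<Sum>p\<in>insert place_inf (place_at ` A). local_bound \<alpha> i p)"
    using sum.reindex_bij_betw[OF P] by blast
  also have "\<dots> = local_bound \<alpha> i place_inf + (\<Sum>p\<in>place_at ` A. local_bound \<alpha> i p)"
    using A inf by (intro sum.insert) auto
  also have "(\<Sum>p\<in>place_at ` A. local_bound \<alpha> i p) = (\<Sum>a\<in>A. local_bound \<alpha> i (place_at a))"
    using place_at_inj by (subst sum.reindex) (auto intro!: inj_onI simp: o_def)
  finally show ?thesis by simp
qed

text \<open>A basis is given by (x^a / z_i) \<open>Y ^ i\<close> with 0 <= a <= N_i, where z_i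
  absorbs the finite part of the i-th divisor; \<open>nat\<close> yields 0 when N_i is
  negative.\<close>

lemma ell_D: "fin_spanned (rr (D \<alpha>)) \<and> ell \<iota> (D \<alpha>) = (\<Sum>i<m. nat (N \<alpha> i + 1))"
proof -
  define z where "z i = (\<Prod>a\<in>A. to_fract [:- a, 1:] powi local_bound \<alpha> i (place_at a))" for i
  have z0: "z i \<noteq> 0" for i unfolding z_def by simp
  have rat: "(\<forall>p. place rat_const p \<longrightarrow> vge p c (- local_bound \<alpha> i p)) \<longleftrightarrow>
    (\<exists>g. c = to_fract g / z i \<and> (g = 0 \<or> int (degree g) \<le> N \<alpha> i))" for c i
    unfolding z_def sum_local_bound[symmetric]
  proof (rule rational_riemann_roch_space)
    fix p assume "place rat_const p" "local_bound \<alpha> i p \<noteq> 0"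
    then have "p \<in> P ` {1..r}" unfolding local_bound_def by meson
    then show "p = place_inf \<or> (\<exists>a\<in>A. p = place_at a)" unfolding P_image by blast
  qed
  define d where "d i = nat (N \<alpha> i + 1)" for i
  define J where "J = (SIGMA i:{..<m}. {..<d i})"
  have J: "finite J" by (simp add: J_def)
  define b where "b = (\<lambda>(i, a). \<phi> (to_fract (monom 1 a) / z i) * Y ^ i)"
  define G where "G u i = (\<Sum>a<d i. monom (u (i, a)) a)" for u :: "nat \<times> nat \<Rightarrow> 'a" and i
  have coeff_G: "coeff (G u i) a = (if a < d i then u (i, a) else 0)" for u i a
    by (auto simp: G_def coeff_sum)
  have sumG: "(\<Sum>j\<in>J. \<iota> (u j) * b j) = (\<Sum>i<m. \<phi> (to_fract (G u i) / z i) * Y ^ i)" for u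
  proof -
    have t: "to_fract (monom c a) = rat_const c * to_fract (monom 1 a)" for c :: 'a and a
      by (simp add: rat_const_def smult_monom flip: to_fract_mult)
    have "(\<Sum>j\<in>J. \<iota> (u j) * b j) = (\<Sum>i<m. \<Sum>a<d i. \<iota> (u (i, a)) * b (i, a))"
      unfolding J_def by (subst sum.Sigma) (auto simp: split_beta)
    also have "\<dots> = (\<Sum>i<m. \<phi> (to_fract (G u i) / z i) * Y ^ i)"
    proof (intro sum.cong refl)
      fix i
      have "to_fract (G u i) / z i = (\<Sum>a<d i. rat_const (u (i, a)) * (to_fract (monom 1 a) / z i))"
        unfolding G_def to_fract_sum t[of "u (i, _)"] by (subst t) (simp add: sum_divide_distrib)
      then have "\<phi> (to_fract (G u i) / z i) = (\<Sum>a<d i. \<iota> (u (i, a)) * \<phi> (to_fract (monom 1 a) / z i))"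
        by (simp only: phi.sum phi.mult o_apply)
      then show "(\<Sum>a<d i. \<iota> (u (i, a)) * b (i, a)) = \<phi> (to_fract (G u i) / z i) * Y ^ i"
        by (simp only: b_def prod.case sum_distrib_right mult.assoc)
    qed
    finally show ?thesis .
  qed
  have "fin_spanned (rr (D \<alpha>)) \<and> V.dim (rr (D \<alpha>)) = card J"
  proof (rule dim_family[OF J])
    fix u j assume u: "(\<Sum>j\<in>J. \<iota> (u j) * b j) = 0" and j: "j \<in> J"
    obtain i a where ia: "j = (i, a)" "i < m" "a < d i" using j by (auto simp: J_def)
    have "to_fract (G u i) / z i = 0" using u unique[of "\<lambda>i. to_fract (G u i) / z i"] ia unfolding sumG by blast
    then have "G u i = 0" using z0[of i] by simp
    then show "u j = 0" using coeff_G[of u i a] ia by simp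
  next
    show "rr (D \<alpha>) = range (\<lambda>u. \<Sum>j\<in>J. \<iota> (u j) * b j)"
    proof (intro equalityI subsetI)
      fix w assume w: "w \<in> rr (D \<alpha>)"
      obtain c where c: "w = (\<Sum>i<m. \<phi> (c i) * Y ^ i)" using gen by blast
      have "\<forall>i<m. \<exists>g. c i = to_fract g / z i \<and> (g = 0 \<or> int (degree g) \<le> N \<alpha> i)"
        using w unfolding c mem_rr_D rat .
      then obtain g where g: "\<And>i. i < m \<Longrightarrow> c i = to_fract (g i) / z i"
        "\<And>i. i < m \<Longrightarrow> g i = 0 \<or> int (degree (g i)) \<le> N \<alpha> i" by metis
      define u where "u = (\<lambda>(i, a). coeff (g i) a)"
      have "G u i = g i" if i: "i < m" for i
      proof (rule poly_eqI)
        fix a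
        have "coeff (g i) a = 0" if "\<not> a < d i"
          using g(2)[OF i] that by (cases "g i = 0") (auto intro!: coeff_eq_0 simp: d_def)
        then show "coeff (G u i) a = coeff (g i) a" unfolding coeff_G by (simp add: u_def)
      qed
      then have "w = (\<Sum>j\<in>J. \<iota> (u j) * b j)" unfolding sumG c using g(1) by (intro sum.cong) auto
      then show "w \<in> range (\<lambda>u. \<Sum>j\<in>J. \<iota> (u j) * b j)" by blast
    next
      fix w assume "w \<in> range (\<lambda>u. \<Sum>j\<in>J. \<iota> (u j) * b j)"
      then obtain u where w: "w = (\<Sum>i<m. \<phi> (to_fract (G u i) / z i) * Y ^ i)" unfolding sumG by blast
      have "G u i = 0 \<or> int (degree (G u i)) \<le> N \<alpha> i" for i
      proof (cases "G u i = 0")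
        case False
        then have "coeff (G u i) (degree (G u i)) \<noteq> 0" by simp
        then have "degree (G u i) < d i" unfolding coeff_G by meson
        then show ?thesis by (simp add: d_def zless_nat_eq_int_zless)
      qed simp
      then show "w \<in> rr (D \<alpha>)" unfolding w mem_rr_D rat by blast
    qed
  qed
  moreover have "card J = (\<Sum>i<m. d i)" unfolding J_def by simp
  ultimately show ?thesis unfolding ell_eq_dim d_def by simp
qed

end

section \<open>The genus\<close>

context kummer_curve begin

lemma rational_P:
  assumes k: "k \<in> {1..r}" and w: "w \<in> place_ring (P k)" shows "\<exists>c. w - rat_const c \<in> P k"
proof -
  have "P k \<in> insert place_inf (place_at ` A)" using P_image k by blast
  then show ?thesis using rational_place_inf[of w] rational_place_at[of w] w by auto
qed

text \<open>For 0 < i < m the valuation of \<open>\<phi> (c i) * Y ^ i\<close> is not divisible by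
  \<open>m\<close>, so if nonnegative it is positive. Modulo \<open>Q k\<close> only
  \<open>c 0\<close> survives, and its residue is constant because \<open>P k\<close> is
  rational.\<close>

lemma place_degree_Q:
  assumes k: "k \<in> {1..n}" shows "place_degree \<iota> (Q k) = 1"
proof (rule place_degree_eqI[OF Q(1)[OF k], where z = "\<lambda>_. 1"])
  interpret q: dplace "Q k" using place_discrete[OF Q(1)[OF k]] by unfold_locales
  have kr: "k \<in> {1..r}" using k nr by auto
  interpret p: dplace "P k" using rat_discrete[OF P_place[OF kr]] by unfold_locales
  show "residue_indep \<iota> (Q k) 1 (\<lambda>_. 1)"
    unfolding residue_indep_def
  proof (intro conjI allI impI)
    fix c :: "nat \<Rightarrow> 'a" and i assume c: "(\<Sum>i<1. \<iota> (c i) * 1) \<in> Q k" and i: "i < (1 :: nat)"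
    then have cQ: "\<iota> (c 0) \<in> Q k" by simp
    have "c 0 = 0"
    proof (rule ccontr)
      assume "c 0 \<noteq> 0"
      then have "q.unit (\<iota> (c 0))"
        using iota_in[OF Q(1)[OF k], of "c 0"] iota_in[OF Q(1)[OF k], of "inverse (c 0)"] by (simp add: q.unit_def)
      then show False using cQ q.P_iff by blast
    qed
    then show "c i = 0" using i by simp
  qed (rule q.one)
  show "residue_spans \<iota> (Q k) 1 (\<lambda>_. 1)"
    unfolding residue_spans_def
  proof
    fix w assume wR: "w \<in> place_ring (Q k)"
    obtain c where w: "w = (\<Sum>i<m. \<phi> (c i) * Y ^ i)" using gen by blast
    have terms: "vge (Q k) (\<phi> (c i) * Y ^ i) 0" if "i < m" for i
      using wR vge_sum_distinct_residues[OF Q(1)[OF k] _ _ distinct_residues[OF k], of c 0] Y0 that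
      unfolding w q.R_iff by simp
    have pos: "\<phi> (c i) * Y ^ i \<in> Q k" if i: "i \<in> {1..<m}" for i
    proof (cases "c i = 0")
      case False
      have "val (Q k) (\<phi> (c i) * Y ^ i) = int m * val (P k) (c i) + int i * \<mu> k"
        using False val_phi_Q[OF k False] val_Y_Q[OF k] Y0 by (simp add: q.val_mult q.val_power)
      moreover have "\<not> int m dvd int i * \<mu> k"
      proof
        assume "int m dvd int i * \<mu> k"
        then have "int m dvd int i" using cop[OF k] by (simp add: coprime_dvd_mult_left_iff \<mu>_def)
        then show False using i by (auto dest: zdvd_imp_le)
      qed
      then have "int m * val (P k) (c i) + int i * \<mu> k \<noteq> 0"
        by (metis add_eq_0_iff dvd_minus_iff dvd_triv_left)
      ultimately show ?thesis using terms[of i] i False Y0 unfolding q.P_vge by (auto simp: vge_def)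
    qed (simp add: q.P_iff q.zero q.unit_def)
    have c0: "\<phi> (c 0) \<in> place_ring (Q k)" using terms[of 0] m q.R_iff by simp
    then have "c 0 \<in> place_ring (P k)" using contraction(2)[OF Q(1)[OF k]] Q(2)[OF k] by simp
    then obtain a where "c 0 - rat_const a \<in> P k" using rational_P[OF kr] by blast
    then have "\<phi> (c 0 - rat_const a) \<in> Q k" using contraction(3)[OF Q(1)[OF k]] Q(2)[OF k] by simp
    moreover have "(\<Sum>i\<in>{1..<m}. \<phi> (c i) * Y ^ i) \<in> Q k"
      unfolding q.P_vge by (intro q.vge_sum) (use pos q.P_vge in blast)
    ultimately have "\<phi> (c 0 - rat_const a) + (\<Sum>i\<in>{1..<m}. \<phi> (c i) * Y ^ i) \<in> Q k" by (rule q.P_ideal(2))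
    moreover have "{..<m} = insert 0 {1..<m}" using m by auto
    then have "w = \<phi> (c 0) + (\<Sum>i\<in>{1..<m}. \<phi> (c i) * Y ^ i)" unfolding w by simp
    ultimately have "w - \<iota> a \<in> Q k" by (simp add: o_apply algebra_simps)
    then show "\<exists>c :: nat \<Rightarrow> 'a. w - (\<Sum>i<1. \<iota> (c i) * 1) \<in> Q k"
      by (intro exI[of _ "\<lambda>_. a"]) (simp del: sum_constant)
  qed
qed

lemma degree_D: "div_degree \<iota> (D \<alpha>) = (\<Sum>k=1..n. \<alpha> k)"
  unfolding D_def div_degree_sum by (intro sum.cong refl) (simp add: div_degree_single place_degree_Q)

text \<open>The value forced by \<open>sum_N\<close> at \<alpha> = 0; \<open>genus_eq\<close>
  identifies it as the genus.\<close>

definition g0 :: int where "g0 = 1 - int m - (\<Sum>i<m. N (\<lambda>_. 0) i)"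

text \<open>The \<alpha> enter only at indices k <= n, where coprimality lets
  \<open>sum_div_coprime\<close> pull them out of the floors.\<close>

lemma sum_N: "(\<Sum>i<m. N \<alpha> i + 1) = div_degree \<iota> (D \<alpha>) + 1 - g0"
proof -
  have 1: "(\<Sum>i<m. (ext \<alpha> k + int i * \<mu> k) div int m) =
      ext \<alpha> k + (\<Sum>i<m. (ext (\<lambda>_. 0) k + int i * \<mu> k) div int m)" if "k \<in> {1..r}" for k
  proof (cases "k \<le> n")
    case True
    then have "coprime (int m) (\<mu> k)" using cop that by (simp add: \<mu>_def)
    then show ?thesis using sum_div_coprime[OF m] by (simp add: ext_def)
  qed (simp add: ext_def)
  have "(\<Sum>i<m. N \<alpha> i) = (\<Sum>k=1..r. \<Sum>i<m. (ext \<alpha> k + int i * \<mu> k) div int m)"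
    unfolding N_def by (rule sum.swap)
  also have "\<dots> = (\<Sum>k=1..r. ext \<alpha> k + (\<Sum>i<m. (ext (\<lambda>_. 0) k + int i * \<mu> k) div int m))"
    using 1 by (intro sum.cong) auto
  also have "\<dots> = (\<Sum>k=1..r. ext \<alpha> k) + (\<Sum>i<m. N (\<lambda>_. 0) i)"
    unfolding N_def sum.distrib by (subst (2) sum.swap) (rule refl)
  also have "(\<Sum>k=1..r. ext \<alpha> k) = (\<Sum>k=1..n. \<alpha> k)"
    using nr by (intro sum.mono_neutral_cong_right) (auto simp: ext_def)
  finally show ?thesis by (simp add: sum.distrib degree_D g0_def)
qed

definition D0 :: "int \<Rightarrow> 'f divisor" where "D0 x = Poly_Mapping.single (Q k0) x"

lemma D0_eq: "D0 x = D (\<lambda>k. if k = k0 then x else 0)"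
proof (rule poly_mapping_eqI)
  fix Q' show "Poly_Mapping.lookup (D0 x) Q' = Poly_Mapping.lookup (D (\<lambda>k. if k = k0 then x else 0)) Q'"
  proof (cases "Q' \<in> Q ` {1..n}")
    case True
    then obtain k where k: "k \<in> {1..n}" "Q' = Q k" by blast
    then show ?thesis using lookup_D_Q[OF k(1)] inj_onD[OF Q_inj, of k0 k] k0
      by (auto simp: D0_def lookup_single when_def)
  next
    case False
    then show ?thesis using lookup_D_other[OF False] k0 by (auto simp: D0_def lookup_single when_def)
  qed
qed

text \<open>For large x no \<open>N\<close> is negative, so the truncations in \<open>ell_D\<close>
  disappear and \<open>sum_N\<close> gives \<open>ell\<close> exactly.\<close>

lemma ell_D0: "\<exists>x0\<ge>0. \<forall>x\<ge>x0. fin_spanned (rr (D0 x)) \<and> int (ell \<iota> (D0 x)) = x + 1 - g0"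
proof -
  \<comment> \<open>Bounds every \<open>N\<close> at \<alpha> = 0; a coefficient of at least
    \<open>m * M\<close> at \<open>k0\<close> adds at least \<open>M\<close> to each of
    them.\<close>
  define M where "M = (\<Sum>i<m. \<bar>N (\<lambda>_. 0) i\<bar>)"
  have "fin_spanned (rr (D0 x)) \<and> int (ell \<iota> (D0 x)) = x + 1 - g0" if x: "int m * M \<le> x" for x
  proof -
    let ?\<alpha> = "\<lambda>k. if k = k0 then x else 0"
    have pos: "0 \<le> N ?\<alpha> i" if i: "i < m" for i
    proof -
      have "(ext ?\<alpha> k + int i * \<mu> k) div int m \<ge> (if k = k0 then M else 0) + (ext (\<lambda>_. 0) k + int i * \<mu> k) div int m" for k
      proof (cases "k = k0")
        case True
        have "M + (int i * \<mu> k) div int m = (int m * M + int i * \<mu> k) div int m" using m by simp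
        also have "\<dots> \<le> (x + int i * \<mu> k) div int m" using x m by (intro zdiv_mono1) auto
        finally show ?thesis using True k0 by (simp add: ext_def)
      qed (simp add: ext_def)
      then have "(\<Sum>k=1..r. (if k = k0 then M else 0) + (ext (\<lambda>_. 0) k + int i * \<mu> k) div int m) \<le> N ?\<alpha> i"
        unfolding N_def by (intro sum_mono)
      then have "M + N (\<lambda>_. 0) i \<le> N ?\<alpha> i" using k0 nr by (simp add: sum.distrib N_def)
      moreover have "\<bar>N (\<lambda>_. 0) i\<bar> \<le> M" unfolding M_def using i by (intro member_le_sum) auto
      ultimately show ?thesis by linarith
    qed
    have "int (ell \<iota> (D ?\<alpha>)) = (\<Sum>i<m. N ?\<alpha> i + 1)"
      using ell_D[of ?\<alpha>] pos by (simp add: add_nonneg_pos)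
    also have "\<dots> = x + 1 - g0" using sum_N[of ?\<alpha>] k0 by (simp add: degree_D)
    finally show ?thesis unfolding D0_eq using ell_D by blast
  qed
  moreover have "0 \<le> int m * M" unfolding M_def by (intro mult_nonneg_nonneg sum_nonneg) auto
  ultimately show ?thesis by blast
qed

text \<open>A product of functions from \<open>exists_zero_over_linear_power\<close> for the places
  below. Since \<open>Q k0\<close> is the only place over \<open>a0\<close>, the places of
  \<open>T\<close> lie over other points, where all factors are integral.\<close>

lemma exists_function_with_zeros:
  assumes T: "finite T" "\<And>Q'. Q' \<in> T \<Longrightarrow> place \<iota> Q' \<and> Q' \<noteq> Q k0"
  shows "\<exists>U \<delta>. poly U a0 \<noteq> 0 \<and> degree U \<le> \<delta> \<and>
    (\<forall>Q'\<in>T. 0 < val Q' (pol U / pol ([:- a0, 1:] ^ \<delta>)))"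
  using T
proof (induction T rule: finite_induct)
  case empty
  show ?case by (intro exI[of _ 1] exI[of _ 0]) simp
next
  case (insert Q' T)
  have Q': "place \<iota> Q'" "Q' \<noteq> Q k0" using insert by auto
  obtain U \<delta> where U: "poly U a0 \<noteq> 0" "degree U \<le> \<delta>"
    "\<And>R'. R' \<in> T \<Longrightarrow> 0 < val R' (pol U / pol ([:- a0, 1:] ^ \<delta>))" using insert by blast
  have ne: "contraction R' \<noteq> place_at a0" if "place \<iota> R'" "R' \<noteq> Q k0" for R'
    using Q_unique[OF k0(1)] that k0(2) by auto
  obtain u e where u: "poly u a0 \<noteq> 0" "degree u \<le> e"
    "0 < val (contraction Q') (to_fract u / to_fract ([:- a0, 1:] ^ e))"
    using exists_zero_over_linear_power[OF contraction(1)[OF Q'(1)] ne[OF Q']] by blast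
  define s where "s v d = to_fract v / to_fract ([:- a0, 1:] ^ d)" for v :: "'a poly" and d
  have s0: "s v d \<noteq> 0" if "poly v a0 \<noteq> 0" for v d using that by (auto simp: s_def)
  have nonneg: "0 \<le> val R' (\<phi> (s v d))" if "poly v a0 \<noteq> 0" "degree v \<le> d" "place \<iota> R'" "R' \<noteq> Q k0" for v d R'
  proof -
    have "0 \<le> val (contraction R') (s v d)"
      using vge_over_linear_power[OF contraction(1)[OF that(3)] ne[OF that(3,4)] that(2)] s0[OF that(1)]
      unfolding s_def vge_def by blast
    then show ?thesis using ramification(2)[OF that(3) s0[OF that(1)]] by simp
  qed
  have prod_eq: "pol (U * u) / pol ([:- a0, 1:] ^ (\<delta> + e)) = \<phi> (s U \<delta>) * \<phi> (s u e)"
    by (simp add: s_def power_add)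
  have sU: "\<phi> (s U \<delta>) \<noteq> 0" "\<phi> (s u e) \<noteq> 0" using s0 U u by auto
  have "0 < val R' (pol (U * u) / pol ([:- a0, 1:] ^ (\<delta> + e)))" if R': "R' \<in> insert Q' T" for R'
  proof -
    have R: "place \<iota> R'" "R' \<noteq> Q k0" using insert.prems R' by auto
    interpret dplace R' using place_discrete[OF R(1)] by unfold_locales
    have sum: "val R' (pol (U * u) / pol ([:- a0, 1:] ^ (\<delta> + e))) = val R' (\<phi> (s U \<delta>)) + val R' (\<phi> (s u e))"
      unfolding prod_eq using sU by (rule val_mult)
    have "0 < val (contraction Q') (s u e)" using u(3) by (simp only: s_def)
    then have "0 < val R' (\<phi> (s u e))" if "R' = Q'"
      unfolding that ramification(2)[OF Q'(1) s0[OF u(1)]] using ramification(1)[OF Q'(1)] by simp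
    moreover have "0 < val R' (\<phi> (s U \<delta>))" if "R' \<in> T" using U(3)[OF that] by (simp add: s_def)
    ultimately show ?thesis unfolding sum using nonneg[OF u(1,2) R] nonneg[OF U(1,2) R] R' by fastforce
  qed
  moreover have "degree (U * u) \<le> \<delta> + e" using U u degree_mult_le[of U u] by linarith
  ultimately show ?case using U u by (intro exI[of _ "U * u"] exI[of _ "\<delta> + e"]) auto
qed

text \<open>Enlarge \<open>B\<close> to a multiple of \<open>Q k0\<close> plus a multiple of the zero divisor of a rational function
  with its only pole at \<open>Q k0\<close>; division by a power of this function then moves all of \<open>B\<close> to \<open>Q k0\<close>.\<close>

lemma riemann_inequality:
  assumes B: "is_divisor \<iota> B"
  shows "div_degree \<iota> B - int (ell \<iota> B) + 1 \<le> g0"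
proof -
  let ?l = "[:- a0, 1:]"
  define T where "T = Poly_Mapping.keys B - {Q k0}"
  have T: "finite T" "\<And>Q'. Q' \<in> T \<Longrightarrow> place \<iota> Q' \<and> Q' \<noteq> Q k0" using B by (auto simp: T_def is_divisor_def)
  obtain U \<delta> where U: "poly U a0 \<noteq> 0" "degree U \<le> \<delta>"
    "\<And>Q'. Q' \<in> T \<Longrightarrow> 0 < val Q' (pol U / pol (?l ^ \<delta>))" using exists_function_with_zeros[OF T] by blast
  define t where "t = pol U / pol (?l ^ \<delta>)"
  have U0: "U \<noteq> 0" using U by auto
  have l0: "?l ^ \<delta> \<noteq> 0" by simp
  have t0: "t \<noteq> 0" using U0 by (simp add: t_def)
  have t_eq: "t = \<phi> (to_fract U / to_fract (?l ^ \<delta>))" by (simp add: t_def)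
  have dl: "degree (?l ^ \<delta>) \<le> \<delta>" by (simp add: degree_power_eq)
  define Z where "Z = {Q'. place \<iota> Q' \<and> 0 < val Q' t}"
  have Zfin: "finite Z" unfolding Z_def by (rule finite_zeros[OF U(2) dl l0 t_def t0])
  have Zdeg: "(\<Sum>Q'\<in>Z. val Q' t * int (place_degree \<iota> Q')) \<le> int (m * \<delta>)"
    by (rule degree_of_zeros_le[OF U(2) dl l0 t_def t0 Zfin]) (auto simp: Z_def)
  have TZ: "T \<subseteq> Z" using U(3) T by (auto simp: Z_def t_def)
  interpret q0: dplace "Q k0" using place_discrete[OF Q(1)[OF k0(1)]] by unfold_locales
  \<comment> \<open>The pole at \<open>a0\<close> has order \<delta> because \<open>U\<close> does
    not vanish there, and total ramification multiplies it by \<open>m\<close>. This matches the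
    bound in \<open>Zdeg\<close>.\<close>
  have vt0: "val (Q k0) t = - int (m * \<delta>)"
  proof -
    interpret p0: dplace "place_at a0" using place_poly(3)[OF prime_elem_linear] by unfold_locales
    have "val (place_at a0) (to_fract U) = 0"
      using val_place_poly_unit[OF prime_elem_linear] U(1) by (simp add: poly_eq_0_iff_dvd)
    moreover have "val (place_at a0) (to_fract (?l ^ \<delta>)) = int \<delta>"
      using val_place_poly_self[OF prime_elem_linear, of a0] by (simp add: to_fract_power p0.val_power)
    ultimately have "val (place_at a0) (to_fract U / to_fract (?l ^ \<delta>)) = - int \<delta>"
      using U0 l0 by (simp add: p0.val_divide)
    then show ?thesis unfolding t_eq using val_phi_Q[OF k0(1), of "to_fract U / to_fract (?l ^ \<delta>)"] U0 k0(2) by simp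
  qed
  have "\<not> 0 < val (Q k0) t" unfolding vt0 by (simp only: neg_0_less_iff_less of_nat_less_0_iff not_False_eq_True)
  then have k0Z: "Q k0 \<notin> Z" unfolding Z_def by blast
  have vt_other: "val Q' t = 0" if "place \<iota> Q'" "Q' \<noteq> Q k0" "Q' \<notin> Z" for Q'
  proof -
    have ne: "contraction Q' \<noteq> place_at a0" using Q_unique[OF k0(1)] that k0(2) by auto
    let ?s = "to_fract U / to_fract (?l ^ \<delta>)"
    have s0: "?s \<noteq> 0" using U0 by simp
    have "0 \<le> val (contraction Q') ?s"
      using vge_over_linear_power[OF contraction(1)[OF that(1)] ne U(2)] s0 unfolding vge_def by blast
    then have "0 \<le> val Q' t" unfolding t_eq using ramification(2)[OF that(1) s0] by simp
    then show ?thesis using that by (auto simp: Z_def)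
  qed
  obtain x0 where x0: "0 \<le> x0"
    "\<And>x. x0 \<le> x \<Longrightarrow> fin_spanned (rr (D0 x)) \<and> int (ell \<iota> (D0 x)) = x + 1 - g0" using ell_D0 by blast
  \<comment> \<open>Each zero of \<open>t\<close> on \<open>T\<close> has order at least 1, so
    \<open>M\<close> times the zero divisor dominates \<open>B\<close> there; \<open>x\<close> does
    the same at \<open>Q k0\<close>.\<close>
  define M where "M = nat (\<Sum>Q'\<in>T. \<bar>Poly_Mapping.lookup B Q'\<bar>)"
  define x where "x = max x0 \<bar>Poly_Mapping.lookup B (Q k0)\<bar>"
  define B2 where "B2 = (\<Sum>Q'\<in>Z. Poly_Mapping.single Q' (int M * val Q' t)) + D0 x"
  have look: "Poly_Mapping.lookup B2 Q' = (if Q' \<in> Z then int M * val Q' t else 0) + (if Q' = Q k0 then x else 0)" for Q'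
    using Zfin by (auto simp: B2_def D0_def lookup_add lookup_sum lookup_single when_def)
  have le: "Poly_Mapping.lookup B Q' \<le> Poly_Mapping.lookup B2 Q'" for Q'
  proof (cases "Q' \<in> T")
    case True
    then have "\<bar>Poly_Mapping.lookup B Q'\<bar> \<le> (\<Sum>Q'\<in>T. \<bar>Poly_Mapping.lookup B Q'\<bar>)" using T by (intro member_le_sum) auto
    then have "\<bar>Poly_Mapping.lookup B Q'\<bar> \<le> int M * 1" by (simp add: M_def)
    also have "\<dots> \<le> int M * val Q' t" using True TZ by (intro mult_left_mono) (auto simp: Z_def)
    finally show ?thesis using True TZ T(2) by (auto simp: look)
  next
    case False
    have "0 \<le> Poly_Mapping.lookup B2 Q'" using x0(1) unfolding look by (auto simp: Z_def x_def)
    moreover have "Poly_Mapping.lookup B Q' = 0 \<or> Q' = Q k0" using False by (auto simp: T_def in_keys_iff)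
    moreover have "Poly_Mapping.lookup B (Q k0) \<le> Poly_Mapping.lookup B2 (Q k0)" using k0Z by (simp add: look x_def)
    ultimately show ?thesis by auto
  qed
  have B2: "is_divisor \<iota> B2"
    unfolding is_divisor_def using Q(1)[OF k0(1)] by (auto simp: in_keys_iff look Z_def split: if_splits)
  \<comment> \<open>Multiplication by \<open>t ^ M\<close> identifies \<open>rr B2\<close> with
    \<open>rr (D0 y)\<close>, and \<open>Zdeg\<close> bounds the degree of \<open>B2\<close> by
    \<open>y\<close>, the degree of \<open>D0 y\<close>.\<close>
  define y where "y = x + int M * int (m * \<delta>)"
  have scaled: "w \<in> rr B2 \<longleftrightarrow> t ^ M * w \<in> rr (D0 y)" for w
  proof -
    have "vge Q' w (- Poly_Mapping.lookup B2 Q') \<longleftrightarrow> vge Q' (t ^ M * w) (- Poly_Mapping.lookup (D0 y) Q')"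
      if Q': "place \<iota> Q'" for Q'
    proof -
      interpret dplace Q' using place_discrete[OF Q'] by unfold_locales
      have "vge Q' (t ^ M * w) (- Poly_Mapping.lookup (D0 y) Q') \<longleftrightarrow>
          vge Q' w (- Poly_Mapping.lookup (D0 y) Q' - int M * val Q' t)"
        using t0 by (subst vge_mult_iff) (auto simp: val_power)
      moreover have "- Poly_Mapping.lookup (D0 y) Q' - int M * val Q' t = - Poly_Mapping.lookup B2 Q'"
        using vt0 k0Z vt_other[OF Q'] by (auto simp: look D0_def lookup_single when_def y_def)
      ultimately show ?thesis by simp
    qed
    then show ?thesis unfolding mem_rr by blast
  qed
  have y: "fin_spanned (rr (D0 y))" "int (ell \<iota> (D0 y)) = y + 1 - g0"
  proof -
    have "x0 \<le> x" "0 \<le> int M * int (m * \<delta>)" by (simp_all add: x_def)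
    then have "x0 \<le> y" unfolding y_def by linarith
    then show "fin_spanned (rr (D0 y))" "int (ell \<iota> (D0 y)) = y + 1 - g0" using x0(2) by auto
  qed
  have tM: "t ^ M \<noteq> 0" using t0 by simp
  have im: "(*) (t ^ M) ` rr B2 = rr (D0 y)"
  proof (intro equalityI subsetI)
    fix w assume w: "w \<in> rr (D0 y)"
    have "w = t ^ M * (w / t ^ M)" using tM by simp
    moreover have "w / t ^ M \<in> rr B2" unfolding scaled using w tM by simp
    ultimately show "w \<in> (*) (t ^ M) ` rr B2" by blast
  qed (use scaled in blast)
  have im': "rr B2 = (*) (inverse (t ^ M)) ` rr (D0 y)"
  proof -
    have "inverse (t ^ M) * (t ^ M * x) = x" for x
      using tM by (metis left_inverse mult.assoc mult_1)
    then show ?thesis unfolding im[symmetric] image_image by (simp only: image_ident)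
  qed
  have fin2: "fin_spanned (rr B2)" using fin_spanned_scaled[OF y(1)] unfolding im' by blast
  have ell2: "ell \<iota> (D0 y) \<le> ell \<iota> B2"
    using fin_spanned_scaled[OF fin2, of "t ^ M"] unfolding im ell_eq_dim by blast
  have "rr B \<subseteq> rr B2"
  proof
    fix w assume w: "w \<in> rr B"
    show "w \<in> rr B2" unfolding mem_rr
    proof (intro allI impI)
      fix Q' assume "place \<iota> Q'"
      then have "vge Q' w (- Poly_Mapping.lookup B Q')" using w unfolding mem_rr by blast
      then show "vge Q' w (- Poly_Mapping.lookup B2 Q')" using le[of Q'] by (auto simp: vge_def)
    qed
  qed
  then have "fin_spanned (rr B)" by (rule fin_spanned_mono[OF fin2])
  then have "div_degree \<iota> B - int (ell \<iota> B) \<le> div_degree \<iota> B2 - int (ell \<iota> B2)"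
    by (rule degree_minus_ell_mono[OF B B2 _ le])
  moreover have "div_degree \<iota> B2 \<le> int M * int (m * \<delta>) + x"
  proof -
    have "div_degree \<iota> B2 = (\<Sum>Q'\<in>Z. int M * val Q' t * int (place_degree \<iota> Q')) + x"
      unfolding B2_def D0_def div_degree_add div_degree_sum div_degree_single by (simp add: place_degree_Q[OF k0(1)])
    also have "(\<Sum>Q'\<in>Z. int M * val Q' t * int (place_degree \<iota> Q')) = int M * (\<Sum>Q'\<in>Z. val Q' t * int (place_degree \<iota> Q'))"
      by (simp add: sum_distrib_left mult.assoc)
    also have "\<dots> \<le> int M * int (m * \<delta>)" using Zdeg by (intro mult_left_mono) auto
    finally show ?thesis by simp
  qed
  moreover have "y + 1 - g0 \<le> int (ell \<iota> B2)" using y(2) ell2 by linarith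
  ultimately show ?thesis unfolding y_def by linarith
qed

lemma genus_eq: "genus \<iota> = g0"
  unfolding genus_def
proof (rule Greatest_equality)
  obtain x0 where "int (ell \<iota> (D0 x0)) = x0 + 1 - g0" using ell_D0 by blast
  moreover have "div_degree \<iota> (D0 x0) = x0"
    by (simp add: D0_def div_degree_single place_degree_Q[OF k0(1)])
  moreover have "is_divisor \<iota> (D0 x0)" unfolding D0_eq by (rule D_divisor)
  ultimately show "\<exists>A. is_divisor \<iota> A \<and> g0 = div_degree \<iota> A - int (ell \<iota> A) + 1"
    by (intro exI[of _ "D0 x0"]) simp
next
  fix y assume "\<exists>A. is_divisor \<iota> A \<and> y = div_degree \<iota> A - int (ell \<iota> A) + 1"
  then show "y \<le> g0" using riemann_inequality by blast
qed

text \<open>In degree g - 1 non-speciality means \<open>ell\<close> = 0, that is, every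
  \<open>N \<alpha> i + 1\<close> is at most 0; as these numbers sum to deg + 1 - g = 0, they all
  vanish.\<close>

lemma non_special_iff:
  "non_special \<iota> (D \<alpha>) \<and> div_degree \<iota> (D \<alpha>) = genus \<iota> - 1 \<longleftrightarrow> (\<forall>i<m. N \<alpha> i = -1)"
proof
  assume L: "non_special \<iota> (D \<alpha>) \<and> div_degree \<iota> (D \<alpha>) = genus \<iota> - 1"
  then have "ell \<iota> (D \<alpha>) = 0" by (simp add: non_special_def)
  then have le: "N \<alpha> i + 1 \<le> 0" if "i < m" for i using ell_D[of \<alpha>] that by simp
  have "(\<Sum>i<m. N \<alpha> i + 1) = 0" using sum_N[of \<alpha>] L genus_eq by simp
  then have "(\<Sum>i<m. - (N \<alpha> i + 1)) = 0" unfolding sum_negf by simp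
  moreover have "0 \<le> - (N \<alpha> i + 1)" if "i \<in> {..<m}" for i using le[of i] that by simp
  ultimately have "\<forall>i\<in>{..<m}. - (N \<alpha> i + 1) = 0"
    using sum_nonneg_eq_0_iff[of "{..<m}" "\<lambda>i. - (N \<alpha> i + 1)"] by blast
  then show "\<forall>i<m. N \<alpha> i = -1" by force
next
  assume R: "\<forall>i<m. N \<alpha> i = -1"
  then have "ell \<iota> (D \<alpha>) = 0" using ell_D[of \<alpha>] by simp
  moreover have "div_degree \<iota> (D \<alpha>) + 1 - g0 = 0" using sum_N[of \<alpha>] R by simp
  ultimately show "non_special \<iota> (D \<alpha>) \<and> div_degree \<iota> (D \<alpha>) = genus \<iota> - 1"
    unfolding non_special_def genus_eq by simp
qed

end

section \<open>Kummer function fields\<close>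

context linear_space begin

lemma dependent_family:
  assumes B: "finite B" "card B < n" and b: "\<And>i. i < n \<Longrightarrow> b i \<in> V.span B"
  shows "\<exists>c. (\<Sum>i<n. scale (c i) (b i)) = 0 \<and> (\<exists>i<n. c i \<noteq> 0)"
proof (rule ccontr)
  assume n: "\<not> ?thesis"
  have "fin_spanned (range (\<lambda>u. \<Sum>j<n. scale (u j) (b j))) \<and>
      V.dim (range (\<lambda>u. \<Sum>j<n. scale (u j) (b j))) = card {..<n}"
    using n by (intro dim_family) auto
  moreover have "range (\<lambda>u. \<Sum>j<n. scale (u j) (b j)) \<subseteq> V.span B"
    using b by (auto intro!: V.span_sum V.span_scale)
  then have "V.dim (range (\<lambda>u. \<Sum>j<n. scale (u j) (b j))) \<le> card B" using B by (intro V.dim_le_card)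
  ultimately show False using B by simp
qed

end

context field_homo begin

lemma ev_reduce:
  assumes y: "y ^ m = h a" and m: "0 < m"
  shows "\<exists>c. ev y g = (\<Sum>i<m. h (c i) * y ^ i)"
proof -
  define M where "M = monom 1 m - [:a:]"
  have dM: "degree M = m" unfolding M_def by (rule degree_monom_minus_const[OF m])
  then have M0: "M \<noteq> 0" using m by auto
  have "ev y M = 0" by (simp add: M_def ev_diff ev_monom y)
  then have "ev y (g div M * M + g mod M) = ev y (g mod M)" by (simp only: ev_add ev_mult) simp
  moreover have "degree (g mod M) < m" using degree_mod_less'[of M g] M0 dM m by (cases "g mod M = 0") auto
  ultimately have "ev y g = (\<Sum>i<m. h (coeff (g mod M) i) * y ^ i)" using ev_low_degree by simp
  then show ?thesis by (rule exI[of _ "coeff (g mod M)"])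
qed

text \<open>Irreducibility of X^m - a is not assumed. Inverses come from the linear dependence of 1,
  z, ..., z^m: a relation divided by its lowest term expresses 1 / z as a polynomial in z.\<close>

lemma subfield_range_ev:
  assumes y: "y ^ m = h a" and m: "0 < m"
  shows "is_subfield (range (ev y))"
proof -
  interpret L: linear_space "\<lambda>a z. h a * z" by unfold_locales (simp_all add: algebra_simps)
  have "is_subring (range (ev y))" unfolding is_subring_def
  proof (intro conjI ballI)
    show "1 \<in> range (ev y)" using ev_1[of y] by (metis rangeI)
    fix u v assume "u \<in> range (ev y)" "v \<in> range (ev y)"
    then obtain f g where "u = ev y f" "v = ev y g" by blast
    then show "u - v \<in> range (ev y)" "u * v \<in> range (ev y)"
      by (auto simp flip: ev_diff ev_mult)
  qed
  moreover have "inverse z \<in> range (ev y)" if "z \<in> range (ev y)" for z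
  proof (cases "z = 0")
    case False
    obtain g where g: "z = ev y g" using \<open>z \<in> range (ev y)\<close> by blast
    have pw: "ev y (g ^ i) = z ^ i" for i by (induction i) (simp_all add: ev_1 ev_mult g)
    let ?B = "(\<lambda>i. y ^ i) ` {..<m}"
    have "\<exists>c. (\<Sum>i<Suc m. h (c i) * z ^ i) = 0 \<and> (\<exists>i<Suc m. c i \<noteq> 0)"
    proof (rule L.dependent_family[of ?B])
      show "card ?B < Suc m" using card_image_le[of "{..<m}" "\<lambda>i. y ^ i"] by simp
      fix i
      obtain c where c: "z ^ i = (\<Sum>j<m. h (c j) * y ^ j)" using ev_reduce[OF y m, of "g ^ i"] unfolding pw by blast
      show "z ^ i \<in> L.V.span ?B" unfolding c
        by (rule L.V.span_sum, rule L.V.span_scale, rule L.V.span_base) auto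
    qed simp
    then obtain c where c: "(\<Sum>i<Suc m. h (c i) * z ^ i) = 0" "\<exists>i. i < Suc m \<and> c i \<noteq> 0" by blast
    define k where "k = (LEAST i. i < Suc m \<and> c i \<noteq> 0)"
    have k: "k < Suc m" "c k \<noteq> 0" using LeastI_ex[OF c(2)] by (simp_all add: k_def)
    have small: "c i = 0" if "i < k" for i
      using not_less_Least[of i "\<lambda>i. i < Suc m \<and> c i \<noteq> 0"] that k(1) by (auto simp: k_def)
    define w where "w = (\<Sum>i\<in>{Suc k..<Suc m}. h (c i) * z ^ (i - Suc k))"
    have "(\<Sum>i<Suc m. h (c i) * z ^ i) = (\<Sum>i\<in>{k..<Suc m}. h (c i) * z ^ i)"
      by (rule sum.mono_neutral_right) (auto simp: small)
    also have "\<dots> = h (c k) * z ^ k + (\<Sum>i\<in>{Suc k..<Suc m}. h (c i) * z ^ i)"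
      using k(1) by (simp add: sum.atLeast_Suc_lessThan del: sum.lessThan_Suc sum.op_ivl_Suc)
    also have "(\<Sum>i\<in>{Suc k..<Suc m}. h (c i) * z ^ i) = z ^ Suc k * w"
      unfolding w_def sum_distrib_left
    proof (intro sum.cong refl)
      fix i assume "i \<in> {Suc k..<Suc m}"
      then have "Suc k + (i - Suc k) = i" by simp
      then have "z ^ i = z ^ Suc k * z ^ (i - Suc k)" by (metis power_add)
      then show "h (c i) * z ^ i = z ^ Suc k * (h (c i) * z ^ (i - Suc k))" by (simp only: mult_ac)
    qed
    finally have "z ^ k * (h (c k) + z * w) = 0" using c(1) by (simp add: algebra_simps)
    then have "h (c k) + z * w = 0" using False by simp
    then have zw: "z * w = - h (c k)" by (simp add: eq_neg_iff_add_eq_0 add.commute)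
    have "z * (- w / h (c k)) = - (z * w) / h (c k)" by simp
    then have "z * (- w / h (c k)) = 1" unfolding zw using k by simp
    then have "inverse z = - w / h (c k)" by (rule inverse_unique)
    moreover have "w = ev y (\<Sum>i\<in>{Suc k..<Suc m}. smult (c i) (g ^ (i - Suc k)))"
      by (simp only: w_def ev_sum ev_smult pw)
    ultimately have "inverse z = ev y (smult (- inverse (c k)) (\<Sum>i\<in>{Suc k..<Suc m}. smult (c i) (g ^ (i - Suc k))))"
      by (simp only: ev_smult uminus inverse) (simp add: divide_inverse mult.commute)
    then show ?thesis by blast
  next
    case True
    then show ?thesis using ev_0[of y] by (metis inverse_zero rangeI)
  qed
  ultimately show ?thesis unfolding is_subfield_def by blast
qed

end

text \<open>The polynomials in 1 / y form a subfield, so they include \<open>y\<close> and are all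
  of F by generation.\<close>

lemma kummer_ff:
  fixes f :: "'a::{field,finite} poly" and \<phi> :: "'a poly fract \<Rightarrow> 'f::field"
  assumes m: "0 < m" and f: "f \<noteq> 0" and K: "kummer_function_field m f \<phi> y"
  shows "ff \<phi> (inverse y) m (inverse (to_fract f))"
proof -
  have hom: "field_hom \<phi>" and y: "y ^ m = \<phi> (to_fract f)"
    and gen: "\<And>S. is_subfield S \<Longrightarrow> range \<phi> \<subseteq> S \<Longrightarrow> y \<in> S \<Longrightarrow> S = UNIV"
    using K by (auto simp: kummer_function_field_def)
  interpret phi: field_homo \<phi> by unfold_locales (rule hom)
  have Ym: "inverse y ^ m = \<phi> (inverse (to_fract f))" using y by (simp add: power_inverse)
  have sf: "is_subfield (range (phi.ev (inverse y)))" by (rule phi.subfield_range_ev[OF Ym m])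
  have "\<phi> a \<in> range (phi.ev (inverse y))" for a using phi.ev_const[of "inverse y" a] by (metis rangeI)
  moreover have "inverse y \<in> range (phi.ev (inverse y))"
    by (rule range_eqI[of _ _ "[:0, 1:]"]) (simp add: phi.ev_pCons)
  then have "inverse (inverse y) \<in> range (phi.ev (inverse y))" using sf unfolding is_subfield_def by blast
  ultimately have "range (phi.ev (inverse y)) = UNIV" using sf by (intro gen) auto
  then have "\<exists>c. z = (\<Sum>i<m. \<phi> (c i) * inverse y ^ i)" for z
    using phi.ev_reduce[OF Ym m] by (metis UNIV_I rangeE)
  then show ?thesis using hom m Ym f by unfold_locales auto
qed

text \<open>One totally ramified place already yields [F : K] = m and independence of the powers of
  1 / y; two of them ensure that one lies over a finite point.\<close>

lemma kummer_curve_if_totally_ramified: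
  fixes f :: "'a::{field,finite} poly" and \<phi> :: "'a poly fract \<Rightarrow> 'f::field"
  assumes m: "2 \<le> m" "\<not> CHAR('a) dvd m" and f: "2 \<le> degree f"
    and roots: "\<forall>z :: 'a alg_closure. poly (map_poly to_ac f) z = 0 \<longrightarrow> z \<in> range to_ac"
    and np: "\<forall>d. d dvd m \<and> d \<ge> 2 \<longrightarrow> \<not> (\<exists>h :: 'a poly fract. to_fract f = h ^ d)"
    and K: "kummer_function_field m f \<phi> y"
    and P: "bij_betw P {1..r} {p. zero_or_pole f p}" and n: "n \<le> r" "2 \<le> n"
    and Q: "\<forall>k\<in>{1..n}. totally_ramified rat_const \<phi> (P k) \<and> lies_over rat_const \<phi> (Q k) (P k)"
  shows "\<exists>k0 a0. kummer_curve \<phi> (inverse y) m (inverse (to_fract f)) {a. poly f a = 0} P Q n r k0 a0"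
proof -
  have m0: "0 < m" using m by simp
  have fn0: "f \<noteq> 0" using f by auto
  interpret ff \<phi> "inverse y" m "inverse (to_fract f)" by (rule kummer_ff[OF m0 fn0 K])
  let ?f = "inverse (to_fract f)"
  have char: "of_nat m \<noteq> (0 :: 'a)" using assms(2) by (simp add: of_nat_eq_0_iff_char_dvd)
  have np': "\<not> (\<exists>h. ?f = h ^ d)" if "d dvd m" "2 \<le> d" for d
  proof
    assume "\<exists>h. ?f = h ^ d"
    then obtain h where "?f = h ^ d" by blast
    then have "to_fract f = inverse h ^ d" by (metis inverse_inverse_eq power_inverse)
    then show False using np that by blast
  qed
  have ZP: "{p. zero_or_pole f p} = insert place_inf (place_at ` {a. poly f a = 0})"
    using zero_or_pole_iff[OF _ roots] f by auto
  have over: "place \<iota> (Q k)" "contraction (Q k) = P k" if "k \<in> {1..n}" for k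
    using Q that lies_over_iff by auto
  have tot: "(\<forall>Q'. lies_over rat_const \<phi> Q' (P k) \<longleftrightarrow> Q' = Q k) \<and> ramification_index \<phi> (Q k) (P k) = ext_degree \<phi>"
    if k: "k \<in> {1..n}" for k
  proof -
    obtain Q0 where Q0: "\<forall>Q'. lies_over rat_const \<phi> Q' (P k) \<longleftrightarrow> Q' = Q0"
      "ramification_index \<phi> Q0 (P k) = ext_degree \<phi>" using Q k unfolding totally_ramified_def by blast
    then have "Q0 = Q k" using Q k by blast
    then show ?thesis using Q0 by simp
  qed
  have tr: "coprime (int m) (val (P k) ?f)" "ramification_index \<phi> (Q k) (P k) = m" if k: "k \<in> {1..n}" for k
    using totally_ramified_coprime[OF over(1)[OF k] _ char np'] tot[OF k] over(2)[OF k] by simp_all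
  have "P 1 \<noteq> P 2" using P n by (auto simp: bij_betw_def dest: inj_onD)
  moreover have "P k \<in> insert place_inf (place_at ` {a. poly f a = 0})" if "k \<in> {1..r}" for k
    using P that unfolding ZP bij_betw_def by blast
  then have "P 1 \<in> insert place_inf (place_at ` {a. poly f a = 0})" "P 2 \<in> insert place_inf (place_at ` {a. poly f a = 0})"
    using n by auto
  ultimately have "\<exists>k0\<in>{1, 2}. \<exists>a0. P k0 = place_at a0" by auto
  then obtain k0 a0 where "k0 \<in> {1, 2}" and Pk0: "P k0 = place_at a0" by blast
  then have "k0 \<in> {1..n}" using n by auto
  note k0 = this Pk0
  have 1: "1 \<in> {1..n}" using n by simp
  have Q1: "inj_on (\<lambda>i. val (Q 1) (inverse y ^ i) mod int (ramification_index \<phi> (Q 1) (contraction (Q 1)))) {..<m}"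
    by (rule inj_on_val_powers[OF over(1)[OF 1]]) (simp_all only: over(2)[OF 1] tr[OF 1])
  have uniq: "c i = 0" if "(\<Sum>i<m. \<phi> (c i) * inverse y ^ i) = 0" "i < m" for c i
  proof (rule ccontr)
    assume "c i \<noteq> 0"
    then have ex: "\<exists>i\<in>{..<m}. c i \<noteq> 0" using that by blast
    show False using sum_distinct_residues(1)[OF over(1)[OF 1] _ _ Q1 ex] Y0 that(1) by simp
  qed
  have "kummer_curve \<phi> (inverse y) m ?f {a. poly f a = 0} P Q n r k0 a0"
  proof unfold_locales
    show "bij_betw P {1..r} (insert place_inf (place_at ` {a. poly f a = 0}))" using P unfolding ZP .
    show "finite {a. poly f a = 0}" by (rule poly_roots_finite[OF fn0])
    fix p :: "'a poly fract set" assume p: "place rat_const p" "p \<notin> insert place_inf (place_at ` {a. poly f a = 0})"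
    interpret dplace p using rat_discrete[OF p(1)] by unfold_locales
    have "\<not> zero_or_pole f p" using p(2) ZP by blast
    then show "val p ?f = 0" using p(1) fn0 by (simp add: zero_or_pole_def val_inverse)
  next
    fix k Q' assume k: "k \<in> {1..n}" and Q': "place \<iota> Q'" "contraction Q' = P k"
    then show "Q' = Q k" using tot[OF k] lies_over_iff by metis
  qed (use char uniq n over tr k0 in auto)
  then show ?thesis by blast
qed

section \<open>Passage from degrees to the numerical conditions\<close>

lemma condition_zero:
  fixes \<alpha> :: "nat \<Rightarrow> int"
  assumes "n \<le> r"
  shows "(\<Sum>k=1..r. (if k \<le> n then \<alpha> k else 0) div int m) = (\<Sum>k=1..n. \<lfloor>real_of_int (\<alpha> k) / real m\<rfloor>)"
proof -
  have "\<lfloor>real_of_int a / real m\<rfloor> = a div int m" for a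
    using floor_divide_of_int_eq[of a "int m", where 'a = real] by simp
  moreover have "(\<Sum>k=1..r. (if k \<le> n then \<alpha> k else 0) div int m) = (\<Sum>k=1..n. \<alpha> k div int m)"
    using assms by (intro sum.mono_neutral_cong_right) auto
  ultimately show ?thesis by simp
qed

text \<open>Subtracting \<open>tk m l k i\<close> instead of i l_k adds the floor of i l_k / m to
  each term. For k <= n this quotient is not an integer, so its ceiling is one larger, which
  accounts for the summand n; for k > n the ceilings in \<open>beta\<close> are the negated floors
  on the left.\<close>

lemma condition_positive:
  fixes l \<alpha> :: "nat \<Rightarrow> int"
  assumes m: "0 < m" and n: "n \<le> r" and cop: "\<And>k. k \<in> {1..n} \<Longrightarrow> coprime (int m) (l k)"
    and i: "0 < i" "i < m"
  shows "(\<Sum>k=1..r. ((if k \<le> n then \<alpha> k else 0) + int i * - l k) div int m) = -1 \<longleftrightarrow>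
    int n + (\<Sum>k=1..n. \<lfloor>real_of_int (\<alpha> k - tk m l k i) / real m\<rfloor>) = beta m r l i"
proof -
  have fl: "\<lfloor>real_of_int a / real m\<rfloor> = a div int m" for a
    using floor_divide_of_int_eq[of a "int m", where 'a = real] by simp
  have cl: "\<lceil>real_of_int a / real m\<rceil> = - (- a div int m)" for a
    unfolding ceiling_def using fl[of "- a"] by simp
  have split: "sum g {1..r} = sum g {1..n} + sum g {n+1..r}" for g :: "nat \<Rightarrow> int"
  proof -
    have "{1..r} = {1..n} \<union> {n+1..r}" using n by auto
    then show ?thesis by (simp only:) (rule sum.union_disjoint, auto)
  qed
  define x where "x k = int i * l k" for k
  have t: "(\<alpha> k - tk m l k i) div int m = (\<alpha> k - x k) div int m + x k div int m" for k
  proof -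
    have e: "\<alpha> k - tk m l k i = (\<alpha> k - x k) + int m * (x k div int m)"
      by (simp add: tk_def x_def minus_mod_eq_mult_div[symmetric])
    show ?thesis unfolding e using m by simp
  qed
  have c: "- (- x k div int m) = x k div int m + 1" if k: "k \<in> {1..n}" for k
  proof -
    have "\<not> int m dvd x k"
    proof
      assume "int m dvd x k"
      then have "int m dvd int i" using cop[OF k] by (simp add: x_def coprime_dvd_mult_left_iff)
      then show False using i by (auto dest: zdvd_imp_le)
    qed
    then have "x k mod int m \<noteq> 0" by (simp add: dvd_eq_mod_eq_0)
    then show ?thesis using zdiv_zminus1_eq_if[of "int m" "x k"] m by simp
  qed
  have A: "(\<Sum>k=1..r. ((if k \<le> n then \<alpha> k else 0) + int i * - l k) div int m) =
      (\<Sum>k=1..n. (\<alpha> k - x k) div int m) + (\<Sum>k=n+1..r. - x k div int m)"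
    unfolding split by (intro arg_cong2[of _ _ _ _ "(+)"] sum.cong refl) (auto simp: x_def)
  have "beta m r l i = (\<Sum>k=1..r. - (- x k div int m)) - 1" unfolding beta_def cl x_def ..
  also have "\<dots> = (\<Sum>k=1..n. x k div int m + 1) + (\<Sum>k=n+1..r. - (- x k div int m)) - 1"
    unfolding split using c by (intro arg_cong2[of _ _ _ _ "(-)"] arg_cong2[of _ _ _ _ "(+)"] sum.cong) auto
  also have "\<dots> = (\<Sum>k=1..n. x k div int m) + int n - (\<Sum>k=n+1..r. - x k div int m) - 1"
    by (simp add: sum.distrib sum_negf)
  finally have B: "beta m r l i = (\<Sum>k=1..n. x k div int m) + int n - (\<Sum>k=n+1..r. - x k div int m) - 1" .
  have C: "(\<Sum>k=1..n. \<lfloor>real_of_int (\<alpha> k - tk m l k i) / real m\<rfloor>) =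
      (\<Sum>k=1..n. (\<alpha> k - x k) div int m) + (\<Sum>k=1..n. x k div int m)"
    unfolding fl t sum.distrib ..
  show ?thesis unfolding A B C by linarith
qed

theorem theorem3p2:
  fixes f :: "'a::{field,finite} poly"
    and \<phi> :: "'a poly fract \<Rightarrow> 'f::field"
    and y :: 'f
    and m n r :: nat
    and P :: "nat \<Rightarrow> 'a poly fract set"
    and Q :: "nat \<Rightarrow> 'f set"
    and \<alpha>' :: "nat \<Rightarrow> int"
    and \<iota> :: "'a \<Rightarrow> 'f"
    and D :: "'f divisor"
    and t :: "nat \<Rightarrow> nat \<Rightarrow> int"
    and \<beta> :: "nat \<Rightarrow> int"
  assumes "m \<ge> 2" and "\<not> CHAR('a) dvd m"
    and "degree f \<ge> 2"
    and "\<forall>z :: 'a alg_closure. poly (map_poly to_ac f) z = 0 \<longrightarrow> z \<in> range to_ac"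
    and "\<forall>d. d dvd m \<and> d \<ge> 2 \<longrightarrow> \<not> (\<exists>h :: 'a poly fract. to_fract f = h ^ d)"
    and "kummer_function_field m f \<phi> y"
    and "\<iota> = \<phi> \<circ> rat_const"
    and "genus \<iota> \<ge> 1"
    and "bij_betw P {1..r} {p. zero_or_pole f p}"
    and "n \<le> r"
    and "\<forall>k\<in>{1..n}. totally_ramified rat_const \<phi> (P k) \<and> lies_over rat_const \<phi> (Q k) (P k)"
    and "inj_on Q {1..n}"
    and "2 \<le> n" and "n \<le> card (UNIV :: 'a set)"
    and "\<And>k i. t k i = tk m (lam f P) k i"
    and "\<And>i. \<beta> i = beta m r (lam f P) i"
    and "D = (\<Sum>k=1..n. Poly_Mapping.single (Q k) (\<alpha>' k))"
  shows
    "(non_special \<iota> D \<and> div_degree \<iota> D = genus \<iota> - 1 \<longleftrightarrow>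
        (\<Sum>k=1..n. \<lfloor>real_of_int (\<alpha>' k) / real m\<rfloor>) = -1 \<and>
        (\<forall>i\<in>{1..m-1}.
           int n + (\<Sum>k=1..n. \<lfloor>real_of_int (\<alpha>' k - t k i) / real m\<rfloor>) = \<beta> i)) \<and>
     (\<forall>j \<alpha> :: nat \<Rightarrow> int.
        (\<forall>k\<in>{1..n}. \<alpha>' k = int m * j k + \<alpha> k \<and> 0 \<le> \<alpha> k \<and> \<alpha> k \<le> int m - 1) \<longrightarrow>
        (non_special \<iota> D \<and> div_degree \<iota> D = genus \<iota> - 1 \<longleftrightarrow>
           (\<Sum>k=1..n. j k) = -1 \<and>
           (\<forall>i\<in>{1..m-1}.
              \<beta> i = int n - 1 + (\<Sum>k=1..n. \<lfloor>real_of_int (\<alpha> k - t k i) / real m\<rfloor>))))"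
proof -
  have m0: "0 < m" using assms(1) by simp
  have f0: "f \<noteq> 0" using assms(3) by auto
  obtain k0 a0 where "kummer_curve \<phi> (inverse y) m (inverse (to_fract f)) {a. poly f a = 0} P Q n r k0 a0"
    using kummer_curve_if_totally_ramified[OF assms(1-6,9,10,13,11)] by blast
  then interpret C: kummer_curve \<phi> "inverse y" m "inverse (to_fract f)" "{a. poly f a = 0}" P Q n r k0 a0 .
  let ?l = "lam f P"
  have mu: "C.\<mu> k = - ?l k" if "k \<in> {1..r}" for k
  proof -
    interpret dplace "P k" using rat_discrete[OF C.P_place[OF that]] by unfold_locales
    show ?thesis using f0 by (simp add: C.\<mu>_def lam_def val_inverse)
  qed
  have cop: "coprime (int m) (?l k)" if "k \<in> {1..n}" for k
    using C.cop[OF that] mu[of k] that assms(10) by (simp add: C.\<mu>_def)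
  have N: "C.N \<alpha>' i = (\<Sum>k=1..r. ((if k \<le> n then \<alpha>' k else 0) + int i * - ?l k) div int m)" for i
    unfolding C.N_def C.ext_def using mu by (intro sum.cong) auto
  have D: "D = C.D \<alpha>'" unfolding C.D_def by (rule assms(17))
  have range: "(\<forall>i<m. C.N \<alpha>' i = -1) \<longleftrightarrow> C.N \<alpha>' 0 = -1 \<and> (\<forall>i\<in>{1..m-1}. C.N \<alpha>' i = -1)"
  proof (intro iffI conjI allI impI)
    fix i assume "C.N \<alpha>' 0 = -1 \<and> (\<forall>i\<in>{1..m-1}. C.N \<alpha>' i = -1)" "i < m"
    then show "C.N \<alpha>' i = -1" by (cases "i = 0") auto
  qed (use m0 in auto)
  have zero: "C.N \<alpha>' 0 = (\<Sum>k=1..n. \<lfloor>real_of_int (\<alpha>' k) / real m\<rfloor>)"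
    unfolding N condition_zero[OF assms(10), symmetric] by simp
  have pos: "C.N \<alpha>' i = -1 \<longleftrightarrow> int n + (\<Sum>k=1..n. \<lfloor>real_of_int (\<alpha>' k - t k i) / real m\<rfloor>) = \<beta> i"
    if "i \<in> {1..m-1}" for i
    unfolding N assms(15,16) using that m0 by (intro condition_positive[OF m0 assms(10) cop]) auto
  have i: "non_special \<iota> D \<and> div_degree \<iota> D = genus \<iota> - 1 \<longleftrightarrow>
        (\<Sum>k=1..n. \<lfloor>real_of_int (\<alpha>' k) / real m\<rfloor>) = -1 \<and>
        (\<forall>i\<in>{1..m-1}.
           int n + (\<Sum>k=1..n. \<lfloor>real_of_int (\<alpha>' k - t k i) / real m\<rfloor>) = \<beta> i)"
    unfolding assms(7) D C.non_special_iff range zero using pos by blast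
  have fl: "\<lfloor>real_of_int a / real m\<rfloor> = a div int m" for a
    using floor_divide_of_int_eq[of a "int m", where 'a = real] by simp
  have ii: "non_special \<iota> D \<and> div_degree \<iota> D = genus \<iota> - 1 \<longleftrightarrow>
           (\<Sum>k=1..n. j k) = -1 \<and>
           (\<forall>i\<in>{1..m-1}.
              \<beta> i = int n - 1 + (\<Sum>k=1..n. \<lfloor>real_of_int (\<alpha> k - t k i) / real m\<rfloor>))"
    if h: "\<forall>k\<in>{1..n}. \<alpha>' k = int m * j k + \<alpha> k \<and> 0 \<le> \<alpha> k \<and> \<alpha> k \<le> int m - 1" for j \<alpha> :: "nat \<Rightarrow> int"
  proof -
    have 1: "(\<Sum>k=1..n. \<lfloor>real_of_int (\<alpha>' k) / real m\<rfloor>) = (\<Sum>k=1..n. j k)"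
      unfolding fl using h m0 by (intro sum.cong refl) (auto simp: div_pos_pos_trivial)
    have 2: "(\<Sum>k=1..n. \<lfloor>real_of_int (\<alpha>' k - t k i) / real m\<rfloor>) =
        (\<Sum>k=1..n. j k) + (\<Sum>k=1..n. \<lfloor>real_of_int (\<alpha> k - t k i) / real m\<rfloor>)" for i
      unfolding fl sum.distrib[symmetric]
    proof (intro sum.cong refl)
      fix k assume "k \<in> {1..n}"
      then have e: "\<alpha>' k - t k i = (\<alpha> k - t k i) + int m * j k" using h by auto
      show "(\<alpha>' k - t k i) div int m = j k + (\<alpha> k - t k i) div int m" unfolding e using m0 by simp
    qed
    \<comment> \<open>The multiples m j_k leave the floors as the sum of the j_k, which is -1; this
      turns n in (i) into n - 1 in (ii).\<close>
    show ?thesis unfolding i 1 2 by (auto simp: algebra_simps)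
  qed
  show ?thesis using i ii by blast
qed

end
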